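(* Let $\mathcal{A}$ be a cluster algebra with upper cluster algebra $\mathcal{U}$ and deep ideal $\mathbb{D}\subset\mathcal{A}$, and let $\mathcal{S}$ be a Noetherian ring such that $\mathcal{A}\subseteq\mathcal{S}\subseteq\mathcal{U}$. Then the following are equivalent. (1) $\mathcal{S}=\mathcal{U}$. (2) $\mathcal{S}$ is normal and $\mathrm{codim}(\mathcal{S}\mathbb{D})\geq 2$. (3) $\mathcal{S}$ is $S2$ and $\mathrm{codim}(\mathcal{S}\mathbb{D})\geq 2$. (4) $\mathrm{Ext}^1_{\mathcal{S}}(\mathcal{S}/\mathcal{S}\mathbb{D},\mathcal{S})=0$. (5) $\mathcal{S}f=(\mathcal{S}f:(\mathcal{S}\mathbb{D})^\infty)$, where $f:=x_1x_2\cdots x_m$ for some cluster $\mathbf{x}=\{x_1,\dots,x_n\}$ of $\mathcal{A}$. Moreover, if $\mathcal{S}f\neq(\mathcal{S}f:(\mathcal{S}\mathbb{D})^\infty)$, then $(\mathcal{S}f:(\mathcal{S}\mathbb{D})^\infty)f^{-1}$ contains elements of $\mathcal{U}$ not in $\mathcal{S}$.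
   Context: All rings are commutative and unital. Seeds. Let $n\ge m\ge 0$ be integers. A matrix $M\in \mathrm{Mat}_{m,m}(\mathbb{Z})$ is skew-symmetrizable if there is a diagonal integer matrix $D$ with positive diagonal entries such that $DM$ is skew-symmetric. An ordered seed is a pair $(\mathbf{x},B)$ where $B\in \mathrm{Mat}_{n,m}(\mathbb{Z})$ has skew-symmetrizable principal part (the top $m\times m$ submatrix), and $\mathbf{x}=(x_1,\dots,x_n)$ is an $n$-tuple of elements of a field $\mathcal{F}$ of characteristic zero which freely generates $\mathcal{F}$ as a field over $\mathbb{Q}$. The variable $x_i$ is mutable if $1\le i\le m$ and frozen if $m<i\le n$. Mutation. For $1\le k\le m$ the mutation of $(\mathbf{x},B)$ at $k$ is the ordered seed $(\mathbf{x}',B')$ with $x_i'=x_i$ for $i\neq k$, $x_k'=\left(\prod_{B_{jk}>0}x_j^{B_{jk}}+\prod_{B_{jk}<0}x_j^{-B_{jk}}\right)x_k^{-1}$, and $B'_{ij}=-B_{ij}$ if $i=k$ or $j=k$, $B'_{ij}=B_{ij}+\frac{|B_{ik}|B_{kj}+B_{ik}|B_{kj}|}{2}$ otherwise. Two ordered seeds are mutation-equivalent if one is obtained from the other by a sequence of mutations and of permutations of the indices preserving $\{1,\dots,m\}$ (acting simultaneously on $\mathbf{x}$ and on the rows and columns of $B$). Algebras. The cluster algebra $\mathcal{A}=\mathcal{A}(\mathbf{x},B)$ is the subring of $\mathcal{F}$ generated by all entries of $\mathbf{y}$ for all $(\mathbf{y},C)$ mutation-equivalent to $(\mathbf{x},B)$,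 together with the inverses $x_i^{-1}$, $m<i\le n$, of the frozen variables. A cluster of $\mathcal{A}$ is the set $\{x_1,\dots,x_n\}$ of variables of some seed mutation-equivalent to $(\mathbf{x},B)$, with $x_1,\dots,x_m$ its mutable variables. The upper cluster algebra is $\mathcal{U}=\bigcap_{\text{clusters }\{x_1,\dots,x_n\}}\mathbb{Z}[x_1^{\pm1},\dots,x_n^{\pm1}]\subset\mathcal{F}$. The deep ideal is $\mathbb{D}=\sum_{\text{clusters }\{x_1,\dots,x_n\}}\mathcal{A}\,x_1x_2\cdots x_m$, an ideal of $\mathcal{A}$; $\mathcal{S}\mathbb{D}$ is the ideal it generates in $\mathcal{S}$. Saturation. For ideals $I,J$ of a ring $R$, $(J:I^\infty)=\{r\in R\mid \forall g\in I,\ \exists k\in\mathbb{N}\text{ such that } rg^k\in J\}$. $S2$ is Serre's condition; $\mathrm{codim}$ of an ideal is the minimum height of a prime containing it (with $\mathrm{codim}$ of the unit ideal $=\infty$). *)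

theory Defs
  imports
    "HOL-Algebra.Ring_Divisibility"
    "HOL-Algebra.Generated_Rings"
    "HOL-Algebra.Generated_Fields"
    "HOL-Algebra.QuotRing"
    "HOL-Algebra.Elementary_Groups"
    "HOL-Algebra.Module"
    "HOL-Algebra.Algebraic_Closure_Type"
    "HOL-Combinatorics.Permutations"
    "HOL-Library.Poly_Mapping"
    "HOL-Library.Extended_Nat"
begin

section \<open>Commutative algebra\<close>

subsection \<open>Height, codimension, depth, saturation\<close>

definition height :: "('r, 'c) ring_scheme \<Rightarrow> 'r set \<Rightarrow> enat" where
  "height R P = (SUP k \<in> {k. \<exists>Q :: nat \<Rightarrow> 'r set.
     (\<forall>i\<le>k. primeideal (Q i) R) \<and> (\<forall>i<k. Q i \<subset> Q (Suc i)) \<and> Q k = P}. enat k)"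

definition krull_dim :: "('r, 'c) ring_scheme \<Rightarrow> enat" where
  "krull_dim R = (SUP P \<in> {P. primeideal P R}. height R P)"

text \<open>The infimum of the empty set of heights is \<open>\<infinity>\<close>; this is the value at the unit ideal.\<close>

definition codim :: "('r, 'c) ring_scheme \<Rightarrow> 'r set \<Rightarrow> enat" where
  "codim R I = (INF P \<in> {P. primeideal P R \<and> I \<subseteq> P}. height R P)"

definition regular_sequence :: "('r, 'c) ring_scheme \<Rightarrow> 'r list \<Rightarrow> bool" where
  "regular_sequence R rs \<longleftrightarrow>
     set rs \<subseteq> carrier R \<and>
     (\<forall>i < length rs. \<forall>a \<in> carrier R.
        rs ! i \<otimes>\<^bsub>R\<^esub> a \<in> genideal R (set (take i rs)) \<longrightarrow> a \<in> genideal R (set (take i rs))) \<and>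
     genideal R (set rs) \<noteq> carrier R"

definition depth :: "('r, 'c) ring_scheme \<Rightarrow> 'r set \<Rightarrow> enat" where
  "depth R I = (SUP rs \<in> {rs. regular_sequence R rs \<and> set rs \<subseteq> I}. enat (length rs))"

definition saturation :: "('r, 'c) ring_scheme \<Rightarrow> 'r set \<Rightarrow> 'r set \<Rightarrow> 'r set" where
  "saturation R J I = {r \<in> carrier R. \<forall>g \<in> I. \<exists>k :: nat. r \<otimes>\<^bsub>R\<^esub> (g [^]\<^bsub>R\<^esub> k) \<in> J}"


subsection \<open>Subrings of a field\<close>

abbreviation ring_on :: "'a::field set \<Rightarrow> 'a ring" where
  "ring_on S \<equiv> ring_of_type_algebra\<lparr>carrier := S\<rparr>"

definition integral_over :: "'a::field set \<Rightarrow> 'a \<Rightarrow> bool" where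
  "integral_over S z \<longleftrightarrow>
     (\<exists>p. (\<forall>i. Polynomial.coeff p i \<in> S) \<and> Polynomial.lead_coeff p = 1 \<and> Polynomial.poly p z = 0)"

definition fractions :: "'a::field set \<Rightarrow> 'a set" where
  "fractions S = {a / b | a b. a \<in> S \<and> b \<in> S \<and> b \<noteq> 0}"

definition normal_subring :: "'a::field set \<Rightarrow> bool" where
  "normal_subring S \<longleftrightarrow> (\<forall>z \<in> fractions S. integral_over S z \<longrightarrow> z \<in> S)"

text \<open>For a subring \<open>S\<close> of a field, a prime \<open>P\<close> of \<open>S\<close> and an ideal \<open>I\<close> of \<open>S\<close>,
  \<open>localize_at S P I\<close> is the localized ideal \<open>I\<^sub>P\<close>, realised inside the field. In particular
  \<open>localize_at S P S\<close> is the local ring \<open>S\<^sub>P\<close> and \<open>localize_at S P P\<close> its maximal ideal.\<close>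

definition localize_at :: "'a::field set \<Rightarrow> 'a set \<Rightarrow> 'a set \<Rightarrow> 'a set" where
  "localize_at S P I = {a / b | a b. a \<in> I \<and> b \<in> S - P}"

definition serre_S :: "nat \<Rightarrow> 'a::field set \<Rightarrow> bool" where
  "serre_S k S \<longleftrightarrow> (\<forall>P. primeideal P (ring_on S) \<longrightarrow>
     min (enat k) (krull_dim (ring_on (localize_at S P S)))
       \<le> depth (ring_on (localize_at S P S)) (localize_at S P P))"


subsection \<open>The first Ext group\<close>

text \<open>\<open>Ext1 R M N\<close> is the first cohomology of \<open>Hom(F\<^sub>\<bullet>, N)\<close>, where
  \<open>F\<^sub>2 \<rightarrow> F\<^sub>1 \<rightarrow> F\<^sub>0 \<rightarrow> M \<rightarrow> 0\<close> is the beginning of the standard free resolution of \<open>M\<close>: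
  \<open>F\<^sub>0\<close> is free on the underlying set of \<open>M\<close>, \<open>F\<^sub>1\<close> is free on the underlying set of the kernel of
  \<open>F\<^sub>0 \<rightarrow> M\<close>, and \<open>F\<^sub>2\<close> on that of the kernel of \<open>F\<^sub>1 \<rightarrow> F\<^sub>0\<close>.
  Only the additive and scalar fields of a module record are meaningful; the
  ring multiplication and unit fields play no role.\<close>

definition self_module :: "('r, 'c) ring_scheme \<Rightarrow> ('r, 'r) module" where
  "self_module R = \<lparr>carrier = carrier R, monoid.mult = monoid.mult R, one = one R,
     ring.zero = ring.zero R, add = add R, module.smult = monoid.mult R\<rparr>"

definition quotient_module :: "('r, 'c) ring_scheme \<Rightarrow> 'r set \<Rightarrow> ('r, 'r set) module" where
  "quotient_module R I = \<lparr>carrier = carrier (R Quot I), monoid.mult = monoid.mult (R Quot I),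
     one = one (R Quot I), ring.zero = ring.zero (R Quot I), add = add (R Quot I),
     module.smult = (\<lambda>r A. (I +>\<^bsub>R\<^esub> r) \<otimes>\<^bsub>R Quot I\<^esub> A)\<rparr>"

definition free_module :: "('r, 'c) ring_scheme \<Rightarrow> 'x set \<Rightarrow> ('r, 'x \<Rightarrow> 'r) module" where
  "free_module R A = \<lparr>
     carrier = {c. range c \<subseteq> carrier R \<and> finite {x. c x \<noteq> \<zero>\<^bsub>R\<^esub>} \<and> {x. c x \<noteq> \<zero>\<^bsub>R\<^esub>} \<subseteq> A},
     monoid.mult = undefined, one = undefined,
     ring.zero = (\<lambda>x. \<zero>\<^bsub>R\<^esub>), add = (\<lambda>c d x. c x \<oplus>\<^bsub>R\<^esub> d x), module.smult = (\<lambda>r c x. r \<otimes>\<^bsub>R\<^esub> c x)\<rparr>"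

definition free_cover :: "('r, 'c) ring_scheme \<Rightarrow> ('r, 'm, 'd) module_scheme \<Rightarrow> ('m \<Rightarrow> 'r) \<Rightarrow> 'm" where
  "free_cover R M c = (\<Oplus>\<^bsub>M\<^esub>x \<in> {x. c x \<noteq> \<zero>\<^bsub>R\<^esub>}. c x \<odot>\<^bsub>M\<^esub> x)"

definition syzygy :: "('r, 'c) ring_scheme \<Rightarrow> ('r, 'm, 'd) module_scheme \<Rightarrow> ('r, 'm \<Rightarrow> 'r) module" where
  "syzygy R M = free_module R (carrier M)
     \<lparr>carrier := {c \<in> carrier (free_module R (carrier M)). free_cover R M c = \<zero>\<^bsub>M\<^esub>}\<rparr>"

definition linear_maps ::
  "('r, 'c) ring_scheme \<Rightarrow> ('r, 'm, 'd) module_scheme \<Rightarrow> ('r, 'n, 'e) module_scheme \<Rightarrow> ('m \<Rightarrow> 'n) set"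
where
  "linear_maps R M N = {h \<in> carrier M \<rightarrow>\<^sub>E carrier N.
     (\<forall>x \<in> carrier M. \<forall>y \<in> carrier M. h (x \<oplus>\<^bsub>M\<^esub> y) = h x \<oplus>\<^bsub>N\<^esub> h y) \<and>
     (\<forall>r \<in> carrier R. \<forall>x \<in> carrier M. h (r \<odot>\<^bsub>M\<^esub> x) = r \<odot>\<^bsub>N\<^esub> h x)}"

definition Hom_group ::
  "('r, 'c) ring_scheme \<Rightarrow> ('r, 'm, 'd) module_scheme \<Rightarrow> ('r, 'n, 'e) module_scheme \<Rightarrow> ('m \<Rightarrow> 'n) monoid"
where
  "Hom_group R M N = \<lparr>carrier = linear_maps R M N,
     monoid.mult = (\<lambda>g h. \<lambda>x \<in> carrier M. g x \<oplus>\<^bsub>N\<^esub> h x),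
     one = (\<lambda>x \<in> carrier M. \<zero>\<^bsub>N\<^esub>)\<rparr>"

definition Ext1 ::
  "('r, 'c) ring_scheme \<Rightarrow> ('r, 'm, 'd) module_scheme \<Rightarrow> ('r, 'n, 'e) module_scheme
     \<Rightarrow> ((('m \<Rightarrow> 'r) \<Rightarrow> 'r) \<Rightarrow> 'n) set monoid"
where
  "Ext1 R M N =
    (let K = syzygy R M; L = syzygy R K;
         F0 = free_module R (carrier M); F1 = free_module R (carrier K); F2 = free_module R (carrier L);
         d1 = free_cover R K; d2 = free_cover R L;
         cocycles = {\<phi> \<in> linear_maps R F1 N. \<forall>c \<in> carrier F2. \<phi> (d2 c) = \<zero>\<^bsub>N\<^esub>};
         coboundaries = {\<lambda>c \<in> carrier F1. \<psi> (d1 c) | \<psi>. \<psi> \<in> linear_maps R F0 N}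
     in (Hom_group R F1 N)\<lparr>carrier := cocycles\<rparr> Mod coboundaries)"


section \<open>Seeds and mutation\<close>

text \<open>Indices run from \<open>0\<close>: the mutable ones are \<open>i < m\<close> and the frozen ones \<open>m \<le> i < n\<close>.
  The values of \<open>x\<close> outside \<open>i < n\<close> and of \<open>B\<close> outside \<open>i < n\<close>, \<open>j < m\<close> are irrelevant.\<close>

type_synonym 'a seed = "(nat \<Rightarrow> 'a) \<times> (nat \<Rightarrow> nat \<Rightarrow> int)"

definition skew_symmetrizable :: "nat \<Rightarrow> (nat \<Rightarrow> nat \<Rightarrow> int) \<Rightarrow> bool" where
  "skew_symmetrizable m M \<longleftrightarrow>
     (\<exists>d :: nat \<Rightarrow> int. (\<forall>i<m. d i > 0) \<and> (\<forall>i<m. \<forall>j<m. d i * M i j = - (d j * M j i)))"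

definition eval_poly :: "(nat \<Rightarrow> 'a::field_char_0) \<Rightarrow> ((nat \<Rightarrow>\<^sub>0 nat) \<Rightarrow>\<^sub>0 rat) \<Rightarrow> 'a" where
  "eval_poly x p = (\<Sum>\<alpha> \<in> Poly_Mapping.keys p.
     of_rat (Poly_Mapping.lookup p \<alpha>) * (\<Prod>i \<in> Poly_Mapping.keys \<alpha>. x i ^ Poly_Mapping.lookup \<alpha> i))"

definition algebraically_independent :: "nat \<Rightarrow> (nat \<Rightarrow> 'a::field_char_0) \<Rightarrow> bool" where
  "algebraically_independent n x \<longleftrightarrow>
     (\<forall>p. (\<forall>\<alpha> \<in> Poly_Mapping.keys p. Poly_Mapping.keys \<alpha> \<subseteq> {..<n}) \<and> eval_poly x p = 0 \<longrightarrow> p = 0)"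

text \<open>A subfield of a field of characteristic zero automatically contains the rationals, so
  \<open>generate_field\<close> is generation as a field over \<open>\<rat>\<close>.\<close>

definition freely_generates :: "nat \<Rightarrow> (nat \<Rightarrow> 'a::field_char_0) \<Rightarrow> bool" where
  "freely_generates n x \<longleftrightarrow>
     algebraically_independent n x \<and> generate_field ring_of_type_algebra (x ` {..<n}) = UNIV"

definition ordered_seed :: "nat \<Rightarrow> nat \<Rightarrow> 'a::field_char_0 seed \<Rightarrow> bool" where
  "ordered_seed n m = (\<lambda>(x, B). m \<le> n \<and> skew_symmetrizable m B \<and> freely_generates n x)"

text \<open>In the second component the numerator is always even, so \<open>div\<close> is exact division.\<close>

definition mutation :: "nat \<Rightarrow> nat \<Rightarrow> 'a::field_char_0 seed \<Rightarrow> 'a seed" where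
  "mutation n k = (\<lambda>(x, B).
     (x(k := ((\<Prod>j | j < n \<and> B j k > 0. x j ^ nat (B j k)) +
              (\<Prod>j | j < n \<and> B j k < 0. x j ^ nat (- B j k))) * inverse (x k)),
      \<lambda>i j. if i = k \<or> j = k then - B i j
             else B i j + (\<bar>B i k\<bar> * B k j + B i k * \<bar>B k j\<bar>) div 2))"

definition permute_seed :: "(nat \<Rightarrow> nat) \<Rightarrow> 'a seed \<Rightarrow> 'a seed" where
  "permute_seed \<sigma> = (\<lambda>(x, B). (\<lambda>i. x (\<sigma> i), \<lambda>i j. B (\<sigma> i) (\<sigma> j)))"

inductive mutation_equivalent :: "nat \<Rightarrow> nat \<Rightarrow> 'a::field_char_0 seed \<Rightarrow> 'a seed \<Rightarrow> bool"
  for n m :: nat and s :: "'a seed"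
where
  refl: "mutation_equivalent n m s s"
| mutate: "mutation_equivalent n m s t \<Longrightarrow> k < m \<Longrightarrow> mutation_equivalent n m s (mutation n k t)"
| permute: "mutation_equivalent n m s t \<Longrightarrow> \<sigma> permutes {..<n} \<Longrightarrow> \<sigma> ` {..<m} = {..<m}
    \<Longrightarrow> mutation_equivalent n m s (permute_seed \<sigma> t)"


section \<open>Cluster algebras\<close>

text \<open>Clusters are kept in the order given by their seed; this records which variables are mutable.\<close>

definition clusters :: "nat \<Rightarrow> nat \<Rightarrow> 'a::field_char_0 seed \<Rightarrow> (nat \<Rightarrow> 'a) set" where
  "clusters n m s = {y. \<exists>C. mutation_equivalent n m s (y, C)}"

definition cluster_algebra :: "nat \<Rightarrow> nat \<Rightarrow> 'a::field_char_0 seed \<Rightarrow> 'a set" where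
  "cluster_algebra n m s = generate_ring ring_of_type_algebra
     ((\<Union>y \<in> clusters n m s. y ` {..<n}) \<union> (\<lambda>i. inverse (fst s i)) ` {m..<n})"

definition laurent_ring :: "nat \<Rightarrow> (nat \<Rightarrow> 'a::field_char_0) \<Rightarrow> 'a set" where
  "laurent_ring n y = generate_ring ring_of_type_algebra (y ` {..<n} \<union> (\<lambda>i. inverse (y i)) ` {..<n})"

definition upper_cluster_algebra :: "nat \<Rightarrow> nat \<Rightarrow> 'a::field_char_0 seed \<Rightarrow> 'a set" where
  "upper_cluster_algebra n m s = (\<Inter>y \<in> clusters n m s. laurent_ring n y)"

definition mutable_product :: "nat \<Rightarrow> (nat \<Rightarrow> 'a::field_char_0) \<Rightarrow> 'a" where
  "mutable_product m y = (\<Prod>i<m. y i)"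

definition deep_ideal :: "nat \<Rightarrow> nat \<Rightarrow> 'a::field_char_0 seed \<Rightarrow> 'a set" where
  "deep_ideal n m s =
     genideal (ring_on (cluster_algebra n m s)) (mutable_product m ` clusters n m s)"

end

(*
  For a cluster with product f of mutable variables, A[1/f] contains the Laurent ring of that
  cluster, so U consists of the u with u f^k in S for some k, for every cluster. The rest is
  commutative algebra of the Noetherian domain S and the ideal I generated by the elements f.

  Among the conductors (S : u) with u in U - S a maximal one is prime and contains I. So S = U
  holds iff uI <= S implies u in S; this is what Ext^1(S/I, S) = 0 says once Ext^1 is computed
  from the syzygies of S/I, and a power of f turns any u in U - S into an element of the
  saturation. If P = (S : u) is such a prime, P S_P has depth 1, so S2 and codim I >= 2 exclude it.
  Conversely, if P contains I and has height 1, then P is itself the conductor of an element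
  outside S, since a maximal conductor of an element of f^-1 S - S_P is a nonzero prime inside P.

  Normal Noetherian domains are S2: if P S_P has depth 1, prime avoidance gives P = (S : u) with
  u outside S; a nonzero prime Q strictly below P would satisfy uQ <= Q, so u would be integral.
  U is normal as an intersection of Laurent rings; these are localizations of polynomial rings
  over the integers, which are completely integrally closed by adjoining one variable at a time.
*)
theory Submission
  imports Defs
begin

section \<open>Subrings of a field\<close>

text \<open>Nothing leaves the ambient field: localizations are subsets of it, and an associated
  prime of a module such as \<open>f^-1 S / S\<close> is the conductor of a field element. The
  Noetherian hypothesis then enters only as the existence of maximal members in families of ideals,
  and lower bounds on heights come from exhibiting a prime strictly between {0} and P. Two obstacles
  shape the rest. Normality of a polynomial ring is awkward to reach through monic equations,
  whereas complete integral closedness speaks of the powers of one element, which leading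
  coefficients and division with remainder can handle. And free generation is given for the initial
  seed only, as the absence of a relation in n variables; under a mutation a fraction would have to
  be substituted into such a relation. Transcendence of each variable over the ring generated by the
  others follows from it and is changed by a mutation only through t -> P/t, so this form is carried
  along all mutations.\<close>

lemma ring_on_simps [simp]:
  "carrier (ring_on S) = S"
  "monoid.mult (ring_on S) x y = x * y"
  "one (ring_on S) = 1"
  "ring.zero (ring_on S) = 0"
  "add (ring_on S) x y = x + y"
  by (simp_all add: ring_of_type_algebra_def)

lemma ring_of_type_algebra_simps [simp]:
  "carrier ring_of_type_algebra = UNIV"
  "monoid.mult ring_of_type_algebra = (*)"
  "one ring_of_type_algebra = 1"
  "ring.zero ring_of_type_algebra = 0"
  "add ring_of_type_algebra = (+)"
  by (simp_all add: ring_of_type_algebra_def)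

locale field_subring =
  fixes S :: "'a::field set"
  assumes one_mem [simp]: "1 \<in> S"
    and diff_mem: "a \<in> S \<Longrightarrow> b \<in> S \<Longrightarrow> a - b \<in> S"
    and mult_mem [simp]: "a \<in> S \<Longrightarrow> b \<in> S \<Longrightarrow> a * b \<in> S"
begin

lemma zero_mem [simp]: "0 \<in> S"
  using diff_mem[OF one_mem one_mem] by simp

lemma uminus_mem [simp]: "a \<in> S \<Longrightarrow> - a \<in> S"
  using diff_mem[OF zero_mem] by force

lemma add_mem [simp]: "a \<in> S \<Longrightarrow> b \<in> S \<Longrightarrow> a + b \<in> S"
  using diff_mem[OF _ uminus_mem] by force

lemma power_mem [simp]: "a \<in> S \<Longrightarrow> a ^ k \<in> S"
  by (induction k) auto

lemma sum_mem: "(\<And>i. i \<in> A \<Longrightarrow> f i \<in> S) \<Longrightarrow> sum f A \<in> S"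
  by (induction A rule: infinite_finite_induct) auto

lemma prod_mem: "(\<And>i. i \<in> A \<Longrightarrow> f i \<in> S) \<Longrightarrow> prod f A \<in> S"
  by (induction A rule: infinite_finite_induct) auto

lemma of_nat_mem [simp]: "of_nat k \<in> S"
  by (induction k) auto

lemma of_int_mem [simp]: "of_int k \<in> S"
  by (cases k rule: int_cases2) auto

lemma ring_on_cring: "cring (ring_on S)"
  by (unfold_locales)
    (auto simp: algebra_simps Units_def intro!: exI[of _ "- _"] bexI[of _ "- _"])

lemma ring_on_domain: "domain (ring_on S)"
proof -
  interpret cring "ring_on S" by (rule ring_on_cring)
  show ?thesis by unfold_locales auto
qed

text \<open>The rewrites let general facts about domains be read directly in the operations of the
  field.\<close>

sublocale R: domain "ring_on S"
  rewrites "carrier (ring_on S) = S"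
    and "monoid.mult (ring_on S) = (*)"
    and "one (ring_on S) = 1"
    and "ring.zero (ring_on S) = 0"
    and "add (ring_on S) = (+)"
  by (auto simp: ring_on_domain)

lemma nat_pow_eq [simp]: "x [^]\<^bsub>ring_on S\<^esub> (k :: nat) = x ^ k"
  by (induction k) (auto simp: nat_pow_def mult.commute)

lemma ideal_iff:
  "ideal I (ring_on S) \<longleftrightarrow>
     I \<subseteq> S \<and> 0 \<in> I \<and> (\<forall>a\<in>I. \<forall>b\<in>I. a + b \<in> I) \<and> (\<forall>s\<in>S. \<forall>a\<in>I. s * a \<in> I)"
  (is "?l \<longleftrightarrow> ?r")
proof
  assume ?l
  then interpret ideal I "ring_on S" .
  show ?r
    using a_subset a_closed I_l_closed zero_closed by auto
next
  assume r: ?r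
  show ?l
  proof (rule idealI)
    show "ring (ring_on S)" by (rule R.ring_axioms)
    have neg: "- a \<in> I" if "a \<in> I" for a
      using r that uminus_mem[OF one_mem] by (metis mult_minus1)
    have inv: "inv\<^bsub>add_monoid (ring_on S)\<^esub> a = - a" if "a \<in> I" for a
    proof -
      have "a \<in> S" using r that by auto
      then show ?thesis
        using R.minus_equality[of "-a" a] by (simp add: a_inv_def)
    qed
    show "subgroup I (add_monoid (ring_on S))"
      by unfold_locales (use r neg inv in auto)
    show "x \<otimes>\<^bsub>ring_on S\<^esub> a \<in> I" "a \<otimes>\<^bsub>ring_on S\<^esub> x \<in> I" if "a \<in> I" "x \<in> carrier (ring_on S)" for a x
      using r that by (auto simp: mult.commute[of a])
  qed
qed

lemma idealD:
  assumes "ideal I (ring_on S)"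
  shows "I \<subseteq> S" "0 \<in> I" "a \<in> I \<Longrightarrow> b \<in> I \<Longrightarrow> a + b \<in> I" "s \<in> S \<Longrightarrow> a \<in> I \<Longrightarrow> s * a \<in> I"
    "s \<in> S \<Longrightarrow> a \<in> I \<Longrightarrow> a * s \<in> I"
  using assms unfolding ideal_iff by (auto simp: mult.commute)

lemma ideal_sum:
  assumes "ideal I (ring_on S)" "\<And>i. i \<in> A \<Longrightarrow> f i \<in> I"
  shows "sum f A \<in> I"
  using assms(2) by (induction A rule: infinite_finite_induct) (auto intro: idealD[OF assms(1)])

lemma primeideal_iff:
  "primeideal I (ring_on S) \<longleftrightarrow>
     ideal I (ring_on S) \<and> 1 \<notin> I \<and> (\<forall>a\<in>S. \<forall>b\<in>S. a * b \<in> I \<longrightarrow> a \<in> I \<or> b \<in> I)"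
  (is "?l \<longleftrightarrow> ?r")
proof
  assume ?l
  then interpret primeideal I "ring_on S" .
  have "1 \<notin> I"
    using one_imp_carrier I_notcarr by auto
  then show ?r
    using I_prime is_ideal by auto
next
  assume ?r
  then show ?l
    by (intro primeidealI) (auto simp: R.cring_axioms)
qed

lemma primeidealD:
  assumes "primeideal I (ring_on S)"
  shows "ideal I (ring_on S)" "1 \<notin> I" "a \<in> S \<Longrightarrow> b \<in> S \<Longrightarrow> a * b \<in> I \<Longrightarrow> a \<in> I \<or> b \<in> I"
  using assms unfolding primeideal_iff by auto

lemma prime_power_mem:
  assumes "primeideal P (ring_on S)" "a \<in> S" "a ^ k \<in> P"
  shows "a \<in> P"
  using assms(3)
proof (induction k)
  case 0
  then show ?case using primeidealD(2)[OF assms(1)] by simp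
next
  case (Suc k)
  then show ?case using primeidealD(3)[OF assms(1), of a "a ^ k"] assms(2) by auto
qed

lemma cgenideal_eq: "cgenideal (ring_on S) f = {s * f | s. s \<in> S}"
  by (simp add: cgenideal_def)

lemma genideal_minimal': "ideal I (ring_on S) \<Longrightarrow> A \<subseteq> I \<Longrightarrow> genideal (ring_on S) A \<subseteq> I"
  by (rule R.genideal_minimal)

lemma genideal_finite:
  assumes "finite A" "A \<subseteq> S"
  shows "genideal (ring_on S) A = {\<Sum>a\<in>A. s a * a | s. s \<in> A \<rightarrow> S}" (is "_ = ?J")
proof
  have "ideal ?J (ring_on S)"
    unfolding ideal_iff
  proof (intro conjI ballI)
    show "?J \<subseteq> S" using assms by (auto intro!: sum_mem)
    show "0 \<in> ?J" by (auto intro!: exI[of _ "\<lambda>_. 0"])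
    show "x + y \<in> ?J" if "x \<in> ?J" "y \<in> ?J" for x y
    proof -
      obtain s t where "x = (\<Sum>a\<in>A. s a * a)" "y = (\<Sum>a\<in>A. t a * a)" "s \<in> A \<rightarrow> S" "t \<in> A \<rightarrow> S"
        using \<open>x \<in> ?J\<close> \<open>y \<in> ?J\<close> by auto
      then show ?thesis
        by (auto intro!: exI[of _ "\<lambda>a. s a + t a"] simp: algebra_simps sum.distrib)
    qed
    show "c * x \<in> ?J" if "c \<in> S" "x \<in> ?J" for c x
    proof -
      obtain s where "x = (\<Sum>a\<in>A. s a * a)" "s \<in> A \<rightarrow> S"
        using \<open>x \<in> ?J\<close> by auto
      then show ?thesis using \<open>c \<in> S\<close>
        by (auto intro!: exI[of _ "\<lambda>a. c * s a"] simp: algebra_simps sum_distrib_left)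
    qed
  qed
  moreover have "A \<subseteq> ?J"
  proof
    fix b assume b: "b \<in> A"
    have "(\<Sum>a\<in>A. (if a = b then 1 else 0) * a) = b"
      using assms b by (simp add: if_distrib[of "\<lambda>x. x * _"] cong: if_cong)
    then show "b \<in> ?J"
      by (auto intro!: exI[of _ "\<lambda>a. if a = b then 1 else 0"])
  qed
  ultimately show "genideal (ring_on S) A \<subseteq> ?J"
    by (rule R.genideal_minimal)
  have "ideal (genideal (ring_on S) A) (ring_on S)"
    using assms by (intro R.genideal_ideal) auto
  moreover have "A \<subseteq> genideal (ring_on S) A"
    using assms by (intro R.genideal_self) auto
  ultimately show "?J \<subseteq> genideal (ring_on S) A"
    by (auto intro!: ideal_sum intro: idealD)
qed

lemma genideal_empty: "genideal (ring_on S) {} = {0}"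
  using genideal_finite[of "{}"] by auto

lemma genideal_single: "a \<in> S \<Longrightarrow> genideal (ring_on S) {a} = {s * a | s. s \<in> S}"
  by (subst genideal_finite) (auto intro: exI[of _ "\<lambda>_. _"])

text \<open>A nonempty chain of ideals contains its own union, so Zorn's lemma works inside any
  family C, even one not closed under unions.\<close>

lemma noetherian_max:
  assumes noeth: "noetherian_ring (ring_on S)"
    and C: "C \<noteq> {}" "\<And>I. I \<in> C \<Longrightarrow> ideal I (ring_on S)"
  obtains M where "M \<in> C" "\<And>I. I \<in> C \<Longrightarrow> M \<subseteq> I \<Longrightarrow> I = M"
proof -
  interpret N: noetherian_ring "ring_on S" by (rule noeth)
  have "\<exists>M\<in>C. \<forall>I\<in>C. M \<subseteq> I \<longrightarrow> I = M"
  proof (rule subset_Zorn)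
    fix D assume D: "subset.chain C D"
    show "\<exists>V\<in>C. \<forall>I\<in>D. I \<subseteq> V"
    proof (cases "D = {}")
      case True
      then show ?thesis using C by auto
    next
      case False
      have "subset.chain {I. ideal I (ring_on S)} D"
        using D C(2) by (auto simp: subset.chain_def)
      then have "\<Union>D \<in> D"
        using N.ideal_chain_is_trivial False by blast
      then show ?thesis
        using D by (auto simp: subset.chain_def)
    qed
  qed
  then show ?thesis using that by blast
qed

end

lemma field_subring_iff: "subring S (ring_of_type_algebra :: 'a::field ring) \<longleftrightarrow> field_subring S"
proof -
  interpret U: field_subring "UNIV :: 'a set" by unfold_locales auto
  have K: "(ring_of_type_algebra :: 'a ring) = ring_on UNIV"
    by (simp add: ring_of_type_algebra_def)
  have inv: "\<ominus>\<^bsub>ring_on UNIV\<^esub> a = - a" for a :: 'a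
    using U.R.minus_equality[of "-a" a] by simp
  show ?thesis
  proof
    assume "subring S (ring_of_type_algebra :: 'a ring)"
    then have s: "subring S (ring_on (UNIV :: 'a set))" using K by metis
    note E = subringE[OF s]
    show "field_subring S"
    proof
      show "1 \<in> S" using E(3) by simp
      show "a * b \<in> S" if "a \<in> S" "b \<in> S" for a b using E(6)[OF that] by simp
      show "a - b \<in> S" if "a \<in> S" "b \<in> S" for a b
        using E(7)[OF \<open>a \<in> S\<close> E(5)[OF \<open>b \<in> S\<close>]] by (simp add: inv)
    qed
  next
    assume "field_subring S"
    then interpret field_subring S .
    have "subring S (ring_on (UNIV :: 'a set))"
      by (rule U.R.subringI) (auto simp: inv)
    then show "subring S (ring_of_type_algebra :: 'a ring)" using K by metis
  qed
qed

section \<open>Heights and localization\<close>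

context field_subring
begin

text \<open>The annihilator of the class of \<open>u\<close> in the quotient of the field by
  \<open>S\<close>; it contains 1 exactly when \<open>u\<close> lies in \<open>S\<close>.\<close>

definition conductor :: "'a \<Rightarrow> 'a set" where
  "conductor u = {s \<in> S. s * u \<in> S}"

lemma conductor_ideal: "ideal (conductor u) (ring_on S)"
  by (auto simp: ideal_iff conductor_def distrib_right mult.assoc)

lemma conductor_mono: "s \<in> S \<Longrightarrow> conductor u \<subseteq> conductor (s * u)"
  by (auto simp: conductor_def mult.left_commute[of _ s])

text \<open>Maximality is relative to V because two families are used:
  \<open>overring G - S\<close>, and the fractions over r outside a local ring.\<close>

definition conductor_maximal :: "'a set \<Rightarrow> 'a \<Rightarrow> bool" where
  "conductor_maximal V v \<longleftrightarrow> v \<in> V \<and> (\<forall>w\<in>V. conductor v \<subseteq> conductor w \<longrightarrow> conductor w = conductor v)"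

lemma conductor_maximal_exists:
  assumes noeth: "noetherian_ring (ring_on S)" and u: "u \<in> V"
  obtains v where "conductor_maximal V v" "conductor u \<subseteq> conductor v"
proof -
  obtain M where M: "M \<in> conductor ` {v \<in> V. conductor u \<subseteq> conductor v}"
    "\<And>I. I \<in> conductor ` {v \<in> V. conductor u \<subseteq> conductor v} \<Longrightarrow> M \<subseteq> I \<Longrightarrow> I = M"
    using u by (rule_tac noetherian_max[OF noeth, of "conductor ` {v \<in> V. conductor u \<subseteq> conductor v}"])
      (auto simp: conductor_ideal)
  then obtain v where v: "v \<in> V" "conductor u \<subseteq> conductor v" "M = conductor v" by auto
  \<comment> \<open>A competitor above \<open>conductor v\<close> is also above
    \<open>conductor u\<close>, so maximality in the restricted family is maximality in V.\<close>
  have "conductor w = conductor v" if "w \<in> V" "conductor v \<subseteq> conductor w" for w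
    using M(2)[of "conductor w"] that v by auto
  then have "conductor_maximal V v"
    using v by (simp add: conductor_maximal_def)
  then show ?thesis
    using v(2) by (rule that)
qed

text \<open>Let ab be in \<open>conductor v\<close>. If av stays in V, its conductor contains that
  of v, hence equals it, and it contains b. Otherwise some cv in V has a in its conductor, and that
  conductor is again the one of v. The second alternative of the hypothesis is there for
  localizations, where av may leave V without lying in S.\<close>

lemma conductor_maximal_prime:
  assumes v: "conductor_maximal V v"
    and V: "\<And>u. u \<in> V \<Longrightarrow> u \<notin> S"
      "\<And>u s. u \<in> V \<Longrightarrow> s \<in> S \<Longrightarrow> s * u \<in> V \<or> (\<exists>b\<in>S. b * u \<in> V \<and> b * (s * u) \<in> S)"
  shows "primeideal (conductor v) (ring_on S)"
  unfolding primeideal_iff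
proof (intro conjI ballI impI)
  have vX: "v \<in> V" and max: "\<And>w. w \<in> V \<Longrightarrow> conductor v \<subseteq> conductor w \<Longrightarrow> conductor w = conductor v"
    using v by (auto simp: conductor_maximal_def)
  show "ideal (conductor v) (ring_on S)" by (rule conductor_ideal)
  show "1 \<notin> conductor v" using V(1)[OF vX] by (auto simp: conductor_def)
  show "a \<in> conductor v \<or> b \<in> conductor v" if ab: "a \<in> S" "b \<in> S" "a * b \<in> conductor v" for a b
  proof (cases "a * v \<in> V")
    case True
    then have "conductor (a * v) = conductor v"
      using max conductor_mono ab by blast
    moreover have "b \<in> conductor (a * v)"
      using ab by (auto simp: conductor_def mult_ac)
    ultimately show ?thesis by blast
  next
    case False
    then obtain c where c: "c \<in> S" "c * v \<in> V" "c * (a * v) \<in> S"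
      using V(2)[OF vX ab(1)] by auto
    then have "a \<in> conductor (c * v)"
      using ab by (auto simp: conductor_def mult_ac)
    then show ?thesis
      using max[OF c(2) conductor_mono[OF c(1)]] by blast
  qed
qed

section \<open>Prime ideals of the localization at a prime\<close>

lemma self_ideal: "ideal S (ring_on S)"
  by (auto simp: ideal_iff)

lemma prime_nonzero: "primeideal P (ring_on S) \<Longrightarrow> b \<notin> P \<Longrightarrow> b \<noteq> 0"
  using idealD(2)[OF primeidealD(1)] by blast

lemma localize_ideal_iff:
  assumes P: "primeideal P (ring_on S)"
  shows "u \<in> localize_at S P Q \<longleftrightarrow> (\<exists>b\<in>S - P. b * u \<in> Q)"
proof
  assume "u \<in> localize_at S P Q"
  then obtain a b where ab: "u = a / b" "a \<in> Q" "b \<in> S - P"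
    by (auto simp: localize_at_def)
  then have "b * u \<in> Q" using prime_nonzero[OF P] by auto
  then show "\<exists>b\<in>S - P. b * u \<in> Q" using ab(3) by blast
next
  assume "\<exists>b\<in>S - P. b * u \<in> Q"
  then obtain b where b: "b \<in> S - P" "b * u \<in> Q" by auto
  moreover have "u = (b * u) / b" using prime_nonzero[OF P] b(1) by auto
  ultimately show "u \<in> localize_at S P Q" unfolding localize_at_def by blast
qed

lemmas localize_iff = localize_ideal_iff[where Q = S]

lemma compl_prime_mult:
  assumes "primeideal P (ring_on S)" "a \<in> S - P" "b \<in> S - P"
  shows "a * b \<in> S - P"
  using assms primeidealD(3)[OF assms(1)] by auto

lemma localize_self_subset:
  assumes P: "primeideal P (ring_on S)" and I: "ideal I (ring_on S)"
  shows "I \<subseteq> localize_at S P I"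
  using primeidealD(2)[OF P] idealD(1)[OF I] by (force simp: localize_ideal_iff[OF P])

lemma localize_subring:
  assumes P: "primeideal P (ring_on S)"
  shows "field_subring (localize_at S P S)"
proof
  show "1 \<in> localize_at S P S"
    using localize_self_subset[OF P self_ideal] by auto
  fix u v assume "u \<in> localize_at S P S" "v \<in> localize_at S P S"
  then obtain a b where ab: "a \<in> S - P" "b \<in> S - P" "a * u \<in> S" "b * v \<in> S"
    by (auto simp: localize_iff[OF P])
  have "a * b * (u - v) = b * (a * u) - a * (b * v)" "a * b * (u * v) = (a * u) * (b * v)"
    by (auto simp: algebra_simps)
  then have "a * b * (u - v) \<in> S" "a * b * (u * v) \<in> S"
    using ab by (simp_all only: DiffE) (simp_all add: diff_mem)
  then show "u - v \<in> localize_at S P S" "u * v \<in> localize_at S P S"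
    using compl_prime_mult[OF P ab(1,2)] by (auto simp: localize_iff[OF P])
qed

text \<open>With \<open>contract_prime\<close> this is the bijection between the primes of S inside
  P and the primes of the local ring; both round trips are needed so that strict inclusions survive
  in either direction.\<close>

lemma localize_prime:
  assumes P: "primeideal P (ring_on S)" and Q: "primeideal Q (ring_on S)" and QP: "Q \<subseteq> P"
  shows "primeideal (localize_at S P Q) (ring_on (localize_at S P S))"
    and "localize_at S P Q \<inter> S = Q"
proof -
  note Qi = primeidealD(1)[OF Q]
  note Pi = primeidealD(1)[OF P]
  interpret L: field_subring "localize_at S P S" by (rule localize_subring[OF P])
  show int: "localize_at S P Q \<inter> S = Q"
  proof
    show "localize_at S P Q \<inter> S \<subseteq> Q"
    proof
      fix x assume "x \<in> localize_at S P Q \<inter> S"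
      then obtain b where "b \<in> S - P" "b * x \<in> Q" "x \<in> S"
        by (auto simp: localize_ideal_iff[OF P])
      then show "x \<in> Q" using primeidealD(3)[OF Q, of b x] QP by auto
    qed
    show "Q \<subseteq> localize_at S P Q \<inter> S"
      using localize_self_subset[OF P Qi] idealD(1)[OF Qi] by auto
  qed
  show "primeideal (localize_at S P Q) (ring_on (localize_at S P S))"
    unfolding L.primeideal_iff L.ideal_iff
  proof (intro conjI ballI impI)
    show "localize_at S P Q \<subseteq> localize_at S P S"
      using idealD(1)[OF Qi] by (auto simp: localize_at_def)
    show "0 \<in> localize_at S P Q"
      using localize_self_subset[OF P Qi] idealD(2)[OF Qi] by auto
    show "1 \<notin> localize_at S P Q"
      using int one_mem primeidealD(2)[OF Q] by auto
    fix u assume u: "u \<in> localize_at S P Q"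
    then obtain a where a: "a \<in> S - P" "a * u \<in> Q" by (auto simp: localize_ideal_iff[OF P])
    show "u + v \<in> localize_at S P Q" if v: "v \<in> localize_at S P Q" for v
    proof -
      obtain b where b: "b \<in> S - P" "b * v \<in> Q" using v by (auto simp: localize_ideal_iff[OF P])
      have "a * b * (u + v) = b * (a * u) + a * (b * v)" by (simp add: algebra_simps)
      then have "a * b * (u + v) \<in> Q" using a b by (auto intro!: idealD(3,4)[OF Qi])
      then show ?thesis using compl_prime_mult[OF P a(1) b(1)] by (auto simp: localize_ideal_iff[OF P])
    qed
  next
    fix s u assume "s \<in> localize_at S P S" "u \<in> localize_at S P Q"
    then obtain a b where ab: "a \<in> S - P" "a * u \<in> Q" "b \<in> S - P" "b * s \<in> S"
      by (auto simp: localize_ideal_iff[OF P] localize_iff[OF P])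
    have "a * b * (s * u) = (b * s) * (a * u)" by (simp add: algebra_simps)
    then have "a * b * (s * u) \<in> Q" using ab idealD(4)[OF Qi, of "b * s" "a * u"] by (simp add: mult_ac)
    then show "s * u \<in> localize_at S P Q"
      using compl_prime_mult[OF P ab(1,3)] by (auto simp: localize_ideal_iff[OF P])
  next
    fix u v assume "u \<in> localize_at S P S" "v \<in> localize_at S P S" "u * v \<in> localize_at S P Q"
    then obtain a b c where ab: "a \<in> S - P" "a * u \<in> S" "b \<in> S - P" "b * v \<in> S" "c \<in> S - P" "c * (u * v) \<in> Q"
      by (auto simp: localize_ideal_iff[OF P] localize_iff[OF P])
    have "c * ((a * u) * (b * v)) = (a * b) * (c * (u * v))" by (simp add: algebra_simps)
    then have "c * ((a * u) * (b * v)) \<in> Q"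
      using ab idealD(4)[OF Qi, of "a * b" "c * (u * v)"] by (simp add: mult_ac)
    then have "(a * u) * (b * v) \<in> Q" using primeidealD(3)[OF Q, of c] ab QP by auto
    then have "a * u \<in> Q \<or> b * v \<in> Q" using primeidealD(3)[OF Q] ab by auto
    then show "u \<in> localize_at S P Q \<or> v \<in> localize_at S P Q"
      using ab by (auto simp: localize_ideal_iff[OF P])
  qed
qed

lemma contract_prime:
  assumes P: "primeideal P (ring_on S)" and Q: "primeideal Q (ring_on (localize_at S P S))"
  shows "primeideal (Q \<inter> S) (ring_on S)" "Q \<inter> S \<subseteq> P" "Q = localize_at S P (Q \<inter> S)"
proof -
  interpret L: field_subring "localize_at S P S" by (rule localize_subring[OF P])
  note Qi = L.primeidealD(1)[OF Q]
  note sub = localize_self_subset[OF P self_ideal]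
  show Qp: "primeideal (Q \<inter> S) (ring_on S)"
    unfolding primeideal_iff ideal_iff
  proof (intro conjI ballI impI)
    show "1 \<notin> Q \<inter> S" using L.primeidealD(2)[OF Q] by auto
    show "a \<in> Q \<inter> S \<or> b \<in> Q \<inter> S" if "a \<in> S" "b \<in> S" "a * b \<in> Q \<inter> S" for a b
      using L.primeidealD(3)[OF Q, of a b] that sub by blast
    show "0 \<in> Q \<inter> S" using L.idealD(2)[OF Qi] by simp
    show "a + b \<in> Q \<inter> S" if "a \<in> Q \<inter> S" "b \<in> Q \<inter> S" for a b
      using L.idealD(3)[OF Qi, of a b] that by simp
    show "s * a \<in> Q \<inter> S" if "s \<in> S" "a \<in> Q \<inter> S" for s a
      using L.idealD(4)[OF Qi, of s a] that sub by auto
  qed simp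
  show "Q \<inter> S \<subseteq> P"
  proof
    fix q assume q: "q \<in> Q \<inter> S"
    show "q \<in> P"
    proof (rule ccontr)
      assume "q \<notin> P"
      then have "1 / q \<in> localize_at S P S"
        using q by (auto simp: localize_at_def)
      moreover have "q \<noteq> 0"
        using \<open>q \<notin> P\<close> idealD(2)[OF primeidealD(1)[OF P]] by auto
      ultimately show False
        using L.idealD(4)[OF Qi, of "1 / q" q] q L.primeidealD(2)[OF Q] by auto
    qed
  qed
  show "Q = localize_at S P (Q \<inter> S)"
  proof (intro equalityI subsetI)
    fix u assume u: "u \<in> Q"
    then have "u \<in> localize_at S P S" using L.idealD(1)[OF Qi] by blast
    then obtain b where b: "b \<in> S - P" "b * u \<in> S"
      unfolding localize_iff[OF P] by blast
    moreover have "b * u \<in> Q" using L.idealD(4)[OF Qi] sub b u by blast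
    ultimately show "u \<in> localize_at S P (Q \<inter> S)"
      by (auto simp: localize_ideal_iff[OF P])
  next
    fix u assume "u \<in> localize_at S P (Q \<inter> S)"
    then obtain b where b: "b \<in> S - P" "b * u \<in> Q"
      by (auto simp: localize_ideal_iff[OF P])
    then have "b \<noteq> 0" "1 / b \<in> localize_at S P S"
      using idealD(2)[OF primeidealD(1)[OF P]] by (auto simp: localize_at_def)
    then show "u \<in> Q" using L.idealD(4)[OF Qi, of "1 / b" "b * u"] b by auto
  qed
qed

lemma height_le_krull_dim_localize:
  assumes P: "primeideal P (ring_on S)"
  shows "height (ring_on S) P \<le> krull_dim (ring_on (localize_at S P S))"
proof -
  have "height (ring_on S) P \<le> height (ring_on (localize_at S P S)) (localize_at S P P)"
    unfolding height_def
  proof (rule SUP_subset_mono)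
    show "{k. \<exists>Q. (\<forall>i\<le>k. primeideal (Q i) (ring_on S)) \<and> (\<forall>i<k. Q i \<subset> Q (Suc i)) \<and> Q k = P}
      \<subseteq> {k. \<exists>Q. (\<forall>i\<le>k. primeideal (Q i) (ring_on (localize_at S P S))) \<and>
          (\<forall>i<k. Q i \<subset> Q (Suc i)) \<and> Q k = localize_at S P P}"
    proof clarify
      fix k Q assume Q: "\<forall>i\<le>k. primeideal (Q i) (ring_on S)" "\<forall>i<k. Q i \<subset> Q (Suc i)" "P = Q k"
      have le: "Q i \<subseteq> P" if "i \<le> k" for i
        using that
      proof (induction rule: inc_induct)
        case (step n)
        then show ?case using Q(2) by blast
      qed (use Q in auto)
      \<comment> \<open>Strictness survives because contracting back to S recovers the members of
        the chain.\<close>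
      have "localize_at S P (Q i) \<subset> localize_at S P (Q (Suc i))" if "i < k" for i
      proof -
        have "localize_at S P (Q i) \<subseteq> localize_at S P (Q (Suc i))"
          using Q(2) that by (auto simp: localize_at_def)
        moreover have "localize_at S P (Q i) \<inter> S = Q i" "localize_at S P (Q (Suc i)) \<inter> S = Q (Suc i)"
          using that Q(1) le by (simp_all add: localize_prime(2)[OF P])
        moreover have "Q i \<noteq> Q (Suc i)" using Q(2) that by auto
        ultimately show ?thesis by (metis psubset_eq)
      qed
      moreover have "primeideal (localize_at S P (Q i)) (ring_on (localize_at S P S))" if "i \<le> k" for i
        using that Q(1) le localize_prime(1)[OF P] by blast
      ultimately show "\<exists>Q'. (\<forall>i\<le>k. primeideal (Q' i) (ring_on (localize_at S (Q k) S))) \<and>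
          (\<forall>i<k. Q' i \<subset> Q' (Suc i)) \<and> Q' k = localize_at S (Q k) (Q k)"
        unfolding Q(3) by (intro exI[of _ "\<lambda>i. localize_at S (Q k) (Q i)"]) blast
    qed
  qed auto
  also have "\<dots> \<le> krull_dim (ring_on (localize_at S P S))"
    unfolding krull_dim_def using localize_prime(1)[OF P P] by (intro SUP_upper) auto
  finally show ?thesis .
qed

text \<open>A chain longer than d is cut down to its first d + 1 steps and contracted to S. The cut
  may remove the top, so the excluded chains end somewhere inside P and not necessarily at
  P.\<close>

lemma krull_dim_localize_le:
  assumes P: "primeideal P (ring_on S)"
    and d: "\<And>Q :: nat \<Rightarrow> 'a set. (\<And>i. i \<le> Suc d \<Longrightarrow> primeideal (Q i) (ring_on S)) \<Longrightarrow>
      (\<And>i. i \<le> d \<Longrightarrow> Q i \<subset> Q (Suc i)) \<Longrightarrow> Q (Suc d) \<subseteq> P \<Longrightarrow> False"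
  shows "krull_dim (ring_on (localize_at S P S)) \<le> enat d"
  unfolding krull_dim_def height_def
proof (intro SUP_least; clarify)
  fix k Q assume Q: "\<forall>i\<le>k. primeideal (Q i) (ring_on (localize_at S P S))" "\<forall>i<k. Q i \<subset> Q (Suc i)"
  show "enat k \<le> enat d"
  proof (rule ccontr)
    assume "\<not> enat k \<le> enat d"
    then have k: "Suc d \<le> k" by simp
    show False
    proof (rule d[of "\<lambda>i. Q i \<inter> S"])
      show "primeideal (Q i \<inter> S) (ring_on S)" if "i \<le> Suc d" for i
        using contract_prime(1)[OF P] Q(1) k that by auto
      show "Q (Suc d) \<inter> S \<subseteq> P"
        using contract_prime(2)[OF P] Q(1) k by auto
      show "Q i \<inter> S \<subset> Q (Suc i) \<inter> S" if "i \<le> d" for i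
      proof -
        have "Q i = localize_at S P (Q i \<inter> S)" "Q (Suc i) = localize_at S P (Q (Suc i) \<inter> S)" "Q i \<subset> Q (Suc i)"
          using contract_prime(3)[OF P] Q k that by auto
        then have "Q i \<inter> S \<noteq> Q (Suc i) \<inter> S" by (metis psubset_eq)
        then show ?thesis using \<open>Q i \<subset> Q (Suc i)\<close> by blast
      qed
    qed
  qed
qed

text \<open>In a domain {0} is prime and starts the chain, so one nonzero prime strictly below P
  suffices.\<close>

lemma height_ge_2:
  assumes "primeideal Q (ring_on S)" "primeideal P (ring_on S)" "Q \<noteq> {0}" "Q \<subset> P"
  shows "2 \<le> height (ring_on S) P"
proof -
  have "{0} \<subset> Q" using assms(3) idealD(2)[OF primeidealD(1)[OF assms(1)]] by auto
  then have "(\<forall>i\<le>2. primeideal ((!) [{0}, Q, P] i) (ring_on S)) \<and>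
     (\<forall>i<2. (!) [{0}, Q, P] i \<subset> (!) [{0}, Q, P] (Suc i)) \<and> (!) [{0}, Q, P] 2 = P"
    using assms R.zeroprimeideal by (auto simp: less_Suc_eq le_Suc_eq numeral_2_eq_2)
  then have "enat 2 \<le> height (ring_on S) P"
    unfolding height_def by (intro SUP_upper CollectI exI)
  then show ?thesis by (simp add: numeral_eq_enat)
qed

lemma codim_ge_2I:
  assumes "\<And>P. primeideal P (ring_on S) \<Longrightarrow> I \<subseteq> P \<Longrightarrow>
    \<exists>Q. primeideal Q (ring_on S) \<and> Q \<noteq> {0} \<and> Q \<subset> P"
  shows "2 \<le> codim (ring_on S) I"
  unfolding codim_def using assms height_ge_2 by (intro INF_greatest) blast

end

section \<open>Elements that become integral away from an ideal\<close>

context field_subring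
begin

text \<open>For G without 0 this is the intersection of the localizations \<open>S[1/g]\<close>, g
  in G. With G the products of mutable variables it becomes the upper cluster algebra.\<close>

definition overring :: "'a set \<Rightarrow> 'a set" where
  "overring G = {u. \<forall>g\<in>G. \<exists>k. u * g ^ k \<in> S}"

lemma overring_superset: "S \<subseteq> overring G"
  by (auto simp: overring_def intro!: exI[of _ 0])

lemma overring_smult:
  assumes "s \<in> S" "u \<in> overring G"
  shows "s * u \<in> overring G"
  unfolding overring_def
proof (intro CollectI ballI)
  fix g assume "g \<in> G"
  then obtain k where "u * g ^ k \<in> S" using assms by (auto simp: overring_def)
  then have "s * (u * g ^ k) \<in> S" using assms by simp
  then show "\<exists>k. s * u * g ^ k \<in> S" by (auto simp: mult.assoc)
qed

text \<open>The elements h all of whose large powers multiply u into S form an ideal: in a binomial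
  expansion of exponent at least k + l, every term has its first exponent at least k or its second
  at least l.\<close>

lemma overring_genideal:
  assumes G: "G \<subseteq> S" and u: "u \<in> overring G" and h: "h \<in> genideal (ring_on S) G"
  shows "\<exists>k. u * h ^ k \<in> S"
proof -
  \<comment> \<open>All large exponents are required, not just one, because the exponents in a
    binomial expansion are only bounded from below.\<close>
  define I where "I = {h \<in> S. \<exists>k. \<forall>i\<ge>k. u * h ^ i \<in> S}"
  have "ideal I (ring_on S)"
    unfolding ideal_iff
  proof (intro conjI ballI)
    show "I \<subseteq> S" by (auto simp: I_def)
    \<comment> \<open>The bound is 1 because \<open>0 ^ 0 = 1\<close> would leave u itself.\<close>
    have "\<forall>i\<ge>1. u * 0 ^ i \<in> S" by (auto simp: power_0_left)
    then show "0 \<in> I" unfolding I_def by blast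
  next
    fix a b assume "a \<in> I" "b \<in> I"
    then obtain k l where kl: "\<And>i. i \<ge> k \<Longrightarrow> u * a ^ i \<in> S" "\<And>i. i \<ge> l \<Longrightarrow> u * b ^ i \<in> S"
      and ab: "a \<in> S" "b \<in> S"
      by (auto simp: I_def)
    have "u * (a + b) ^ i \<in> S" if "i \<ge> k + l" for i
    proof -
      have "u * (a + b) ^ i = (\<Sum>j\<le>i. of_nat (i choose j) * (u * a ^ j * b ^ (i - j)))"
        by (simp add: binomial_ring sum_distrib_left mult_ac)
      also have "\<dots> \<in> S"
      proof (rule sum_mem)
        fix j assume "j \<in> {..i}"
        then have "j \<ge> k \<or> i - j \<ge> l" using that by auto
        then consider "j \<ge> k" | "i - j \<ge> l" by blast
        then have "u * a ^ j * b ^ (i - j) \<in> S"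
        proof cases
          case 1
          then show ?thesis using kl(1) ab by auto
        next
          case 2
          have "a ^ j * (u * b ^ (i - j)) \<in> S" using kl(2)[OF 2] ab by auto
          then show ?thesis by (simp add: mult_ac)
        qed
        then show "of_nat (i choose j) * (u * a ^ j * b ^ (i - j)) \<in> S"
          by (rule mult_mem[OF of_nat_mem])
      qed
      finally show ?thesis .
    qed
    then show "a + b \<in> I" using ab unfolding I_def by auto
  next
    fix s a assume s: "s \<in> S" "a \<in> I"
    then obtain k where k: "\<And>i. i \<ge> k \<Longrightarrow> u * a ^ i \<in> S" and a: "a \<in> S" by (auto simp: I_def)
    have "u * (s * a) ^ i \<in> S" if "i \<ge> k" for i
    proof -
      have "s ^ i * (u * a ^ i) \<in> S" using k that s by auto
      then show ?thesis by (simp add: power_mult_distrib mult_ac)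
    qed
    then show "s * a \<in> I" using s a unfolding I_def by auto
  qed
  moreover have "G \<subseteq> I"
  proof
    fix g assume g: "g \<in> G"
    then obtain k where k: "u * g ^ k \<in> S" using u by (auto simp: overring_def)
    have "u * g ^ i \<in> S" if "i \<ge> k" for i
    proof -
      have "u * g ^ k * g ^ (i - k) \<in> S" using k g G by auto
      then show ?thesis using that by (simp add: mult.assoc flip: power_add)
    qed
    then show "g \<in> I" using g G by (auto simp: I_def)
  qed
  ultimately have "genideal (ring_on S) G \<subseteq> I" by (rule R.genideal_minimal)
  then show ?thesis using h by (auto simp: I_def)
qed

text \<open>Division by f turns Sf into S, and the saturation into those elements of
  \<open>overring G\<close> that f multiplies into S. If \<open>overring G\<close> is larger than S,
  multiplying one of its new elements by a suitable power of f gives a new element of this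
  kind.\<close>

lemma saturation_eq_iff:
  assumes G: "G \<subseteq> S" "f \<in> G" "0 \<notin> G"
  defines "J \<equiv> cgenideal (ring_on S) f"
    and "I \<equiv> genideal (ring_on S) G"
  shows "S = overring G \<longleftrightarrow> J = saturation (ring_on S) J I"
    and "S \<noteq> overring G \<Longrightarrow>
      \<exists>r \<in> saturation (ring_on S) J I. r * inverse f \<in> overring G \<and> r * inverse f \<notin> S"
proof -
  have f: "f \<in> S" "f \<noteq> 0" using G by auto
  have J: "r \<in> J \<longleftrightarrow> r / f \<in> S" for r
    unfolding J_def cgenideal_eq using f by (auto intro!: exI[of _ "r / f"])
  have sat: "saturation (ring_on S) J I = {r \<in> S. \<forall>g\<in>I. \<exists>k. r / f * g ^ k \<in> S}"
    by (auto simp: saturation_def J)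
  have GI: "G \<subseteq> I" using G unfolding I_def by (intro R.genideal_self) auto
  have mem: "r / f \<in> overring G" if "r \<in> saturation (ring_on S) J I" for r
    using that GI by (auto simp: sat overring_def)
  have sub: "J \<subseteq> saturation (ring_on S) J I"
  proof
    fix r assume r: "r \<in> J"
    then have "r / f * f \<in> S" unfolding J using f by (intro mult_mem)
    then show "r \<in> saturation (ring_on S) J I"
      using r f unfolding J sat by (auto intro!: exI[of _ 0])
  qed
  show ex: "\<exists>r \<in> saturation (ring_on S) J I. r * inverse f \<in> overring G \<and> r * inverse f \<notin> S"
    if ne: "S \<noteq> overring G"
  proof -
    obtain u where u: "u \<in> overring G" "u \<notin> S" using ne overring_superset by blast
    \<comment> \<open>With the least exponent k, one factor f fewer leaves an element outside S that
      f carries into S; k is positive since u is not in S.\<close>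
    define k where "k = (LEAST k. u * f ^ k \<in> S)"
    have ex: "\<exists>k. u * f ^ k \<in> S" using u G by (auto simp: overring_def)
    have k: "u * f ^ k \<in> S" unfolding k_def by (rule LeastI_ex[OF ex])
    obtain j where j: "k = Suc j" using k u(2) by (cases k) auto
    have nj: "u * f ^ j \<notin> S" using not_less_Least[of j "\<lambda>k. u * f ^ k \<in> S"] j by (auto simp: k_def)
    have uj: "u * f ^ j \<in> overring G"
      using overring_smult[of "f ^ j" u] u f by (simp add: mult.commute)
    have uj_eq: "u * f ^ k * inverse f = u * f ^ j" using f by (simp add: j)
    \<comment> \<open>The saturation tests every element of the ideal, \<open>overring\<close> only
      the generators; \<open>overring_genideal\<close> bridges the two.\<close>
    have "u * f ^ k \<in> saturation (ring_on S) J I"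
      using k overring_genideal[OF G(1) uj, folded I_def] unfolding sat I_def[symmetric]
      by (auto simp only: mem_Collect_eq divide_inverse uj_eq)
    then show ?thesis
      using uj nj by (intro bexI[of _ "u * f ^ k"] conjI) (simp_all only: uj_eq not_False_eq_True)
  qed
  show "S = overring G \<longleftrightarrow> J = saturation (ring_on S) J I"
  proof
    assume "S = overring G"
    then show "J = saturation (ring_on S) J I"
      using mem sub J by auto
  next
    assume "J = saturation (ring_on S) J I"
    then show "S = overring G"
      using ex J by (auto simp: divide_inverse)
  qed
qed

text \<open>Primality is what removes the exponents: membership in \<open>overring G\<close> puts
  only a power of each h of the ideal into the conductor, and a prime containing a power of h
  contains h.\<close>

lemma conductor_prime_exists:
  assumes noeth: "noetherian_ring (ring_on S)" and G: "G \<subseteq> S" and ne: "S \<noteq> overring G"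
  obtains u where "u \<in> overring G" "u \<notin> S" "primeideal (conductor u) (ring_on S)"
    "genideal (ring_on S) G \<subseteq> conductor u"
proof -
  obtain u where "u \<in> overring G - S" using ne overring_superset by blast
  then obtain v where v: "conductor_maximal (overring G - S) v"
    using conductor_maximal_exists[OF noeth] by metis
  have v': "v \<in> overring G" "v \<notin> S" using v by (auto simp: conductor_maximal_def)
  have p: "primeideal (conductor v) (ring_on S)"
  proof (rule conductor_maximal_prime[OF v])
    fix u s assume "u \<in> overring G - S" "s \<in> S"
    then show "s * u \<in> overring G - S \<or> (\<exists>b\<in>S. b * u \<in> overring G - S \<and> b * (s * u) \<in> S)"
      using overring_smult by (cases "s * u \<in> S") (auto intro!: bexI[of _ 1])
  qed auto
  moreover have "genideal (ring_on S) G \<subseteq> conductor v"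
  proof
    fix h assume h: "h \<in> genideal (ring_on S) G"
    have hS: "h \<in> S" using genideal_minimal'[OF self_ideal G] h by auto
    obtain k where "v * h ^ k \<in> S" using overring_genideal[OF G v'(1) h] by auto
    then have "h ^ k \<in> conductor v" using hS by (auto simp: conductor_def mult.commute)
    then show "h \<in> conductor v" by (rule prime_power_mem[OF p hS])
  qed
  ultimately show ?thesis using that v' by blast
qed

text \<open>The right side says that \<open>(S : I)\<close>, taken in the field, is no larger than
  S. It involves first powers only, so it can be compared with linear maps in the computation of
  Ext.\<close>

lemma eq_overring_iff_no_denominators:
  assumes noeth: "noetherian_ring (ring_on S)" and G: "G \<subseteq> S"
  shows "S = overring G \<longleftrightarrow> (\<forall>u. genideal (ring_on S) G \<subseteq> conductor u \<longrightarrow> u \<in> S)"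
proof
  assume eq: "S = overring G"
  show "\<forall>u. genideal (ring_on S) G \<subseteq> conductor u \<longrightarrow> u \<in> S"
  proof (intro allI impI)
    fix u assume u: "genideal (ring_on S) G \<subseteq> conductor u"
    have "G \<subseteq> conductor u" using R.genideal_self[of G] G u by auto
    then have "u \<in> overring G"
      by (force simp: overring_def conductor_def mult.commute intro!: exI[of _ 1])
    then show "u \<in> S" using eq by simp
  qed
next
  assume "\<forall>u. genideal (ring_on S) G \<subseteq> conductor u \<longrightarrow> u \<in> S"
  then show "S = overring G"
    using conductor_prime_exists[OF noeth G] by metis
qed

section \<open>Codimension and depth at conductor primes\<close>

lemma depth_ge_2_obtain:
  assumes "2 \<le> depth R I"
  obtains rs where "regular_sequence R rs" "set rs \<subseteq> I" "2 \<le> length rs"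
proof -
  have "\<exists>rs. regular_sequence R rs \<and> set rs \<subseteq> I \<and> 2 \<le> length rs"
  proof (rule ccontr)
    assume n: "\<not> ?thesis"
    have "depth R I \<le> enat 1"
      unfolding depth_def
    proof (rule SUP_least)
      fix rs assume "rs \<in> {rs. regular_sequence R rs \<and> set rs \<subseteq> I}"
      then have "\<not> 2 \<le> length rs" using n by auto
      then show "enat (length rs) \<le> enat 1" by simp
    qed
    then have "2 \<le> enat 1" using assms by (rule_tac order_trans)
    then show False by (simp add: numeral_eq_enat)
  qed
  then show ?thesis using that by blast
qed

text \<open>A prime \<open>P = (S : u)\<close> of height at least 2 has depth 1: for a regular sequence
  \<open>r\<^sub>1, r\<^sub>2\<close> in \<open>P\<^sub>P\<close> the identity \<open>r\<^sub>2 (u r\<^sub>1) = r\<^sub>1 (u r\<^sub>2)\<close> would give \<open>u \<in> S\<^sub>P\<close>.\<close>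

lemma serre_S2_imp_eq_overring:
  assumes noeth: "noetherian_ring (ring_on S)" and G: "G \<subseteq> S"
    and S2: "serre_S 2 S" and codim: "2 \<le> codim (ring_on S) (genideal (ring_on S) G)"
  shows "S = overring G"
proof (rule ccontr)
  assume "S \<noteq> overring G"
  then obtain u where u: "u \<notin> S" and P: "primeideal (conductor u) (ring_on S)"
    and GP: "genideal (ring_on S) G \<subseteq> conductor u"
    using conductor_prime_exists[OF noeth G] by metis
  define P where "P = conductor u"
  define L where "L = localize_at S P S"
  have P: "primeideal P (ring_on S)" using P by (simp add: P_def)
  interpret L: field_subring L unfolding L_def by (rule localize_subring[OF P])
  have "2 \<le> height (ring_on S) P"
    using codim GP P by (auto simp: codim_def P_def le_INF_iff)
  also have "\<dots> \<le> krull_dim (ring_on L)"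
    unfolding L_def by (rule height_le_krull_dim_localize[OF P])
  finally have "2 \<le> depth (ring_on L) (localize_at S P P)"
    using S2 P by (auto simp: serre_S_def L_def numeral_eq_enat min_def split: if_splits)
  then obtain rs where rs: "regular_sequence (ring_on L) rs" "set rs \<subseteq> localize_at S P P" "2 \<le> length rs"
    by (rule depth_ge_2_obtain)
  then obtain a b ts where abt: "rs = a # b # ts"
    by (metis Suc_le_length_iff numeral_2_eq_2)
  have aL: "a \<in> L" "b \<in> L" using rs(1) by (auto simp: abt regular_sequence_def)
  have reg: "c \<in> genideal (ring_on L) (set (take i rs))"
    if "i < length rs" "c \<in> L" "rs ! i * c \<in> genideal (ring_on L) (set (take i rs))" for i c
    using rs(1) that by (simp add: regular_sequence_def)
  \<comment> \<open>If a were 0, then a times 1 would lie in the ideal of the empty list, which is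
    {0}, and regularity would put 1 there.\<close>
  have "a \<noteq> 0"
  proof
    assume "a = 0"
    then show False using reg[of 0 1] by (simp add: abt L.genideal_empty)
  qed
  have mem: "c * u \<in> L" if c: "c \<in> localize_at S P P" for c
  proof -
    obtain d where "d \<in> S - P" "d * c \<in> P" using c by (auto simp: localize_ideal_iff[OF P])
    then have "d \<in> S - P" "d * (c * u) \<in> S" by (auto simp: P_def conductor_def mult.assoc)
    then show ?thesis unfolding L_def localize_iff[OF P] by blast
  qed
  have "\<forall>c\<in>L. b * c \<in> genideal (ring_on L) {a} \<longrightarrow> c \<in> genideal (ring_on L) {a}"
    using reg[of 1] by (simp add: abt)
  moreover have "a * u \<in> L" "b * u \<in> L" using mem rs(2) by (auto simp: abt)
  moreover have "b * (a * u) = (b * u) * a" by simp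
  ultimately have "a * u \<in> genideal (ring_on L) {a}"
    using L.genideal_single[OF aL(1)] by blast
  then have "u \<in> L" using L.genideal_single[OF aL(1)] \<open>a \<noteq> 0\<close> by (auto simp: mult.commute[of a])
  then obtain d where "d \<in> S - P" "d * u \<in> S" by (auto simp: L_def localize_iff[OF P])
  \<comment> \<open>Such a d belongs to \<open>conductor u\<close>, which is P.\<close>
  then show False by (auto simp: P_def conductor_def)
qed

text \<open>Elements of \<open>r\<inverse> S\<close> outside \<open>S\<^sub>P\<close>. Their conductors are the annihilators of elements of
  \<open>S / (r S\<^sub>P \<inter> S)\<close>, up to multiplying the element by something outside \<open>P\<close>.\<close>

definition nonlocal_fractions :: "'a set \<Rightarrow> 'a \<Rightarrow> 'a set" where
  "nonlocal_fractions P r = {u. r * u \<in> S \<and> u \<notin> localize_at S P S}"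

text \<open>If su falls into the local ring, take a denominator b of it outside P. Being a unit of
  the local ring, b cannot bring u into it, so bu stays in the family while b(su) lies in S. This is
  the second alternative of \<open>conductor_maximal_prime\<close>.\<close>

lemma nonlocal_fractions_smult:
  assumes P: "primeideal P (ring_on S)" and u: "u \<in> nonlocal_fractions P r" and s: "s \<in> S"
  shows "s * u \<in> nonlocal_fractions P r \<or>
    (\<exists>b\<in>S - P. b * u \<in> nonlocal_fractions P r \<and> b * (s * u) \<in> S)"
proof (cases "s * u \<in> localize_at S P S")
  case False
  have "s * (r * u) \<in> S" using u s by (simp add: nonlocal_fractions_def)
  then show ?thesis using False by (simp add: nonlocal_fractions_def mult_ac)
next
  case True
  then obtain b where b: "b \<in> S - P" "b * (s * u) \<in> S" by (auto simp: localize_iff[OF P])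
  have "b * (r * u) \<in> S" using u b by (simp add: nonlocal_fractions_def)
  moreover have "b * u \<notin> localize_at S P S"
  proof
    assume "b * u \<in> localize_at S P S"
    then obtain c where c: "c \<in> S - P" "c * b * u \<in> S" by (auto simp: localize_iff[OF P] mult.assoc)
    have "u \<in> localize_at S P S"
      unfolding localize_iff[OF P] using compl_prime_mult[OF P c(1) b(1)] c(2) by blast
    then show False using u by (simp add: nonlocal_fractions_def)
  qed
  ultimately show ?thesis using b by (auto simp: nonlocal_fractions_def mult_ac)
qed

lemma nonlocal_fractions_notin:
  assumes P: "primeideal P (ring_on S)" and u: "u \<in> nonlocal_fractions P r"
  shows "u \<notin> S" "conductor u \<subseteq> P"
proof -
  have "u \<notin> localize_at S P S" using u by (simp add: nonlocal_fractions_def)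
  then show "u \<notin> S" "conductor u \<subseteq> P"
    using localize_self_subset[OF P self_ideal] by (blast, auto simp: conductor_def localize_iff[OF P])
qed

lemma nonlocal_fractions_prime:
  assumes P: "primeideal P (ring_on S)" and v: "conductor_maximal (nonlocal_fractions P r) v"
  shows "primeideal (conductor v) (ring_on S)"
  using nonlocal_fractions_smult[OF P] nonlocal_fractions_notin[OF P]
  by (intro conductor_maximal_prime[OF v]) blast+

text \<open>The family of fractions over f is chosen so that f lies in all its conductors: the prime
  found is thus nonzero. It is inside P because the fractions avoid the local ring, and it is not P
  because P contains the ideal of G, which admits no denominators outside S.\<close>

lemma codim_ge_2_of_eq_overring:
  assumes noeth: "noetherian_ring (ring_on S)" and G: "G \<subseteq> S" "f \<in> G" "f \<noteq> 0"
    and eq: "S = overring G"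
  shows "2 \<le> codim (ring_on S) (genideal (ring_on S) G)"
proof (rule codim_ge_2I)
  fix P assume P: "primeideal P (ring_on S)" and GP: "genideal (ring_on S) G \<subseteq> P"
  have fP: "f \<in> P" using GP R.genideal_self[of G] G by auto
  \<comment> \<open>The family is nonempty because f lies in P and so is no unit of the local
    ring.\<close>
  have "1 / f \<in> nonlocal_fractions P f"
  proof -
    have "1 / f \<notin> localize_at S P S"
    proof
      assume "1 / f \<in> localize_at S P S"
      then obtain b where b: "b \<in> S - P" "b / f \<in> S" by (auto simp: localize_iff[OF P])
      then have "b / f * f \<in> P" using idealD(4)[OF primeidealD(1)[OF P]] fP by blast
      then show False using b \<open>f \<noteq> 0\<close> by simp
    qed
    then show ?thesis using \<open>f \<noteq> 0\<close> by (simp add: nonlocal_fractions_def)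
  qed
  then obtain v where v: "conductor_maximal (nonlocal_fractions P f) v"
    using conductor_maximal_exists[OF noeth] by metis
  then have vn: "v \<in> nonlocal_fractions P f" by (simp add: conductor_maximal_def)
  have pr: "primeideal (conductor v) (ring_on S)" by (rule nonlocal_fractions_prime[OF P v])
  have "f \<in> conductor v" using vn G by (auto simp: conductor_def nonlocal_fractions_def)
  moreover have "conductor v \<noteq> P"
  proof
    assume "conductor v = P"
    then have "v \<in> S" using eq_overring_iff_no_denominators[OF noeth G(1)] eq GP by blast
    then show False using nonlocal_fractions_notin[OF P vn] by simp
  qed
  ultimately show "\<exists>Q. primeideal Q (ring_on S) \<and> Q \<noteq> {0} \<and> Q \<subset> P"
    using pr nonlocal_fractions_notin(2)[OF P vn] \<open>f \<noteq> 0\<close> by blast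
qed

end

section \<open>Normal Noetherian domains satisfy S2\<close>

context field_subring
begin

text \<open>The family may repeat values, so the coefficients sit on a set J of representatives and
  are 0 at the other indices.\<close>

lemma genideal_image:
  assumes "finite I" "f ` I \<subseteq> S" "x \<in> genideal (ring_on S) (f ` I)"
  obtains s where "\<And>i. i \<in> I \<Longrightarrow> s i \<in> S" "x = (\<Sum>i\<in>I. s i * f i)"
proof -
  obtain J where J: "J \<subseteq> I" "inj_on f J" "f ` I = f ` J"
    using subset_image_inj[of "f ` I" f I] by auto
  obtain t where t: "t \<in> f ` I \<rightarrow> S" "x = (\<Sum>a\<in>f ` I. t a * a)"
    using assms genideal_finite[of "f ` I"] by auto
  define s where "s i = (if i \<in> J then t (f i) else 0)" for i
  have "x = (\<Sum>i\<in>J. t (f i) * f i)"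
    unfolding t(2) J(3) by (simp add: sum.reindex[OF J(2)])
  also have "\<dots> = (\<Sum>i\<in>I. s i * f i)"
    using J(1) assms(1) by (intro sum.mono_neutral_cong_left) (auto simp: s_def)
  finally have "x = (\<Sum>i\<in>I. s i * f i)" .
  moreover have "s i \<in> S" if "i \<in> I" for i
    using that t(1) by (auto simp: s_def)
  ultimately show ?thesis using that by blast
qed

text \<open>The exponent n = 0 does no harm: the equation would read 1 = 0.\<close>

lemma integral_over_iff:
  "integral_over S z \<longleftrightarrow> (\<exists>n a. (\<forall>i<n. a i \<in> S) \<and> z ^ n = (\<Sum>i<n. a i * z ^ i))"
proof
  assume "integral_over S z"
  then obtain p where p: "\<And>i. Polynomial.coeff p i \<in> S" "Polynomial.lead_coeff p = 1" "Polynomial.poly p z = 0"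
    by (auto simp: integral_over_def)
  have "(\<Sum>i<Polynomial.degree p. Polynomial.coeff p i * z ^ i) + z ^ Polynomial.degree p = 0"
    using p(2,3) by (simp add: poly_altdef flip: lessThan_Suc_atMost)
  then have "z ^ Polynomial.degree p = (\<Sum>i<Polynomial.degree p. - Polynomial.coeff p i * z ^ i)"
    by (simp add: sum_negf add_eq_0_iff2)
  moreover have "\<forall>i<Polynomial.degree p. - Polynomial.coeff p i \<in> S" using p(1) by simp
  ultimately show "\<exists>n a. (\<forall>i<n. a i \<in> S) \<and> z ^ n = (\<Sum>i<n. a i * z ^ i)"
    by (intro exI[of _ "Polynomial.degree p"] exI[of _ "\<lambda>i. - Polynomial.coeff p i"]) auto
next
  assume "\<exists>n a. (\<forall>i<n. a i \<in> S) \<and> z ^ n = (\<Sum>i<n. a i * z ^ i)"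
  then obtain n a where a: "\<And>i. i < n \<Longrightarrow> a i \<in> S" "z ^ n = (\<Sum>i<n. a i * z ^ i)" by auto
  define p where "p = Polynomial.monom 1 n - (\<Sum>i<n. Polynomial.monom (a i) i)"
  have cf: "Polynomial.coeff p k = (if k = n then 1 else if k < n then - a k else 0)" for k
    by (auto simp: p_def coeff_sum)
  have "Polynomial.degree p = n"
    using cf by (intro antisym degree_le le_degree) auto
  then have "Polynomial.lead_coeff p = 1" using cf by simp
  moreover have "Polynomial.poly p z = 0"
    using a by (simp add: p_def poly_sum poly_monom)
  moreover have "Polynomial.coeff p k \<in> S" for k
    using a(1) by (auto simp: cf)
  ultimately show "integral_over S z" unfolding integral_over_def by blast
qed

text \<open>For a nonzero q in I, the ideals generated by q, qv, ..., \<open>q v^(n-1)\<close>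
  become stationary. Then \<open>q v^n\<close> is a combination of the earlier products, and
  cancelling q leaves a monic equation for v, without determinants.\<close>

lemma integral_over_if_stabilizes_ideal:
  assumes noeth: "noetherian_ring (ring_on S)" and I: "ideal I (ring_on S)" "I \<noteq> {0}"
    and v: "\<And>a. a \<in> I \<Longrightarrow> a * v \<in> I"
  shows "integral_over S v"
proof -
  obtain q where q: "q \<in> I" "q \<noteq> 0" using I idealD(2)[OF I(1)] by blast
  have qI: "q * v ^ k \<in> I" for k
  proof (induction k)
    case (Suc k)
    then show ?case using v[of "q * v ^ k"] by (simp add: mult_ac)
  qed (use q in auto)
  then have qS: "q * v ^ k \<in> S" for k using idealD(1)[OF I(1)] by blast
  define K where "K n = genideal (ring_on S) ((\<lambda>i. q * v ^ i) ` {..<n})" for n :: nat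
  have Kid: "ideal (K n) (ring_on S)" for n
    unfolding K_def using qS by (intro R.genideal_ideal) auto
  obtain M where M: "M \<in> range K" "\<And>J. J \<in> range K \<Longrightarrow> M \<subseteq> J \<Longrightarrow> J = M"
    using noetherian_max[OF noeth, of "range K"] Kid by auto
  then obtain n where n: "M = K n" by auto
  have self: "(\<lambda>i. q * v ^ i) ` {..<k} \<subseteq> K k" for k
    unfolding K_def using qS by (intro R.genideal_self) auto
  have "K n \<subseteq> K (Suc n)"
    unfolding K_def[of n] using order_trans[OF image_mono self[of "Suc n"], of "{..<n}"]
    by (intro genideal_minimal' Kid) auto
  then have "K (Suc n) = K n" using M n by auto
  then have "q * v ^ n \<in> K n" using self[of "Suc n"] by auto
  then obtain s where s: "\<And>i. i \<in> {..<n} \<Longrightarrow> s i \<in> S" "q * v ^ n = (\<Sum>i<n. s i * (q * v ^ i))"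
    unfolding K_def using qS by (elim genideal_image[rotated 2]) auto
  have "q * v ^ n = q * (\<Sum>i<n. s i * v ^ i)"
    unfolding s(2) by (simp add: sum_distrib_left mult_ac)
  then have eq: "v ^ n = (\<Sum>i<n. s i * v ^ i)" using q by simp
  then show ?thesis
    unfolding integral_over_iff using s(1) by (intro exI[of _ n] exI[of _ s]) simp
qed

section \<open>Prime avoidance and finiteness of associated primes\<close>

lemma ideal_prod_mem:
  assumes "ideal I (ring_on S)" "finite A" "\<And>i. i \<in> A \<Longrightarrow> f i \<in> S" "j \<in> A" "f j \<in> I"
  shows "prod f A \<in> I"
proof -
  have "prod f A = prod f (A - {j}) * f j"
    using assms by (simp add: prod.remove[of A j] mult.commute)
  then show ?thesis
    using idealD(4)[OF assms(1) _ assms(5)] prod_mem[of "A - {j}" f] assms(3) by auto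
qed

lemma prime_prod_mem:
  assumes "primeideal P (ring_on S)" "finite A" "\<And>i. i \<in> A \<Longrightarrow> f i \<in> S" "prod f A \<in> P"
  obtains i where "i \<in> A" "f i \<in> P"
  using assms(2,3,4)
proof (induction A arbitrary: thesis rule: finite_induct)
  case empty
  then show ?case using primeidealD(2)[OF assms(1)] by auto
next
  case (insert a A)
  have "f a \<in> S" "prod f A \<in> S" "f a * prod f A \<in> P"
    using insert by (auto intro!: prod_mem)
  then consider "f a \<in> P" | "prod f A \<in> P"
    using primeidealD(3)[OF assms(1)] by blast
  then show ?case
  proof cases
    case 1
    then show ?thesis using insert.prems(1) by blast
  next
    case 2
    show ?thesis
    proof (rule insert.IH)
      show "thesis" if "i \<in> A" "f i \<in> P" for i
        using insert.prems(1) that by blast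
    qed (use insert.prems 2 in auto)
  qed
qed

text \<open>Otherwise the product of elements chosen from each \<open>I i\<close> outside P lies in
  every \<open>I i\<close>, hence in P, which is prime. The intersection is phrased through elements
  of S, so that for empty F it is S itself.\<close>

lemma prime_contains_inter:
  assumes P: "primeideal P (ring_on S)" and F: "finite F" "\<And>i. i \<in> F \<Longrightarrow> ideal (I i) (ring_on S)"
    and sub: "\<And>s. s \<in> S \<Longrightarrow> (\<And>i. i \<in> F \<Longrightarrow> s \<in> I i) \<Longrightarrow> s \<in> P"
  shows "\<exists>i\<in>F. I i \<subseteq> P"
proof (rule ccontr)
  assume "\<not> ?thesis"
  then have "\<forall>i\<in>F. \<exists>t. t \<in> I i \<and> t \<notin> P" by blast
  then obtain t where t: "\<And>i. i \<in> F \<Longrightarrow> t i \<in> I i" "\<And>i. i \<in> F \<Longrightarrow> t i \<notin> P" by metis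
  have tS: "\<And>i. i \<in> F \<Longrightarrow> t i \<in> S" using t(1) idealD(1)[OF F(2)] by blast
  have "prod t F \<in> P"
  proof (rule sub)
    show "prod t F \<in> S" using tS by (rule prod_mem)
    show "prod t F \<in> I i" if "i \<in> F" for i
      using ideal_prod_mem[where f = t, OF F(2)[OF that] F(1) _ that t(1)[OF that]] tS by blast
  qed
  then obtain i where "i \<in> F" "t i \<in> P"
    using prime_prod_mem[of P F t] P F(1) tS by blast
  then show False using t(2) by blast
qed

text \<open>In a minimal cover each Q has an element \<open>y Q\<close> of I that lies in no other
  member. Then \<open>y Q0\<close> plus the product of the other \<open>y Q\<close> lies in I but in
  no member.\<close>

lemma prime_avoidance:
  assumes I: "ideal I (ring_on S)" and F: "finite F" "\<And>Q. Q \<in> F \<Longrightarrow> primeideal Q (ring_on S)"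
    and cover: "I \<subseteq> \<Union>F"
  shows "\<exists>Q\<in>F. I \<subseteq> Q"
  using F cover
proof (induction F rule: finite_psubset_induct)
  case (psubset F)
  show ?case
  proof (cases "\<exists>F'\<subset>F. I \<subseteq> \<Union>F'")
    case True
    then obtain F' where "F' \<subset> F" "I \<subseteq> \<Union>F'" by blast
    then show ?thesis using psubset.IH[of F'] psubset.prems by blast
  next
    case False
    have mini: "\<exists>x\<in>I. x \<notin> \<Union>(F - {Q})" if "Q \<in> F" for Q
      using False that by blast
    then obtain y where y: "\<And>Q. Q \<in> F \<Longrightarrow> y Q \<in> I" "\<And>Q. Q \<in> F \<Longrightarrow> y Q \<notin> \<Union>(F - {Q})"
      by metis
    have yQ: "y Q \<in> Q" if "Q \<in> F" for Q using y[OF that] psubset.prems(2) by blast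
    have yS: "y Q \<in> S" if "Q \<in> F" for Q using y(1)[OF that] idealD(1)[OF I] by blast
    obtain Q0 where Q0: "Q0 \<in> F" using psubset.prems(2) idealD(2)[OF I] by blast
    note Q0p = psubset.prems(1)[OF Q0]
    note fin = psubset.hyps
    define z where "z = prod y (F - {Q0})"
    show ?thesis
    \<comment> \<open>For a single prime the product z is empty and equals 1, which need not lie in
      I.\<close>
    proof (cases "F = {Q0}")
      case True
      then show ?thesis using psubset.prems(2) by auto
    next
      case False
      then obtain Q1 where Q1: "Q1 \<in> F - {Q0}" using Q0 by blast
      have zI: "z \<in> I"
        unfolding z_def using fin yS y(1) Q1 by (intro ideal_prod_mem[OF I, of _ _ Q1]) auto
      have nz: "z \<notin> Q0"
      proof
        assume "z \<in> Q0"
        then obtain Q where "Q \<in> F - {Q0}" "y Q \<in> Q0"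
          unfolding z_def using prime_prod_mem[of Q0 "F - {Q0}" y] Q0p fin yS by blast
        then show False using y(2)[of Q] Q0 by auto
      qed
      have "y Q0 + z \<in> I" using idealD(3)[OF I y(1)[OF Q0] zI] .
      then obtain Q where Q: "Q \<in> F" "y Q0 + z \<in> Q" using psubset.prems(2) by auto
      note Qi = primeidealD(1)[OF psubset.prems(1)[OF Q(1)]]
      have sub: "a - b \<in> Q" if "a \<in> Q" "b \<in> Q" for a b
        using idealD(3)[OF Qi that(1) idealD(4)[OF Qi uminus_mem[OF one_mem] that(2)]] by simp
      have False
      proof (cases "Q = Q0")
        case True
        then show False using sub[OF Q(2), of "y Q0"] yQ[OF Q0] nz by simp
      next
        case False
        have "z \<in> Q"
          unfolding z_def using fin yS yQ False Q(1) by (intro ideal_prod_mem[OF Qi, of _ _ Q]) auto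
        then show False using sub[OF Q(2), of z] y(2)[OF Q0] Q(1) False by auto
      qed
      then show ?thesis ..
    qed
  qed
qed

text \<open>Multiplication by r moves the fractions into S, where those of a suitable finite set F
  generate a largest ideal. Any further v is then a combination of F, so \<open>conductor v\<close>
  contains the intersection of the conductors from F; being prime it contains one of them, and by
  maximality equals it. Only the conductors are finite in number, not the fractions.\<close>

lemma finitely_many_maximal_conductors:
  assumes noeth: "noetherian_ring (ring_on S)" and r: "r \<in> S" "r \<noteq> 0"
    and P: "primeideal P (ring_on S)"
  obtains F where "finite F" "\<And>w. w \<in> F \<Longrightarrow> conductor_maximal (nonlocal_fractions P r) w"
    "\<And>v. conductor_maximal (nonlocal_fractions P r) v \<Longrightarrow> \<exists>w\<in>F. conductor v = conductor w"
proof -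
  define V where "V = {v. conductor_maximal (nonlocal_fractions P r) v}"
  define K where "K F = genideal (ring_on S) ((*) r ` F)" for F
  have VS: "(*) r ` V \<subseteq> S"
    by (auto simp: V_def conductor_maximal_def nonlocal_fractions_def)
  have Kid: "ideal (K F) (ring_on S)" if "F \<subseteq> V" for F
    unfolding K_def using VS that by (intro R.genideal_ideal) auto
  have self: "(*) r ` F \<subseteq> K F" if "F \<subseteq> V" for F
    unfolding K_def using VS that by (intro R.genideal_self) auto
  obtain M where M: "M \<in> K ` {F. finite F \<and> F \<subseteq> V}"
    "\<And>J. J \<in> K ` {F. finite F \<and> F \<subseteq> V} \<Longrightarrow> M \<subseteq> J \<Longrightarrow> J = M"
    using Kid by (rule_tac noetherian_max[OF noeth, of "K ` {F. finite F \<and> F \<subseteq> V}"]) auto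
  then obtain F where F: "M = K F" "finite F" "F \<subseteq> V" by auto
  have "\<exists>w\<in>F. conductor v = conductor w" if v: "v \<in> V" for v
  proof -
    have vF: "insert v F \<subseteq> V" using v F by auto
    have "K F \<subseteq> K (insert v F)"
      unfolding K_def[of F] using self[OF vF] by (intro genideal_minimal' Kid[OF vF]) auto
    then have "K (insert v F) = K F" using M(2)[of "K (insert v F)"] F vF by auto
    then have "r * v \<in> K F" using self[OF vF] by auto
    then obtain s where s: "\<And>i. i \<in> F \<Longrightarrow> s i \<in> S" "r * v = (\<Sum>w\<in>F. s w * (r * w))"
      unfolding K_def using VS F by (elim genideal_image[rotated 2]) auto
    have "r * v = r * (\<Sum>w\<in>F. s w * w)"
      unfolding s(2) by (simp add: sum_distrib_left mult_ac)
    then have veq: "v = (\<Sum>w\<in>F. s w * w)" using r by simp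
    have "\<exists>w\<in>F. conductor w \<subseteq> conductor v"
    proof (rule prime_contains_inter)
      show "primeideal (conductor v) (ring_on S)"
        using v nonlocal_fractions_prime[OF P] by (simp add: V_def)
      fix t assume t: "t \<in> S" "\<And>w. w \<in> F \<Longrightarrow> t \<in> conductor w"
      have "t * v = (\<Sum>w\<in>F. s w * (t * w))"
        by (subst veq) (simp add: sum_distrib_left mult_ac)
      also have "\<dots> \<in> S" using t s(1) by (auto intro!: sum_mem simp: conductor_def)
      finally show "t \<in> conductor v" using t by (simp add: conductor_def)
    qed (use F conductor_ideal in auto)
    then obtain w where w: "w \<in> F" "conductor w \<subseteq> conductor v" by blast
    then have "conductor_maximal (nonlocal_fractions P r) w" using F by (auto simp: V_def)
    then show ?thesis using w v by (auto simp: conductor_maximal_def V_def)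
  qed
  then show ?thesis using that F by (auto simp: V_def)
qed

text \<open>If some p in P avoids the finitely many maximal conductors, then p is regular modulo r
  in the local ring. Otherwise prime avoidance puts P inside one of them, and conductors of nonlocal
  fractions lie inside P.\<close>

lemma depth_ge_2_or_conductor:
  assumes noeth: "noetherian_ring (ring_on S)" and P: "primeideal P (ring_on S)"
    and r: "r \<in> P" "r \<noteq> 0"
  obtains "2 \<le> depth (ring_on (localize_at S P S)) (localize_at S P P)"
  | v where "v \<in> nonlocal_fractions P r" "conductor v = P"
proof -
  note Pi = primeidealD(1)[OF P]
  have rS: "r \<in> S" using r idealD(1)[OF Pi] by auto
  define L where "L = localize_at S P S"
  interpret L: field_subring L unfolding L_def by (rule localize_subring[OF P])
  note SL = localize_self_subset[OF P self_ideal, folded L_def]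
  note PL = localize_self_subset[OF P Pi]
  note Lp = localize_prime(1)[OF P P order_refl, folded L_def]
  obtain F where F: "finite F" "\<And>w. w \<in> F \<Longrightarrow> conductor_maximal (nonlocal_fractions P r) w"
    "\<And>v. conductor_maximal (nonlocal_fractions P r) v \<Longrightarrow> \<exists>w\<in>F. conductor v = conductor w"
    using finitely_many_maximal_conductors[OF noeth rS r(2) P] by metis
  show ?thesis
  proof (cases "P \<subseteq> \<Union>(conductor ` F)")
    case True
    moreover have "primeideal Q (ring_on S)" if "Q \<in> conductor ` F" for Q
      using that F(2) nonlocal_fractions_prime[OF P] by blast
    ultimately have "\<exists>Q\<in>conductor ` F. P \<subseteq> Q"
      using F(1) by (intro prime_avoidance[OF Pi]) auto
    then obtain v where v: "v \<in> F" "P \<subseteq> conductor v" by auto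
    then have "v \<in> nonlocal_fractions P r" using F(2) by (auto simp: conductor_maximal_def)
    then show ?thesis
      using that(2)[of v] v nonlocal_fractions_notin(2)[OF P] by blast
  next
    case False
    then obtain p where p: "p \<in> P" "\<And>w. w \<in> F \<Longrightarrow> p \<notin> conductor w" by auto
    have pS: "p \<in> S" using p idealD(1)[OF Pi] by auto
    have npV: "p \<notin> conductor u" if u: "u \<in> nonlocal_fractions P r" for u
    proof
      assume pu: "p \<in> conductor u"
      obtain v where v: "conductor_maximal (nonlocal_fractions P r) v" "conductor u \<subseteq> conductor v"
        using conductor_maximal_exists[OF noeth u] .
      then obtain w where "w \<in> F" "conductor v = conductor w" using F(3) by blast
      then show False using p(2) pu v by blast
    qed
    have reg: "c \<in> genideal (ring_on L) {r}" if c: "c \<in> L" "p * c \<in> genideal (ring_on L) {r}" for c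
    proof (rule ccontr)
      assume nc: "c \<notin> genideal (ring_on L) {r}"
      \<comment> \<open>Writing c as ru in the field turns divisibility of c by r in L into
        membership of u in L.\<close>
      obtain u where "c = u * r" using r(2) by (metis nonzero_eq_divide_eq)
      then have cu: "c = r * u" by (simp add: mult.commute)
      have rL: "r \<in> L" using rS SL by auto
      have nu: "u \<notin> L" using nc unfolding L.genideal_single[OF rL] cu by (auto simp: mult.commute)
      obtain l where "l \<in> L" "p * (r * u) = l * r"
        using c(2) unfolding L.genideal_single[OF rL] cu by auto
      then have "p * u \<in> L" using r(2) by (simp add: mult_ac)
      then obtain b where b: "b \<in> S - P" "b * (p * u) \<in> S" unfolding L_def localize_iff[OF P] by blast
      obtain d where d: "d \<in> S - P" "d * (r * u) \<in> S" using c(1) unfolding cu L_def localize_iff[OF P] by blast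
      \<comment> \<open>The denominators b of pu and d of ru are applied together: bdu is still
        outside L, where bd is a unit, and both r and p multiply it into S.\<close>
      have bd: "b * d \<in> S - P" by (rule compl_prime_mult[OF P b(1) d(1)])
      have "b * d * u \<notin> L"
      proof
        assume "b * d * u \<in> L"
        then obtain e where "e \<in> S - P" "e * (b * d * u) \<in> S" unfolding L_def localize_iff[OF P] by blast
        then have "e * (b * d) \<in> S - P" "e * (b * d) * u \<in> S"
          using compl_prime_mult[OF P _ bd] by (auto simp: mult.assoc)
        then show False using nu unfolding L_def localize_iff[OF P] by blast
      qed
      moreover have "b * (d * (r * u)) \<in> S" "d * (b * (p * u)) \<in> S" using b d by auto
      ultimately have "b * d * u \<in> nonlocal_fractions P r" "p \<in> conductor (b * d * u)"
        using pS by (auto simp: nonlocal_fractions_def conductor_def L_def mult_ac)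
      then show False using npV by blast
    qed
    have "regular_sequence (ring_on L) [r, p]"
      unfolding regular_sequence_def
    proof (intro conjI allI ballI impI)
      show "set [r, p] \<subseteq> carrier (ring_on L)" using rS pS SL by auto
      have "genideal (ring_on L) (set [r, p]) \<subseteq> localize_at S P P"
        using r p PL by (intro L.genideal_minimal' L.primeidealD(1)[OF Lp]) auto
      then show "genideal (ring_on L) (set [r, p]) \<noteq> carrier (ring_on L)"
        using L.primeidealD(2)[OF Lp] by auto
      fix i a
      assume i: "i < length [r, p]" and a: "a \<in> carrier (ring_on L)"
        "[r, p] ! i \<otimes>\<^bsub>ring_on L\<^esub> a \<in> genideal (ring_on L) (set (take i [r, p]))"
      consider "i = 0" | "i = 1" using i by fastforce
      then show "a \<in> genideal (ring_on L) (set (take i [r, p]))"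
        by cases (use a r reg in \<open>auto simp: L.genideal_empty\<close>)
    qed
    moreover have "set [r, p] \<subseteq> localize_at S P P" using r p PL by auto
    ultimately have "enat (length [r, p]) \<le> depth (ring_on L) (localize_at S P P)"
      unfolding depth_def by (intro SUP_upper) auto
    then show ?thesis using that(1) by (simp add: L_def numeral_eq_enat numeral_2_eq_2)
  qed
qed

theorem normal_imp_serre_S2:
  assumes noeth: "noetherian_ring (ring_on S)" and normal: "normal_subring S"
  shows "serre_S 2 S"
  unfolding serre_S_def
proof (intro allI impI)
  fix P assume P: "primeideal P (ring_on S)"
  note Pi = primeidealD(1)[OF P]
  define L where "L = localize_at S P S"
  let ?d = "depth (ring_on L) (localize_at S P P)"
  show "min (enat 2) (krull_dim (ring_on (localize_at S P S)))
      \<le> depth (ring_on (localize_at S P S)) (localize_at S P P)"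
  proof (cases "P = {0}")
    case True
    \<comment> \<open>No prime lies strictly below {0}, so the local ring has dimension 0 and the
      bound is trivial.\<close>
    have "krull_dim (ring_on (localize_at S P S)) \<le> enat 0"
    proof (rule krull_dim_localize_le[OF P])
      fix Q :: "nat \<Rightarrow> 'a set"
      assume Q: "\<And>i. i \<le> Suc 0 \<Longrightarrow> primeideal (Q i) (ring_on S)"
        "\<And>i. i \<le> 0 \<Longrightarrow> Q i \<subset> Q (Suc i)" "Q (Suc 0) \<subseteq> P"
      have "0 \<in> Q 0" using idealD(2)[OF primeidealD(1)[OF Q(1)]] by auto
      then show False using Q(2)[of 0] Q(3) True by auto
    qed
    then show ?thesis by (simp add: min_def zero_enat_def[symmetric])
  next
    case False
    then obtain r where r: "r \<in> P" "r \<noteq> 0" using idealD(2)[OF Pi] by blast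
    consider "2 \<le> depth (ring_on (localize_at S P S)) (localize_at S P P)"
      | v where "v \<in> nonlocal_fractions P r" "conductor v = P"
      using depth_ge_2_or_conductor[OF noeth P r] .
    then show ?thesis
    proof cases
      case 1
      then show ?thesis
        by (intro min.coboundedI1) (simp add: numeral_eq_enat)
    next
      case (2 v)
      have vS: "v \<notin> S" using nonlocal_fractions_notin(1)[OF P 2(1)] .
      have rS: "r \<in> S" using r idealD(1)[OF Pi] by auto
      have "r * v \<in> S" using 2(1) by (simp add: nonlocal_fractions_def)
      then have "v \<in> fractions S"
        using r rS unfolding fractions_def
        by (intro CollectI exI[of _ "r * v"] exI[of _ r]) simp
      then have nint: "\<not> integral_over S v" using vS normal by (auto simp: normal_subring_def)
      have zero: "Q = {0}" if Q: "primeideal Q (ring_on S)" "Q \<subset> P" for Q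
      proof (rule ccontr)
        assume "Q \<noteq> {0}"
        note Qi = primeidealD(1)[OF Q(1)]
        obtain p where p: "p \<in> P" "p \<notin> Q" using Q by blast
        have "q * v \<in> Q" if q: "q \<in> Q" for q
        proof -
          have S: "q * v \<in> S" "p * v \<in> S" "p \<in> S" using q p Q 2(2) by (auto simp: conductor_def)
          \<comment> \<open>Since P is the conductor of v, pv lies in S and the product lies in Q;
            p, being outside Q, can be cancelled.\<close>
          have "p * (q * v) = (p * v) * q" by simp
          then have "p * (q * v) \<in> Q" using idealD(4)[OF Qi S(2) q] by (simp add: mult_ac)
          then show ?thesis using primeidealD(3)[OF Q(1) S(3,1)] p by blast
        qed
        then show False
          using integral_over_if_stabilizes_ideal[OF noeth Qi \<open>Q \<noteq> {0}\<close>] nint by blast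
      qed
      have "krull_dim (ring_on (localize_at S P S)) \<le> enat 1"
      proof (rule krull_dim_localize_le[OF P])
        fix Q :: "nat \<Rightarrow> 'a set"
        assume Q: "\<And>i. i \<le> Suc 1 \<Longrightarrow> primeideal (Q i) (ring_on S)"
          "\<And>i. i \<le> 1 \<Longrightarrow> Q i \<subset> Q (Suc i)" "Q (Suc 1) \<subseteq> P"
        have "Q 0 \<subset> Q 1" "Q 1 \<subset> P" using Q(2)[of 0] Q(2)[of 1] Q(3) by auto
        moreover from this have "Q 1 = {0}" using zero[of "Q 1"] Q(1) by auto
        moreover have "0 \<in> Q 0" using idealD(2)[OF primeidealD(1)[OF Q(1)]] by auto
        ultimately show False by auto
      qed
      \<comment> \<open>A nonzero r of P is a regular sequence of length 1, which is all that
        dimension at most 1 demands.\<close>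
      moreover have "enat 1 \<le> depth (ring_on (localize_at S P S)) (localize_at S P P)"
      proof -
        interpret L: field_subring "localize_at S P S" by (rule localize_subring[OF P])
        note PL = localize_self_subset[OF P Pi]
        note Lp = localize_prime(1)[OF P P order_refl]
        have "genideal (ring_on (localize_at S P S)) {r} \<subseteq> localize_at S P P"
          using r PL by (intro L.genideal_minimal' L.primeidealD(1)[OF Lp]) auto
        then have "regular_sequence (ring_on (localize_at S P S)) [r]"
          using r rS localize_self_subset[OF P self_ideal] L.primeidealD(2)[OF Lp] L.one_mem
          unfolding regular_sequence_def by (auto simp: L.genideal_empty)
        moreover have "set [r] \<subseteq> localize_at S P P" using r PL by auto
        ultimately have "enat (length [r]) \<le> depth (ring_on (localize_at S P S)) (localize_at S P P)"
          unfolding depth_def by (intro SUP_upper) auto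
        then show ?thesis by simp
      qed
      ultimately show ?thesis by (meson min.coboundedI2 order_trans)
    qed
  qed
qed

end

section \<open>The first Ext group\<close>

lemma free_module_simps [simp]:
  "c \<in> carrier (free_module R A) \<longleftrightarrow>
     (\<forall>x. c x \<in> carrier R) \<and> finite {x. c x \<noteq> \<zero>\<^bsub>R\<^esub>} \<and> {x. c x \<noteq> \<zero>\<^bsub>R\<^esub>} \<subseteq> A"
  "ring.zero (free_module R A) = (\<lambda>x. \<zero>\<^bsub>R\<^esub>)"
  "add (free_module R A) c d = (\<lambda>x. c x \<oplus>\<^bsub>R\<^esub> d x)"
  "module.smult (free_module R A) r c = (\<lambda>x. r \<otimes>\<^bsub>R\<^esub> c x)"
  by (auto simp: free_module_def)

lemma self_module_simps [simp]:
  "carrier (self_module R) = carrier R"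
  "ring.zero (self_module R) = \<zero>\<^bsub>R\<^esub>"
  "add (self_module R) = add R"
  "module.smult (self_module R) = monoid.mult R"
  by (simp_all add: self_module_def)

lemma syzygy_simps [simp]:
  "c \<in> carrier (syzygy R M) \<longleftrightarrow> c \<in> carrier (free_module R (carrier M)) \<and> free_cover R M c = \<zero>\<^bsub>M\<^esub>"
  "ring.zero (syzygy R M) = (\<lambda>x. \<zero>\<^bsub>R\<^esub>)"
  "add (syzygy R M) c d = (\<lambda>x. c x \<oplus>\<^bsub>R\<^esub> d x)"
  "module.smult (syzygy R M) r c = (\<lambda>x. r \<otimes>\<^bsub>R\<^esub> c x)"
  by (auto simp: syzygy_def free_module_def)

lemma free_module_is_module:
  assumes "cring R"
  shows "module R (free_module R A)"
proof -
  interpret cring R by fact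
  have add: "(\<lambda>x. c x \<oplus>\<^bsub>R\<^esub> d x) \<in> carrier (free_module R A)"
    if "c \<in> carrier (free_module R A)" "d \<in> carrier (free_module R A)" for c d
  proof -
    have sub: "{x. c x \<oplus>\<^bsub>R\<^esub> d x \<noteq> \<zero>\<^bsub>R\<^esub>} \<subseteq> {x. c x \<noteq> \<zero>\<^bsub>R\<^esub>} \<union> {x. d x \<noteq> \<zero>\<^bsub>R\<^esub>}" by auto
    then have "finite {x. c x \<oplus>\<^bsub>R\<^esub> d x \<noteq> \<zero>\<^bsub>R\<^esub>}" using that by (auto intro: finite_subset)
    then show ?thesis using that sub by auto
  qed
  have smult: "(\<lambda>x. r \<otimes>\<^bsub>R\<^esub> c x) \<in> carrier (free_module R A)"
    if "r \<in> carrier R" "c \<in> carrier (free_module R A)" for r c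
  proof -
    have sub: "{x. r \<otimes>\<^bsub>R\<^esub> c x \<noteq> \<zero>\<^bsub>R\<^esub>} \<subseteq> {x. c x \<noteq> \<zero>\<^bsub>R\<^esub>}" using that by auto
    then have "finite {x. r \<otimes>\<^bsub>R\<^esub> c x \<noteq> \<zero>\<^bsub>R\<^esub>}" using that by (auto intro: finite_subset)
    then show ?thesis using that sub by auto
  qed
  show ?thesis
  proof (rule moduleI)
    show "abelian_group (free_module R A)"
    proof (rule abelian_groupI)
      fix c assume c: "c \<in> carrier (free_module R A)"
      have "(\<lambda>x. \<ominus>\<^bsub>R\<^esub> \<one>\<^bsub>R\<^esub> \<otimes>\<^bsub>R\<^esub> c x) \<in> carrier (free_module R A)"
        using smult[OF _ c] by auto
      moreover have "(\<lambda>x. \<ominus>\<^bsub>R\<^esub> \<one>\<^bsub>R\<^esub> \<otimes>\<^bsub>R\<^esub> c x) \<oplus>\<^bsub>free_module R A\<^esub> c = \<zero>\<^bsub>free_module R A\<^esub>"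
        using c by (auto simp: l_minus l_neg)
      ultimately show "\<exists>d\<in>carrier (free_module R A). d \<oplus>\<^bsub>free_module R A\<^esub> c = \<zero>\<^bsub>free_module R A\<^esub>"
        by blast
    qed (use add in \<open>auto simp: a_ac\<close>)
  qed (use smult in \<open>auto simp: \<open>cring R\<close> l_distr r_distr m_assoc\<close>)
qed

definition basis_vector :: "('r, 'c) ring_scheme \<Rightarrow> 'x \<Rightarrow> 'x \<Rightarrow> 'r" where
  "basis_vector R x = (\<lambda>y. if y = x then \<one>\<^bsub>R\<^esub> else \<zero>\<^bsub>R\<^esub>)"

lemma linear_mapsD:
  assumes "h \<in> linear_maps R M N"
  shows "x \<in> carrier M \<Longrightarrow> h x \<in> carrier N"
    and "x \<in> carrier M \<Longrightarrow> y \<in> carrier M \<Longrightarrow> h (x \<oplus>\<^bsub>M\<^esub> y) = h x \<oplus>\<^bsub>N\<^esub> h y"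
    and "r \<in> carrier R \<Longrightarrow> x \<in> carrier M \<Longrightarrow> h (r \<odot>\<^bsub>M\<^esub> x) = r \<odot>\<^bsub>N\<^esub> h x"
    and "h \<in> extensional (carrier M)"
  using assms by (auto simp: linear_maps_def PiE_def)

text \<open>Members of \<open>linear_maps\<close> are extensional, so every map given by a formula
  has to be restricted before it can be one.\<close>

lemma restrict_linear_maps:
  assumes "module R M"
    and "\<And>x. x \<in> carrier M \<Longrightarrow> h x \<in> carrier N"
    and "\<And>x y. x \<in> carrier M \<Longrightarrow> y \<in> carrier M \<Longrightarrow> h (x \<oplus>\<^bsub>M\<^esub> y) = h x \<oplus>\<^bsub>N\<^esub> h y"
    and "\<And>r x. r \<in> carrier R \<Longrightarrow> x \<in> carrier M \<Longrightarrow> h (r \<odot>\<^bsub>M\<^esub> x) = r \<odot>\<^bsub>N\<^esub> h x"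
  shows "(\<lambda>x\<in>carrier M. h x) \<in> linear_maps R M N"
proof -
  interpret module R M by fact
  show ?thesis using assms(2-) by (auto simp: linear_maps_def)
qed

lemma linear_maps_zero:
  assumes "module R M" "module R N" "h \<in> linear_maps R M N"
  shows "h \<zero>\<^bsub>M\<^esub> = \<zero>\<^bsub>N\<^esub>"
proof -
  interpret M: module R M by fact
  interpret N: module R N by fact
  have "h (\<zero>\<^bsub>R\<^esub> \<odot>\<^bsub>M\<^esub> \<zero>\<^bsub>M\<^esub>) = \<zero>\<^bsub>R\<^esub> \<odot>\<^bsub>N\<^esub> h \<zero>\<^bsub>M\<^esub>"
    by (rule linear_mapsD(3)[OF assms(3)]) auto
  also have "\<dots> = \<zero>\<^bsub>N\<^esub>"
    using linear_mapsD(1)[OF assms(3) M.M.zero_closed] by (rule N.smult_l_null)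
  finally show ?thesis by (simp only: M.smult_l_null[OF M.M.zero_closed])
qed

context module
begin

lemma free_cover_eq:
  assumes "\<And>x. c x \<in> carrier R" "finite B" "{x. c x \<noteq> \<zero>} \<subseteq> B" "B \<subseteq> carrier M"
  shows "free_cover R M c = (\<Oplus>\<^bsub>M\<^esub>x\<in>B. c x \<odot>\<^bsub>M\<^esub> x)"
  unfolding free_cover_def
  by (rule M.add.finprod_mono_neutral_cong_left) (use assms in auto)

lemma free_cover_closed:
  assumes "c \<in> carrier (free_module R (carrier M))"
  shows "free_cover R M c \<in> carrier M"
  unfolding free_cover_def by (rule M.finsum_closed) (use assms in auto)

lemma free_cover_add:
  assumes c: "c \<in> carrier (free_module R (carrier M))" and d: "d \<in> carrier (free_module R (carrier M))"
  shows "free_cover R M (\<lambda>x. c x \<oplus> d x) = free_cover R M c \<oplus>\<^bsub>M\<^esub> free_cover R M d"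
proof -
  define B where "B = {x. c x \<noteq> \<zero>} \<union> {x. d x \<noteq> \<zero>}"
  have B: "finite B" "B \<subseteq> carrier M" using c d by (auto simp: B_def)
  have "free_cover R M (\<lambda>x. c x \<oplus> d x) = (\<Oplus>\<^bsub>M\<^esub>x\<in>B. (c x \<oplus> d x) \<odot>\<^bsub>M\<^esub> x)"
    using c d B by (intro free_cover_eq) (auto simp: B_def)
  also have "\<dots> = (\<Oplus>\<^bsub>M\<^esub>x\<in>B. c x \<odot>\<^bsub>M\<^esub> x \<oplus>\<^bsub>M\<^esub> d x \<odot>\<^bsub>M\<^esub> x)"
    using c d B by (intro M.finsum_cong') (auto simp: smult_l_distr)
  also have "\<dots> = (\<Oplus>\<^bsub>M\<^esub>x\<in>B. c x \<odot>\<^bsub>M\<^esub> x) \<oplus>\<^bsub>M\<^esub> (\<Oplus>\<^bsub>M\<^esub>x\<in>B. d x \<odot>\<^bsub>M\<^esub> x)"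
    using c d B by (intro M.finsum_addf) auto
  also have "(\<Oplus>\<^bsub>M\<^esub>x\<in>B. c x \<odot>\<^bsub>M\<^esub> x) = free_cover R M c"
    using c B by (intro free_cover_eq[symmetric]) (auto simp: B_def)
  also have "(\<Oplus>\<^bsub>M\<^esub>x\<in>B. d x \<odot>\<^bsub>M\<^esub> x) = free_cover R M d"
    using d B by (intro free_cover_eq[symmetric]) (auto simp: B_def)
  finally show ?thesis .
qed

lemma free_cover_smult:
  assumes r: "r \<in> carrier R" and c: "c \<in> carrier (free_module R (carrier M))"
  shows "free_cover R M (\<lambda>x. r \<otimes> c x) = r \<odot>\<^bsub>M\<^esub> free_cover R M c"
proof -
  define B where "B = {x. c x \<noteq> \<zero>}"
  have B: "finite B" "B \<subseteq> carrier M" using c by (auto simp: B_def)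
  have "free_cover R M (\<lambda>x. r \<otimes> c x) = (\<Oplus>\<^bsub>M\<^esub>x\<in>B. (r \<otimes> c x) \<odot>\<^bsub>M\<^esub> x)"
    using c r B by (intro free_cover_eq) (auto simp: B_def)
  also have "\<dots> = (\<Oplus>\<^bsub>M\<^esub>x\<in>B. r \<odot>\<^bsub>M\<^esub> (c x \<odot>\<^bsub>M\<^esub> x))"
    using c r B by (intro M.finsum_cong') (auto simp: smult_assoc1)
  also have "\<dots> = r \<odot>\<^bsub>M\<^esub> (\<Oplus>\<^bsub>M\<^esub>x\<in>B. c x \<odot>\<^bsub>M\<^esub> x)"
    using c r B by (intro finsum_smult_ldistr[symmetric]) auto
  also have "(\<Oplus>\<^bsub>M\<^esub>x\<in>B. c x \<odot>\<^bsub>M\<^esub> x) = free_cover R M c"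
    using c B by (intro free_cover_eq[symmetric]) (auto simp: B_def)
  finally show ?thesis .
qed

lemma basis_vector_mem: "x \<in> A \<Longrightarrow> basis_vector R x \<in> carrier (free_module R A)"
  by (auto simp: basis_vector_def)

lemma free_cover_basis_vector:
  assumes "x \<in> carrier M"
  shows "free_cover R M (basis_vector R x) = x"
proof -
  have "free_cover R M (basis_vector R x) = (\<Oplus>\<^bsub>M\<^esub>y\<in>{x}. basis_vector R x y \<odot>\<^bsub>M\<^esub> y)"
    using assms by (intro free_cover_eq) (auto simp: basis_vector_def)
  then show ?thesis using assms by (simp add: basis_vector_def)
qed

lemma free_cover_zero: "free_cover R M (\<lambda>x. \<zero>) = \<zero>\<^bsub>M\<^esub>"
  by (simp add: free_cover_def)

lemma syzygy_is_module: "module R (syzygy R M)"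
proof -
  interpret F: module R "free_module R (carrier M)"
    by (rule free_module_is_module[OF R.cring_axioms])
  have sub: "c \<in> carrier (free_module R (carrier M))" if "c \<in> carrier (syzygy R M)" for c
    using that by simp
  have add: "(\<lambda>x. c x \<oplus> d x) \<in> carrier (syzygy R M)"
    if "c \<in> carrier (syzygy R M)" "d \<in> carrier (syzygy R M)" for c d
    using F.M.a_closed[OF that[THEN sub]] that free_cover_add[OF that[THEN sub]]
    by (simp only: syzygy_simps(1) free_module_simps(3) M.l_zero M.zero_closed)
  have smult: "(\<lambda>x. r \<otimes> c x) \<in> carrier (syzygy R M)"
    if "r \<in> carrier R" "c \<in> carrier (syzygy R M)" for r c
    using F.smult_closed[OF that(1) sub[OF that(2)]] that free_cover_smult[OF that(1) sub[OF that(2)]]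
    by (simp only: syzygy_simps(1) free_module_simps(4) smult_r_null)
  have mem: "c x \<in> carrier R" if "c \<in> carrier (syzygy R M)" for c x
    using that by simp
  show ?thesis
  proof (rule moduleI)
    show "abelian_group (syzygy R M)"
    proof (rule abelian_groupI)
      fix c assume c: "c \<in> carrier (syzygy R M)"
      have "(\<lambda>x. \<ominus> \<one> \<otimes> c x) \<in> carrier (syzygy R M)"
        using smult[OF _ c] by auto
      moreover have "(\<lambda>x. \<ominus> \<one> \<otimes> c x) \<oplus>\<^bsub>syzygy R M\<^esub> c = \<zero>\<^bsub>syzygy R M\<^esub>"
        using mem[OF c] by (auto simp: R.l_minus R.l_neg)
      ultimately show "\<exists>d\<in>carrier (syzygy R M). d \<oplus>\<^bsub>syzygy R M\<^esub> c = \<zero>\<^bsub>syzygy R M\<^esub>"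
        by blast
    next
      show "\<zero>\<^bsub>syzygy R M\<^esub> \<in> carrier (syzygy R M)" by (simp add: free_cover_zero)
    qed (use add mem in \<open>auto simp: R.a_ac simp del: syzygy_simps(1)\<close>)
  qed (use smult mem in
      \<open>auto simp: R.cring_axioms R.l_distr R.r_distr R.m_assoc simp del: syzygy_simps(1)\<close>)
qed

end

lemma Hom_group_simps [simp]:
  "carrier (Hom_group R M N) = linear_maps R M N"
  "monoid.mult (Hom_group R M N) g h = (\<lambda>x\<in>carrier M. g x \<oplus>\<^bsub>N\<^esub> h x)"
  "one (Hom_group R M N) = (\<lambda>x\<in>carrier M. \<zero>\<^bsub>N\<^esub>)"
  by (simp_all add: Hom_group_def)

lemma Hom_group_subgroup:
  assumes "module R M" "module R N"
  shows "comm_group (Hom_group R M N)"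
    and "h \<in> linear_maps R M N \<Longrightarrow> inv\<^bsub>Hom_group R M N\<^esub> h = (\<lambda>x\<in>carrier M. \<ominus>\<^bsub>N\<^esub> h x)"
    and "h \<in> linear_maps R M N \<Longrightarrow> (\<lambda>x\<in>carrier M. \<ominus>\<^bsub>N\<^esub> h x) \<in> linear_maps R M N"
proof -
  interpret M: module R M by fact
  interpret N: module R N by fact
  note D = linear_mapsD
  show neg: "(\<lambda>x\<in>carrier M. \<ominus>\<^bsub>N\<^esub> h x) \<in> linear_maps R M N" if "h \<in> linear_maps R M N" for h
    by (rule restrict_linear_maps) (auto simp: assms D[OF that] N.M.minus_add N.smult_r_minus)
  have inv: "(\<lambda>x\<in>carrier M. \<ominus>\<^bsub>N\<^esub> h x) \<otimes>\<^bsub>Hom_group R M N\<^esub> h = \<one>\<^bsub>Hom_group R M N\<^esub>"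
    if "h \<in> linear_maps R M N" for h
    by (auto simp: D[OF that] N.M.l_neg)
  show comm: "comm_group (Hom_group R M N)"
  proof (rule comm_groupI)
    fix g h k assume "g \<in> carrier (Hom_group R M N)" "h \<in> carrier (Hom_group R M N)"
    then have g: "g \<in> linear_maps R M N" and h: "h \<in> linear_maps R M N" by auto
    have "(\<lambda>x\<in>carrier M. g x \<oplus>\<^bsub>N\<^esub> h x) \<in> linear_maps R M N"
      by (rule restrict_linear_maps) (auto simp: assms D[OF g] D[OF h] N.M.a_ac N.smult_r_distr)
    then show "g \<otimes>\<^bsub>Hom_group R M N\<^esub> h \<in> carrier (Hom_group R M N)" by simp
    show "g \<otimes>\<^bsub>Hom_group R M N\<^esub> h = h \<otimes>\<^bsub>Hom_group R M N\<^esub> g"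
      by (auto simp: D[OF g] D[OF h] N.M.a_comm)
    assume "k \<in> carrier (Hom_group R M N)"
    then have k: "k \<in> linear_maps R M N" by auto
    show "g \<otimes>\<^bsub>Hom_group R M N\<^esub> h \<otimes>\<^bsub>Hom_group R M N\<^esub> k =
        g \<otimes>\<^bsub>Hom_group R M N\<^esub> (h \<otimes>\<^bsub>Hom_group R M N\<^esub> k)"
      by (auto simp: D[OF g] D[OF h] D[OF k] N.M.a_assoc)
  next
    have "(\<lambda>x\<in>carrier M. \<zero>\<^bsub>N\<^esub>) \<in> linear_maps R M N"
      by (rule restrict_linear_maps) (auto simp: assms)
    then show "\<one>\<^bsub>Hom_group R M N\<^esub> \<in> carrier (Hom_group R M N)" by simp
    fix h assume "h \<in> carrier (Hom_group R M N)"
    then have h: "h \<in> linear_maps R M N" by simp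
    show "\<one>\<^bsub>Hom_group R M N\<^esub> \<otimes>\<^bsub>Hom_group R M N\<^esub> h = h"
      using D(4)[OF h] by (auto simp: D[OF h] extensional_def)
    show "\<exists>g\<in>carrier (Hom_group R M N). g \<otimes>\<^bsub>Hom_group R M N\<^esub> h = \<one>\<^bsub>Hom_group R M N\<^esub>"
      using neg[OF h] inv[OF h] by (auto simp del: Hom_group_simps(2,3))
  qed
  interpret H: comm_group "Hom_group R M N" by (rule comm)
  show "inv\<^bsub>Hom_group R M N\<^esub> h = (\<lambda>x\<in>carrier M. \<ominus>\<^bsub>N\<^esub> h x)" if "h \<in> linear_maps R M N" for h
    using inv[OF that] neg[OF that] that by (intro H.inv_equality) auto
qed

lemma (in comm_group) trivial_quotient_iff:
  assumes Z: "subgroup Z G" and B: "subgroup B G" "B \<subseteq> Z"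
  shows "trivial_group (G\<lparr>carrier := Z\<rparr> Mod B) \<longleftrightarrow> Z \<subseteq> B"
proof -
  define H where "H = G\<lparr>carrier := Z\<rparr>"
  interpret H: group H unfolding H_def by (rule subgroup_imp_group[OF Z])
  interpret H: comm_group H
    by (rule H.group_comm_groupI) (use subgroup.subset[OF Z] in \<open>auto simp: H_def intro!: m_comm\<close>)
  have BH: "subgroup B H" unfolding H_def by (rule subgroup_incl[OF B(1) Z B(2)])
  interpret N: normal B H by (rule H.subgroup_imp_normal[OF BH])
  have grp: "group (H Mod B)" by (rule N.factorgroup_is_group)
  have "trivial_group (H Mod B) \<longleftrightarrow> rcosets\<^bsub>H\<^esub> B = {B}"
    using grp by (simp add: trivial_group_def FactGroup_def)
  also have "\<dots> \<longleftrightarrow> Z \<subseteq> B"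
  proof
    assume eq: "rcosets\<^bsub>H\<^esub> B = {B}"
    show "Z \<subseteq> B"
    proof
      fix z assume "z \<in> Z"
      then have z: "z \<in> carrier H" by (simp add: H_def)
      then have "B #>\<^bsub>H\<^esub> z = B" using eq by (auto simp: RCOSETS_def)
      then show "z \<in> B" using H.rcos_self[OF z BH] by simp
    qed
  next
    assume "Z \<subseteq> B"
    then have "Z = B" using B by auto
    then have eq: "B #>\<^bsub>H\<^esub> z = B" if "z \<in> Z" for z
      using that H.coset_join2[OF _ BH] by (simp add: H_def)
    have "\<one>\<^bsub>H\<^esub> \<in> Z" using H.one_closed by (simp add: H_def)
    then show "rcosets\<^bsub>H\<^esub> B = {B}"
      using eq by (auto simp: RCOSETS_def H_def)
  qed
  finally show ?thesis by (simp add: H_def)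
qed

text \<open>Cocycles are the maps on F1 that vanish on the kernel of \<open>d1\<close>, so they are
  the maps factoring through the surjection of F1 onto the syzygies K. A coboundary is one whose
  factor on K extends to F0.\<close>

lemma Ext1_trivial_iff:
  assumes M: "module R M" and N: "module R N"
  shows "trivial_group (Ext1 R M N) \<longleftrightarrow>
    (\<forall>\<chi> \<in> linear_maps R (syzygy R M) N.
       \<exists>\<psi> \<in> linear_maps R (free_module R (carrier M)) N. \<forall>k \<in> carrier (syzygy R M). \<psi> k = \<chi> k)"
    (is "_ \<longleftrightarrow> ?ext")
proof -
  interpret M: module R M by fact
  interpret N: module R N by fact
  define K where "K = syzygy R M"
  define F0 where "F0 = free_module R (carrier M)"
  define F1 where "F1 = free_module R (carrier K)"
  interpret K: module R K unfolding K_def by (rule M.syzygy_is_module)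
  interpret F0: module R F0 unfolding F0_def by (rule free_module_is_module[OF M.R.cring_axioms])
  interpret F1: module R F1 unfolding F1_def by (rule free_module_is_module[OF M.R.cring_axioms])
  define L where "L = syzygy R K"
  interpret L: module R L unfolding L_def by (rule K.syzygy_is_module)
  define F2 where "F2 = free_module R (carrier L)"
  define d1 where "d1 = free_cover R K"
  define d2 where "d2 = free_cover R L"
  define Z where "Z = {\<phi> \<in> linear_maps R F1 N. \<forall>c \<in> carrier F2. \<phi> (d2 c) = \<zero>\<^bsub>N\<^esub>}"
  define B where "B = {\<lambda>c \<in> carrier F1. \<psi> (d1 c) | \<psi>. \<psi> \<in> linear_maps R F0 N}"
  have Ext: "Ext1 R M N = (Hom_group R F1 N)\<lparr>carrier := Z\<rparr> Mod B"
    unfolding Ext1_def Let_def Z_def B_def d1_def d2_def F0_def F1_def F2_def L_def K_def ..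
  note D = linear_mapsD
  have K_F0: "k \<in> carrier F0" if "k \<in> carrier K" for k using that unfolding K_def F0_def by simp
  have K_ops: "a \<oplus>\<^bsub>K\<^esub> b = a \<oplus>\<^bsub>F0\<^esub> b" "r \<odot>\<^bsub>K\<^esub> a = r \<odot>\<^bsub>F0\<^esub> a" "\<zero>\<^bsub>K\<^esub> = \<zero>\<^bsub>F0\<^esub>" for a b r
    by (simp_all add: K_def F0_def)
  have L_iff: "c \<in> carrier L \<longleftrightarrow> c \<in> carrier F1 \<and> d1 c = \<zero>\<^bsub>K\<^esub>" for c
    by (simp add: L_def F1_def d1_def)
  have d1: "d1 c \<in> carrier K" if "c \<in> carrier F1" for c
    using that unfolding F1_def d1_def by (rule K.free_cover_closed)
  have d1_add: "d1 (c \<oplus>\<^bsub>F1\<^esub> d) = d1 c \<oplus>\<^bsub>K\<^esub> d1 d" if "c \<in> carrier F1" "d \<in> carrier F1" for c d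
    using K.free_cover_add[of c d] that by (simp add: F1_def d1_def)
  have d1_smult: "d1 (r \<odot>\<^bsub>F1\<^esub> c) = r \<odot>\<^bsub>K\<^esub> d1 c" if "r \<in> carrier R" "c \<in> carrier F1" for r c
    using K.free_cover_smult[of r c] that by (simp add: F1_def d1_def)
  have bv: "basis_vector R k \<in> carrier F1" "d1 (basis_vector R k) = k" if "k \<in> carrier K" for k
    using that K.basis_vector_mem[of k "carrier K"] K.free_cover_basis_vector unfolding F1_def d1_def by auto
  \<comment> \<open>Exactness at F1: \<open>d2\<close> maps onto L, since every element of L is the
    image of its basis vector.\<close>
  have Z_iff: "\<phi> \<in> Z \<longleftrightarrow> \<phi> \<in> linear_maps R F1 N \<and> (\<forall>c \<in> carrier L. \<phi> c = \<zero>\<^bsub>N\<^esub>)" for \<phi>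
  proof -
    have "d2 c \<in> carrier L" if "c \<in> carrier F2" for c
      using that unfolding F2_def d2_def by (rule L.free_cover_closed)
    moreover have "l \<in> d2 ` carrier F2" if "l \<in> carrier L" for l
      unfolding F2_def d2_def
      using L.basis_vector_mem[OF that] L.free_cover_basis_vector[OF that] by (metis image_eqI)
    ultimately have "carrier L = d2 ` carrier F2" by blast
    then show ?thesis unfolding Z_def by simp
  qed
  interpret G: comm_group "Hom_group R F1 N"
    by (rule Hom_group_subgroup(1)[OF F1.module_axioms N.module_axioms])
  note inv = Hom_group_subgroup(2)[OF F1.module_axioms N.module_axioms]
  have L_F1: "c \<in> carrier F1" if "c \<in> carrier L" for c using that L_iff by blast
  have Z: "subgroup Z (Hom_group R F1 N)"
  proof (rule G.subgroupI)
    show "Z \<subseteq> carrier (Hom_group R F1 N)" by (auto simp: Z_iff)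
    have "(\<lambda>x\<in>carrier F1. \<zero>\<^bsub>N\<^esub>) \<in> Z" using G.one_closed L_F1 by (simp add: Z_iff)
    then show "Z \<noteq> {}" by blast
    show "inv\<^bsub>Hom_group R F1 N\<^esub> a \<in> Z" if "a \<in> Z" for a
      using that G.inv_closed[of a] L_F1 inv[of a] by (auto simp: Z_iff)
    show "a \<otimes>\<^bsub>Hom_group R F1 N\<^esub> b \<in> Z" if "a \<in> Z" "b \<in> Z" for a b
      using that G.m_closed[of a b] L_F1 by (auto simp: Z_iff)
  qed
  have comp: "(\<lambda>c\<in>carrier F1. \<chi> (d1 c)) \<in> Z" if "\<chi> \<in> linear_maps R K N" for \<chi>
    unfolding Z_iff
  proof
    show "(\<lambda>c\<in>carrier F1. \<chi> (d1 c)) \<in> linear_maps R F1 N"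
      by (rule restrict_linear_maps) (auto simp: F1.module_axioms d1_add d1_smult d1 D[OF that])
    show "\<forall>c\<in>carrier L. (\<lambda>c\<in>carrier F1. \<chi> (d1 c)) c = \<zero>\<^bsub>N\<^esub>"
      using linear_maps_zero[OF K.module_axioms N.module_axioms that] by (simp add: L_iff)
  qed
  have restr: "(\<lambda>k\<in>carrier K. \<psi> k) \<in> linear_maps R K N" if "\<psi> \<in> linear_maps R F0 N" for \<psi>
    by (rule restrict_linear_maps) (auto simp: K.module_axioms K_F0 K_ops D[OF that])
  have BZ: "B \<subseteq> Z"
  proof
    fix b assume "b \<in> B"
    then obtain \<psi> where psi: "b = (\<lambda>c\<in>carrier F1. \<psi> (d1 c))" "\<psi> \<in> linear_maps R F0 N" by (auto simp: B_def)
    have "b = (\<lambda>c\<in>carrier F1. (\<lambda>k\<in>carrier K. \<psi> k) (d1 c))"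
      unfolding psi(1) using d1 by (intro restrict_ext) simp
    then show "b \<in> Z" using comp[OF restr[OF psi(2)]] by simp
  qed
  note Hom0 = Hom_group_subgroup[OF F0.module_axioms N.module_axioms]
  interpret G0: comm_group "Hom_group R F0 N" by (rule Hom0(1))
  have B: "subgroup B (Hom_group R F1 N)"
  proof (rule G.subgroupI)
    show "B \<subseteq> carrier (Hom_group R F1 N)" using BZ by (auto simp: Z_iff)
    have "\<one>\<^bsub>Hom_group R F0 N\<^esub> \<in> linear_maps R F0 N"
      using G0.one_closed by (simp only: Hom_group_simps(1))
    then show "B \<noteq> {}" unfolding B_def by blast
    show "inv\<^bsub>Hom_group R F1 N\<^esub> a \<in> B" if aB: "a \<in> B" for a
    proof -
      obtain \<psi> where psi: "a = (\<lambda>c\<in>carrier F1. \<psi> (d1 c))" "\<psi> \<in> linear_maps R F0 N"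
        using aB by (auto simp: B_def)
      have "inv\<^bsub>Hom_group R F1 N\<^esub> a = (\<lambda>c\<in>carrier F1. \<ominus>\<^bsub>N\<^esub> a c)"
        using aB BZ inv[of a] by (auto simp: Z_iff)
      also have "\<dots> = (\<lambda>c\<in>carrier F1. (\<lambda>k\<in>carrier F0. \<ominus>\<^bsub>N\<^esub> \<psi> k) (d1 c))"
        unfolding psi(1) using d1 K_F0 by (intro restrict_ext) simp
      finally show ?thesis unfolding B_def using Hom0(3)[OF psi(2)] by blast
    qed
    show "a \<otimes>\<^bsub>Hom_group R F1 N\<^esub> b \<in> B" if ab: "a \<in> B" "b \<in> B" for a b
    proof -
      obtain \<psi> \<xi> where psi: "a = (\<lambda>c\<in>carrier F1. \<psi> (d1 c))" "\<psi> \<in> linear_maps R F0 N"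
        and xi: "b = (\<lambda>c\<in>carrier F1. \<xi> (d1 c))" "\<xi> \<in> linear_maps R F0 N"
        using ab by (auto simp: B_def)
      have "a \<otimes>\<^bsub>Hom_group R F1 N\<^esub> b = (\<lambda>c\<in>carrier F1. (\<psi> \<otimes>\<^bsub>Hom_group R F0 N\<^esub> \<xi>) (d1 c))"
        unfolding psi(1) xi(1) using d1 K_F0 by (auto intro!: restrict_ext)
      moreover have "\<psi> \<otimes>\<^bsub>Hom_group R F0 N\<^esub> \<xi> \<in> linear_maps R F0 N"
        using G0.m_closed[of \<psi> \<xi>] psi xi by simp
      ultimately show ?thesis unfolding B_def by blast
    qed
  qed
  have "trivial_group (Ext1 R M N) \<longleftrightarrow> Z \<subseteq> B"
    unfolding Ext by (rule G.trivial_quotient_iff[OF Z B BZ])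
  also have "\<dots> \<longleftrightarrow> (\<forall>\<chi> \<in> linear_maps R K N. \<exists>\<psi> \<in> linear_maps R F0 N. \<forall>k \<in> carrier K. \<psi> k = \<chi> k)"
  proof
    assume ZB: "Z \<subseteq> B"
    show "\<forall>\<chi> \<in> linear_maps R K N. \<exists>\<psi> \<in> linear_maps R F0 N. \<forall>k \<in> carrier K. \<psi> k = \<chi> k"
    proof
      fix \<chi> assume "\<chi> \<in> linear_maps R K N"
      then obtain \<psi> where psi: "\<psi> \<in> linear_maps R F0 N"
        "(\<lambda>c\<in>carrier F1. \<chi> (d1 c)) = (\<lambda>c\<in>carrier F1. \<psi> (d1 c))"
        using comp ZB by (auto simp: B_def)
      have "\<psi> k = \<chi> k" if "k \<in> carrier K" for k
        using fun_cong[OF psi(2), of "basis_vector R k"] bv[OF that] by simp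
      then show "\<exists>\<psi> \<in> linear_maps R F0 N. \<forall>k \<in> carrier K. \<psi> k = \<chi> k" using psi(1) by blast
    qed
  next
    assume ext: "\<forall>\<chi> \<in> linear_maps R K N. \<exists>\<psi> \<in> linear_maps R F0 N. \<forall>k \<in> carrier K. \<psi> k = \<chi> k"
    show "Z \<subseteq> B"
    proof
      fix \<phi> assume "\<phi> \<in> Z"
      then have phi: "\<phi> \<in> linear_maps R F1 N" "\<And>c. c \<in> carrier L \<Longrightarrow> \<phi> c = \<zero>\<^bsub>N\<^esub>" by (auto simp: Z_iff)
      \<comment> \<open>A cocycle depends only on the image under \<open>d1\<close>, because the
        difference of two preimages lies in L.\<close>
      have eq: "\<phi> c = \<phi> d" if cd: "c \<in> carrier F1" "d \<in> carrier F1" "d1 c = d1 d" for c d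
      proof -
        define e where "e = \<ominus>\<^bsub>R\<^esub> \<one>\<^bsub>R\<^esub> \<odot>\<^bsub>F1\<^esub> d"
        have e: "e \<in> carrier F1" unfolding e_def using cd by (intro F1.smult_closed) auto
        have de: "d1 e = \<ominus>\<^bsub>R\<^esub> \<one>\<^bsub>R\<^esub> \<odot>\<^bsub>K\<^esub> d1 d" unfolding e_def using cd by (intro d1_smult) auto
        have "d1 (c \<oplus>\<^bsub>F1\<^esub> e) = d1 c \<oplus>\<^bsub>K\<^esub> \<ominus>\<^bsub>R\<^esub> \<one>\<^bsub>R\<^esub> \<odot>\<^bsub>K\<^esub> d1 d"
          unfolding d1_add[OF cd(1) e] de ..
        also have "\<dots> = \<zero>\<^bsub>K\<^esub>"
          unfolding cd(3) using d1[OF cd(2)] by (simp add: K.smult_l_minus K.M.r_neg)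
        finally have "\<phi> (c \<oplus>\<^bsub>F1\<^esub> e) = \<zero>\<^bsub>N\<^esub>" using phi(2) cd e by (simp add: L_iff)
        then have 0: "\<phi> c \<oplus>\<^bsub>N\<^esub> \<phi> e = \<zero>\<^bsub>N\<^esub>" using D(2)[OF phi(1) cd(1) e] by simp
        have dN: "\<phi> d \<in> carrier N" "\<phi> c \<in> carrier N" using D(1)[OF phi(1)] cd by auto
        have "\<phi> e = \<ominus>\<^bsub>R\<^esub> \<one>\<^bsub>R\<^esub> \<odot>\<^bsub>N\<^esub> \<phi> d"
          unfolding e_def using cd(2) by (intro D(3)[OF phi(1)]) auto
        also have "\<dots> = \<ominus>\<^bsub>N\<^esub> \<phi> d" using dN by (simp add: N.smult_l_minus)
        finally show ?thesis
          using 0 N.M.minus_equality[of "\<phi> c" "\<ominus>\<^bsub>N\<^esub> \<phi> d"] dN by simp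
      qed
      \<comment> \<open>Basis vectors are a section of \<open>d1\<close> that is not linear; the
        induced map is linear nevertheless, since \<open>eq\<close> ignores the choice of
        preimage.\<close>
      define \<chi> where "\<chi> = (\<lambda>k\<in>carrier K. \<phi> (basis_vector R k))"
      have "\<chi> \<in> linear_maps R K N"
        unfolding \<chi>_def
      proof (rule restrict_linear_maps)
        show "\<phi> (basis_vector R k) \<in> carrier N" if "k \<in> carrier K" for k
          using D(1)[OF phi(1)] bv that by blast
        show "\<phi> (basis_vector R (k \<oplus>\<^bsub>K\<^esub> l)) = \<phi> (basis_vector R k) \<oplus>\<^bsub>N\<^esub> \<phi> (basis_vector R l)"
          if "k \<in> carrier K" "l \<in> carrier K" for k l
          using that bv by (subst D(2)[OF phi(1), symmetric]) (auto intro!: eq simp: d1_add)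
        show "\<phi> (basis_vector R (r \<odot>\<^bsub>K\<^esub> k)) = r \<odot>\<^bsub>N\<^esub> \<phi> (basis_vector R k)"
          if "r \<in> carrier R" "k \<in> carrier K" for r k
          using that bv by (subst D(3)[OF phi(1), symmetric]) (auto intro!: eq simp: d1_smult)
      qed (rule K.module_axioms)
      then obtain \<psi> where psi: "\<psi> \<in> linear_maps R F0 N" "\<And>k. k \<in> carrier K \<Longrightarrow> \<psi> k = \<chi> k"
        using ext by blast
      have "\<phi> c = \<psi> (d1 c)" if "c \<in> carrier F1" for c
        using psi(2)[OF d1[OF that]] d1[OF that] eq[OF that] bv by (simp add: \<chi>_def)
      then have "\<phi> = (\<lambda>c\<in>carrier F1. \<psi> (d1 c))"
        using D(4)[OF phi(1)] by (auto simp: extensional_def)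
      then show "\<phi> \<in> B" unfolding B_def using psi(1) by blast
    qed
  qed
  finally show ?thesis by (simp only: K_def F0_def)
qed

section \<open>Ext of a quotient by an ideal, computed inside the field\<close>

lemma self_module_is_module:
  assumes "cring R"
  shows "module R (self_module R)"
proof -
  interpret cring R by fact
  show ?thesis
  proof (rule moduleI)
    show "abelian_group (self_module R)"
    proof (rule abelian_groupI)
      fix x assume "x \<in> carrier (self_module R)"
      then show "\<exists>y\<in>carrier (self_module R). y \<oplus>\<^bsub>self_module R\<^esub> x = \<zero>\<^bsub>self_module R\<^esub>"
        using l_neg[of x] a_inv_closed[of x] by auto
    qed (auto simp: a_ac)
  qed (auto simp: \<open>cring R\<close> l_distr r_distr m_assoc)
qed

lemma quotient_module_simps [simp]:
  "carrier (quotient_module R I) = carrier (R Quot I)"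
  "ring.zero (quotient_module R I) = \<zero>\<^bsub>R Quot I\<^esub>"
  "add (quotient_module R I) = add (R Quot I)"
  "module.smult (quotient_module R I) r A = (I +>\<^bsub>R\<^esub> r) \<otimes>\<^bsub>R Quot I\<^esub> A"
  by (simp_all add: quotient_module_def)

text \<open>Finite sums see only the additive part of a record, and this part is shared with the
  quotient ring.\<close>

lemma finsum_quotient_module: "finsum (quotient_module R I) = finsum (R Quot I)"
  by (intro ext) (simp add: finsum_def finprod_def quotient_module_def cong: if_cong)

lemma quotient_module_is_module:
  assumes R: "cring R" and I: "ideal I R"
  shows "module R (quotient_module R I)"
proof -
  interpret I: ideal I R by fact
  interpret h: ring_hom_cring R "R Quot I" "(+>\<^bsub>R\<^esub>) I"
    by (rule I.rcos_ring_hom_cring[OF R])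
  show ?thesis
  proof (rule moduleI)
    show "abelian_group (quotient_module R I)"
    proof (rule abelian_groupI)
      fix x assume "x \<in> carrier (quotient_module R I)"
      then show "\<exists>y\<in>carrier (quotient_module R I). y \<oplus>\<^bsub>quotient_module R I\<^esub> x = \<zero>\<^bsub>quotient_module R I\<^esub>"
        using h.S.l_neg[of x] h.S.a_inv_closed[of x] by auto
    qed (auto simp: h.S.a_ac)
  qed (auto simp: R h.S.l_distr h.S.r_distr h.S.m_assoc)
qed

context field_subring
begin

lemma finsum_eq_sum: "f \<in> A \<rightarrow> S \<Longrightarrow> finsum (ring_on S) f A = sum f A"
proof (induction A rule: infinite_finite_induct)
  case (insert x A)
  then show ?case by (subst R.finsum_insert) auto
qed (auto simp: R.finsum_infinite)

text \<open>With \<open>\<rho>\<close> lifting coset combinations to \<open>S\<close>, an element \<open>u\<close> with \<open>uI \<subseteq> S\<close> gives the linear map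
  \<open>u\<rho>\<close> on the syzygies, which extends to the free module only if \<open>u \<in> S\<close>. Conversely a linear map
  \<open>\<chi>\<close> on the syzygies extends to \<open>c \<mapsto> \<chi>(fc)/f\<close>, whose values are multiplied into \<open>S\<close> by \<open>I\<close>.\<close>

lemma Ext1_quotient_trivial_iff:
  assumes I: "ideal I (ring_on S)" and f: "f \<in> I" "f \<noteq> 0"
  shows "trivial_group (Ext1 (ring_on S) (quotient_module (ring_on S) I) (self_module (ring_on S)))
    \<longleftrightarrow> (\<forall>u. I \<subseteq> conductor u \<longrightarrow> u \<in> S)"
proof -
  define R where "R = ring_on S"
  define Q where "Q = quotient_module R I"
  have cR: "cring R" unfolding R_def by (rule ring_on_cring)
  interpret I: ideal I R unfolding R_def by (rule I)
  interpret Q: module R Q unfolding Q_def by (rule quotient_module_is_module[OF cR I.is_ideal])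
  interpret N: module R "self_module R" by (rule self_module_is_module[OF cR])
  let ?h = "(+>\<^bsub>R\<^esub>) I"
  interpret h: ring_hom_cring R "R Quot I" ?h by (rule I.rcos_ring_hom_cring[OF cR])
  define F0 where "F0 = free_module R (carrier Q)"
  define K where "K = syzygy R Q"
  interpret F0: module R F0 unfolding F0_def by (rule free_module_is_module[OF cR])
  interpret K: module R K unfolding K_def by (rule Q.syzygy_is_module)
  have Rs [simp]: "carrier R = S" "\<zero>\<^bsub>R\<^esub> = 0" "\<one>\<^bsub>R\<^esub> = 1" "\<And>a b. a \<otimes>\<^bsub>R\<^esub> b = a * b" "\<And>a b. a \<oplus>\<^bsub>R\<^esub> b = a + b"
    by (simp_all add: R_def)
  have Qs: "carrier Q = carrier (R Quot I)" "\<zero>\<^bsub>Q\<^esub> = \<zero>\<^bsub>R Quot I\<^esub>"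
    "\<And>r A. r \<odot>\<^bsub>Q\<^esub> A = ?h r \<otimes>\<^bsub>R Quot I\<^esub> A" "finsum Q = finsum (R Quot I)"
    by (simp_all add: Q_def finsum_quotient_module)
  have IS: "a \<in> S" if "a \<in> I" for a using that idealD(1)[OF I] by auto
  note D = linear_mapsD
  have h0: "?h a = \<zero>\<^bsub>R Quot I\<^esub> \<longleftrightarrow> a \<in> I" if "a \<in> S" for a
  proof
    assume "?h a = \<zero>\<^bsub>R Quot I\<^esub>"
    then have "I +>\<^bsub>R\<^esub> a = I" by (simp add: FactRing_def)
    then show "a \<in> I" using I.a_rcos_self[of a] that by simp
  next
    assume "a \<in> I"
    then show "?h a = \<zero>\<^bsub>R Quot I\<^esub>" using I.a_rcos_const by (simp add: FactRing_def)
  qed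
  have F0_iff: "c \<in> carrier F0 \<longleftrightarrow> (\<forall>A. c A \<in> S) \<and> finite {A. c A \<noteq> 0} \<and> {A. c A \<noteq> 0} \<subseteq> carrier Q" for c
    by (simp add: F0_def)
  have K_iff: "c \<in> carrier K \<longleftrightarrow> c \<in> carrier F0 \<and> free_cover R Q c = \<zero>\<^bsub>Q\<^esub>" for c
    by (simp add: K_def F0_def)
  have F0_ops: "c \<oplus>\<^bsub>F0\<^esub> d = (\<lambda>A. c A + d A)" "r \<odot>\<^bsub>F0\<^esub> c = (\<lambda>A. r * c A)" for c d r
    by (simp_all add: F0_def)
  have K_ops: "c \<oplus>\<^bsub>K\<^esub> d = (\<lambda>A. c A + d A)" "r \<odot>\<^bsub>K\<^esub> c = (\<lambda>A. r * c A)" for c d r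
    by (simp_all add: K_def)
  have IK: "(\<lambda>A. g * c A) \<in> carrier K" if g: "g \<in> I" and c: "c \<in> carrier F0" for g c
  proof -
    have "free_cover R Q (\<lambda>A. g * c A) = g \<odot>\<^bsub>Q\<^esub> free_cover R Q c"
      using Q.free_cover_smult[of g c] IS[OF g] c by (simp add: F0_def)
    also have "\<dots> = \<zero>\<^bsub>R Quot I\<^esub> \<otimes>\<^bsub>R Quot I\<^esub> free_cover R Q c"
      unfolding Qs(3) using h0[OF IS[OF g]] g by simp
    also have "\<dots> = \<zero>\<^bsub>Q\<^esub>"
      using Q.free_cover_closed[folded F0_def, OF c] unfolding Qs(1,2) by (rule h.S.l_null)
    finally show ?thesis
      using F0.smult_closed[of g c] IS[OF g] c unfolding K_iff F0_ops by simp
  qed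
  have KF: "k \<in> carrier F0" if "k \<in> carrier K" for k using that K_iff by blast
  have "(\<forall>\<chi> \<in> linear_maps R K (self_module R). \<exists>\<psi> \<in> linear_maps R F0 (self_module R). \<forall>k \<in> carrier K. \<psi> k = \<chi> k)
    \<longleftrightarrow> (\<forall>u. I \<subseteq> conductor u \<longrightarrow> u \<in> S)" (is "?ext \<longleftrightarrow> ?den")
  proof
    assume ext: ?ext
    show ?den
    proof (intro allI impI)
      fix u assume u: "I \<subseteq> conductor u"
      \<comment> \<open>The coset of 1 is lifted to 1 itself, so that \<rho> takes the value 1 on
        its basis vector.\<close>
      define rep where "rep A = (if A = ?h 1 then 1 else SOME a. a \<in> S \<and> ?h a = A)" for A
      have rep: "rep A \<in> S" "?h (rep A) = A" if A: "A \<in> carrier Q" for A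
      proof -
        have "\<exists>a. a \<in> S \<and> ?h a = A" using A by (auto simp: Qs FactRing_def A_RCOSETS_def' )
        then show "rep A \<in> S" "?h (rep A) = A"
          using someI_ex[of "\<lambda>a. a \<in> S \<and> ?h a = A"] by (auto simp: rep_def)
      qed
      define \<rho> where "\<rho> c = (\<Sum>A\<in>{A. c A \<noteq> 0}. c A * rep A)" for c
      have rho_eq: "\<rho> c = (\<Sum>A\<in>B. c A * rep A)" if "finite B" "{A. c A \<noteq> 0} \<subseteq> B" for c B
        unfolding \<rho>_def using that by (intro sum.mono_neutral_left) auto
      have rho_add: "\<rho> (\<lambda>A. c A + d A) = \<rho> c + \<rho> d" if "c \<in> carrier F0" "d \<in> carrier F0" for c d
      proof -
        let ?B = "{A. c A \<noteq> 0} \<union> {A. d A \<noteq> 0}"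
        have B: "finite ?B" using that by (simp add: F0_iff)
        have "\<rho> (\<lambda>A. c A + d A) = (\<Sum>A\<in>?B. (c A + d A) * rep A)" using B by (intro rho_eq) auto
        also have "\<dots> = (\<Sum>A\<in>?B. c A * rep A) + (\<Sum>A\<in>?B. d A * rep A)"
          by (simp add: distrib_right sum.distrib)
        also have "(\<Sum>A\<in>?B. c A * rep A) = \<rho> c" using B by (intro rho_eq[symmetric]) auto
        also have "(\<Sum>A\<in>?B. d A * rep A) = \<rho> d" using B by (intro rho_eq[symmetric]) auto
        finally show ?thesis .
      qed
      have rho_smult: "\<rho> (\<lambda>A. r * c A) = r * \<rho> c" if "c \<in> carrier F0" for r c
      proof -
        have "\<rho> (\<lambda>A. r * c A) = (\<Sum>A\<in>{A. c A \<noteq> 0}. r * c A * rep A)"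
          using that by (intro rho_eq) (auto simp: F0_iff)
        then show ?thesis by (simp add: \<rho>_def sum_distrib_left mult_ac)
      qed
      \<comment> \<open>The coset of \<open>\<rho> k\<close> is the value of the free cover at k,
        which vanishes for a syzygy; hence u times it lies in S.\<close>
      have rho_K: "\<rho> k \<in> I" if k: "k \<in> carrier K" for k
      proof -
        have kF: "\<And>A. k A \<in> S" "finite {A. k A \<noteq> 0}" "{A. k A \<noteq> 0} \<subseteq> carrier Q"
          using KF[OF k] by (auto simp: F0_iff)
        have mem: "(\<lambda>A. k A * rep A) \<in> {A. k A \<noteq> 0} \<rightarrow> S"
          using kF rep(1) by auto
        have "?h (\<rho> k) = ?h (finsum R (\<lambda>A. k A * rep A) {A. k A \<noteq> 0})"
          unfolding \<rho>_def R_def using mem by (simp add: finsum_eq_sum)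
        also have "\<dots> = (\<Oplus>\<^bsub>R Quot I\<^esub>A\<in>{A. k A \<noteq> 0}. ?h (k A * rep A))"
          using mem by (subst h.hom_finsum) (auto simp: o_def)
        also have "\<dots> = (\<Oplus>\<^bsub>R Quot I\<^esub>A\<in>{A. k A \<noteq> 0}. ?h (k A) \<otimes>\<^bsub>R Quot I\<^esub> A)"
        proof (rule h.S.finsum_cong')
          show "?h (k A * rep A) = ?h (k A) \<otimes>\<^bsub>R Quot I\<^esub> A" if A: "A \<in> {A. k A \<noteq> 0}" for A
            using h.hom_mult[of "k A" "rep A"] kF rep[of A] A by auto
        qed (use kF in \<open>auto simp: Qs\<close>)
        also have "\<dots> = free_cover R Q k" by (simp add: free_cover_def Qs)
        also have "\<dots> = \<zero>\<^bsub>R Quot I\<^esub>" using k by (simp add: K_iff Qs)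
        finally have "?h (\<rho> k) = \<zero>\<^bsub>R Quot I\<^esub>" .
        moreover have "\<rho> k \<in> S" unfolding \<rho>_def using mem by (intro sum_mem) auto
        ultimately show ?thesis using h0 by blast
      qed
      have "(\<lambda>k\<in>carrier K. \<rho> k * u) \<in> linear_maps R K (self_module R)"
      proof (rule restrict_linear_maps)
        show "\<rho> k * u \<in> carrier (self_module R)" if "k \<in> carrier K" for k
          using rho_K[OF that] u by (auto simp: conductor_def)
      qed (use rho_add rho_smult KF in \<open>auto simp: K.module_axioms K_ops distrib_right mult.assoc\<close>)
      then obtain \<psi> where psi: "\<psi> \<in> linear_maps R F0 (self_module R)"
        "\<And>k. k \<in> carrier K \<Longrightarrow> \<psi> k = \<rho> k * u"
        using ext by force
      define e where "e = basis_vector R (?h 1)"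
      have "?h 1 \<in> carrier Q" unfolding Qs by (rule h.hom_closed) simp
      then have e: "e \<in> carrier F0" unfolding e_def F0_def by (rule Q.basis_vector_mem)
      have "\<rho> e = 1"
      proof -
        have "\<rho> e = (\<Sum>A\<in>{?h 1}. e A * rep A)" by (intro rho_eq) (auto simp: e_def basis_vector_def)
        then show ?thesis by (simp add: e_def basis_vector_def rep_def)
      qed
      \<comment> \<open>The basis vector e is not a syzygy in general, but fe is, since f lies in I.
        So the extension is known on fe, and dividing by f exhibits u as a value of it.\<close>
      then have "f * u = \<psi> (\<lambda>A. f * e A)"
        using psi(2)[OF IK[OF f(1) e]] rho_smult[OF e] by simp
      also have "\<dots> = f * \<psi> e"
        using D(3)[OF psi(1), of f e] e IS[OF f(1)] by (simp add: F0_ops)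
      finally have "u = \<psi> e" using f by simp
      then show "u \<in> S" using D(1)[OF psi(1) e] by simp
    qed
  next
    assume den: ?den
    show ?ext
    proof
      fix \<chi> assume chi: "\<chi> \<in> linear_maps R K (self_module R)"
      have fS: "f \<in> S" by (rule IS[OF f(1)])
      define \<psi> where "\<psi> = (\<lambda>c\<in>carrier F0. \<chi> (\<lambda>A. f * c A) / f)"
      \<comment> \<open>Both sides are the value at gfc. Hence every g in I multiplies the quotient
        \<open>\<chi>(fc)/f\<close> to \<open>\<chi>(gc)\<close>, an element of S.\<close>
      have cross: "g * \<chi> (\<lambda>A. f * c A) = f * \<chi> (\<lambda>A. g * c A)"
        if g: "g \<in> I" and c: "c \<in> carrier F0" for g c
      proof -
        have "g * \<chi> (\<lambda>A. f * c A) = \<chi> (\<lambda>A. g * (f * c A))"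
          using D(3)[OF chi, of g "\<lambda>A. f * c A"] IK[OF f(1) c] IS[OF g] by (simp add: K_ops)
        also have "\<dots> = \<chi> (\<lambda>A. f * (g * c A))" by (simp add: mult_ac)
        also have "\<dots> = f * \<chi> (\<lambda>A. g * c A)"
          using D(3)[OF chi, of f "\<lambda>A. g * c A"] IK[OF g c] fS by (simp add: K_ops)
        finally show ?thesis .
      qed
      have "\<psi> \<in> linear_maps R F0 (self_module R)"
        unfolding \<psi>_def
      proof (rule restrict_linear_maps)
        fix c assume c: "c \<in> carrier F0"
        have "I \<subseteq> conductor (\<chi> (\<lambda>A. f * c A) / f)"
        proof
          fix g assume g: "g \<in> I"
          have "g * (\<chi> (\<lambda>A. f * c A) / f) = \<chi> (\<lambda>A. g * c A)" using cross[OF g c] f by (simp add: field_simps)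
          then show "g \<in> conductor (\<chi> (\<lambda>A. f * c A) / f)"
            using D(1)[OF chi IK[OF g c]] IS[OF g] by (simp add: conductor_def)
        qed
        then show "\<chi> (\<lambda>A. f * c A) / f \<in> carrier (self_module R)" using den by simp
        show "\<chi> (\<lambda>A. f * (r \<odot>\<^bsub>F0\<^esub> c) A) / f = r \<odot>\<^bsub>self_module R\<^esub> (\<chi> (\<lambda>A. f * c A) / f)"
          if "r \<in> carrier R" for r
          using D(3)[OF chi that IK[OF f(1) c]] by (simp add: F0_ops K_ops mult.left_commute)
        fix d assume d: "d \<in> carrier F0"
        show "\<chi> (\<lambda>A. f * (c \<oplus>\<^bsub>F0\<^esub> d) A) / f
            = \<chi> (\<lambda>A. f * c A) / f \<oplus>\<^bsub>self_module R\<^esub> \<chi> (\<lambda>A. f * d A) / f"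
          using D(2)[OF chi IK[OF f(1) c] IK[OF f(1) d]]
          by (simp add: F0_ops K_ops distrib_left add_divide_distrib)
      qed (rule F0.module_axioms)
      \<comment> \<open>On a syzygy k itself, f can be pulled out of \<open>\<chi>(fk)\<close>, so
        the quotient is the old value.\<close>
      moreover have "\<psi> k = \<chi> k" if k: "k \<in> carrier K" for k
        using D(3)[OF chi, of f k] k fS f KF[OF k] by (simp add: \<psi>_def K_ops)
      ultimately show "\<exists>\<psi> \<in> linear_maps R F0 (self_module R). \<forall>k \<in> carrier K. \<psi> k = \<chi> k" by blast
    qed
  qed
  then show ?thesis
    using Ext1_trivial_iff[OF Q.module_axioms N.module_axioms] by (simp only: R_def Q_def F0_def K_def)
qed

end

section \<open>Laurent polynomial rings are normal\<close>

text \<open>The exponent k = 1 makes z a fraction of elements of S, so z may range over the whole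
  field.\<close>

definition completely_integrally_closed :: "'a::field set \<Rightarrow> bool" where
  "completely_integrally_closed S \<longleftrightarrow>
     (\<forall>z d. d \<in> S \<longrightarrow> d \<noteq> 0 \<longrightarrow> (\<forall>k. d * z ^ k \<in> S) \<longrightarrow> z \<in> S)"

definition coeffs_in :: "'a::field set \<Rightarrow> 'a poly \<Rightarrow> bool" where
  "coeffs_in S p \<longleftrightarrow> (\<forall>i. Polynomial.coeff p i \<in> S)"

definition adjoin :: "'a::field set \<Rightarrow> 'a \<Rightarrow> 'a set" where
  "adjoin S t = {Polynomial.poly p t | p. coeffs_in S p}"

definition transcendental_over :: "'a::field set \<Rightarrow> 'a \<Rightarrow> bool" where
  "transcendental_over S t \<longleftrightarrow> (\<forall>p. coeffs_in S p \<longrightarrow> Polynomial.poly p t = 0 \<longrightarrow> p = 0)"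

text \<open>Complete integral closedness of the integers for the fraction e/d. After division by the
  gcd, all powers of the reduced denominator divide d, so it is a unit.\<close>

lemma int_dvd_of_power_dvd:
  fixes d e :: int
  assumes d: "d \<noteq> 0" and dvd: "\<And>k. d ^ k dvd d * e ^ k"
  shows "d dvd e"
proof -
  define g where "g = gcd d e"
  have "g \<noteq> 0" using d by (simp add: g_def)
  then obtain d' e' where de: "d = d' * g" "e = e' * g" "coprime d' e'"
    using gcd_coprime_exists[of d e, folded g_def] by blast
  have "d' ^ k dvd d" for k
  proof -
    have "g ^ k * d' ^ k dvd g ^ k * (d * e' ^ k)"
      using dvd[of k] by (simp add: de power_mult_distrib mult_ac)
    then have "d' ^ k dvd d * e' ^ k" using \<open>g \<noteq> 0\<close> by simp
    moreover have "coprime (d' ^ k) (e' ^ k)" using de(3) by simp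
    ultimately show ?thesis by (simp add: coprime_dvd_mult_left_iff)
  qed
  then have le: "\<bar>d'\<bar> ^ k \<le> \<bar>d\<bar>" for k
    using dvd_imp_le_int[OF d, of "d' ^ k"] by (simp add: power_abs)
  have "\<bar>d'\<bar> = 1"
  proof (rule ccontr)
    assume "\<bar>d'\<bar> \<noteq> 1"
    moreover have "d' \<noteq> 0" using d de by auto
    ultimately have "2 \<le> \<bar>d'\<bar>" by linarith
    \<comment> \<open>The exponent \<open>\<bar>d\<bar>\<close> is large enough because
      \<open>2 ^ j > j\<close>.\<close>
    then have "2 ^ nat \<bar>d\<bar> \<le> \<bar>d'\<bar> ^ nat \<bar>d\<bar>" by (intro power_mono) auto
    moreover have "int (nat \<bar>d\<bar>) < 2 ^ nat \<bar>d\<bar>"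
      using of_nat_less_two_power[where 'a = int] .
    ultimately show False using le[of "nat \<bar>d\<bar>"] by simp
  qed
  then have "d' dvd 1" by simp
  then show ?thesis unfolding de by (metis dvd_mult_unit_iff' dvd_triv_right mult.commute dvd_trans)
qed

text \<open>The hypothesis passes from C to its remainder E modulo D, by binomial expansion. A
  nonzero E has smaller degree than D, and then the degree of \<open>D * E ^ k\<close> falls behind
  that of \<open>D ^ k\<close> for large k.\<close>

lemma poly_dvd_of_power_dvd:
  fixes D C :: "'a::field poly"
  assumes D: "D \<noteq> 0" and dvd: "\<And>k. D ^ k dvd D * C ^ k"
  shows "D dvd C"
proof -
  define E where "E = C mod D"
  define q where "q = C div D"
  have E: "E = C + - (D * q)" by (simp add: E_def q_def minus_div_mult_eq_mod[symmetric] mult.commute)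
  have "D ^ k dvd D * E ^ k" for k
  proof -
    have "D * E ^ k = (\<Sum>j\<le>k. of_nat (k choose j) * ((- q) ^ (k - j) * (D * C ^ j * D ^ (k - j))))"
      unfolding E binomial_ring sum_distrib_left
      by (intro sum.cong) (auto simp: power_mult_distrib[symmetric] mult_ac)
    moreover have "D ^ k dvd D * C ^ j * D ^ (k - j)" if "j \<le> k" for j
    proof -
      have "D ^ j * D ^ (k - j) dvd D * C ^ j * D ^ (k - j)" using dvd[of j] by (intro mult_dvd_mono) auto
      then show ?thesis using that by (simp flip: power_add)
    qed
    ultimately show ?thesis by (auto intro!: dvd_sum)
  qed
  note dvdE = this
  have "E = 0"
  proof (rule ccontr)
    assume "E \<noteq> 0"
    then have lt: "Polynomial.degree E < Polynomial.degree D"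
      using Polynomial.degree_mod_less[OF D, of C] by (simp add: E_def)
    \<comment> \<open>The degree bound \<open>k deg D \<le> deg D + k (deg D - 1)\<close> forces
      \<open>k \<le> deg D\<close>, so the next value of k contradicts it.\<close>
    define k where "k = Suc (Polynomial.degree D)"
    have "Polynomial.degree (D ^ k) \<le> Polynomial.degree (D * E ^ k)"
      using dvdE[of k] \<open>E \<noteq> 0\<close> D by (intro dvd_imp_degree_le) auto
    also have "\<dots> = Polynomial.degree D + k * Polynomial.degree E"
      using \<open>E \<noteq> 0\<close> D by (simp add: Polynomial.degree_mult_eq Polynomial.degree_power_eq)
    also have "\<dots> \<le> Polynomial.degree D + k * (Polynomial.degree D - 1)"
      using lt by auto
    also have "\<dots> < Polynomial.degree D + k * (Polynomial.degree D - 1) + 1" by simp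
    also have "\<dots> = k * Polynomial.degree D"
      using lt by (cases "Polynomial.degree D") (auto simp: k_def algebra_simps)
    finally show False using D by (simp add: Polynomial.degree_power_eq)
  qed
  then show ?thesis by (simp add: E_def dvd_eq_mod_eq_0)
qed

lemma range_of_int_subring: "field_subring (range of_int :: 'a::field set)"
proof
  show "(1 :: 'a) \<in> range of_int" by (metis of_int_1 rangeI)
  show "a - b \<in> range of_int" "a * b \<in> range of_int" if "a \<in> range of_int" "b \<in> range of_int" for a b :: 'a
    using that by (auto simp flip: of_int_diff of_int_mult)
qed

lemma completely_integrally_closed_range_of_int:
  "completely_integrally_closed (range of_int :: 'a::field_char_0 set)"
  unfolding completely_integrally_closed_def
proof (intro allI impI)
  fix z d :: 'a assume d: "d \<in> range of_int" "d \<noteq> 0" and dz: "\<forall>k. d * z ^ k \<in> range of_int"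
  obtain d' where d': "d = of_int d'" using d by auto
  have "\<forall>k. \<exists>e. d * z ^ k = of_int e" using dz by auto
  then obtain e where e: "\<And>k. d * z ^ k = of_int (e k)" by metis
  have "d' dvd e 1"
  proof (rule int_dvd_of_power_dvd)
    show "d' \<noteq> 0" using d d' by auto
    fix k
    have "(of_int (d' * e 1 ^ k) :: 'a) = d * (d * z) ^ k" using e[of 1] by (simp add: d')
    also have "\<dots> = d ^ k * (d * z ^ k)" by (simp add: power_mult_distrib mult_ac)
    also have "\<dots> = of_int (d' ^ k * e k)" by (simp only: e) (simp add: d')
    finally have "d' * e 1 ^ k = d' ^ k * e k" by (simp only: of_int_eq_iff)
    then show "d' ^ k dvd d' * e 1 ^ k" by simp
  qed
  then obtain c where "e 1 = d' * c" by auto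
  then have "d * z = d * of_int c" using e[of 1] by (simp add: d')
  then show "z \<in> range of_int" using d by simp
qed

context field_subring
begin

lemma coeffs_in_simps [simp]:
  "coeffs_in S 0" "coeffs_in S 1" "c \<in> S \<Longrightarrow> coeffs_in S (Polynomial.monom c i)" "c \<in> S \<Longrightarrow> coeffs_in S [:c:]"
  "coeffs_in S p \<Longrightarrow> coeffs_in S q \<Longrightarrow> coeffs_in S (p + q)"
  "coeffs_in S p \<Longrightarrow> coeffs_in S q \<Longrightarrow> coeffs_in S (p - q)"
  "coeffs_in S p \<Longrightarrow> coeffs_in S (- p)"
  "coeffs_in S p \<Longrightarrow> coeffs_in S q \<Longrightarrow> coeffs_in S (p * q)"
  by (auto simp: coeffs_in_def Polynomial.coeff_mult diff_mem coeff_pCons split: nat.split intro!: sum_mem)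

lemma coeffs_in_power [simp]: "coeffs_in S p \<Longrightarrow> coeffs_in S (p ^ k)"
  by (induction k) auto

lemma coeffs_in_sum: "(\<And>i. i \<in> A \<Longrightarrow> coeffs_in S (f i)) \<Longrightarrow> coeffs_in S (sum f A)"
  by (induction A rule: infinite_finite_induct) auto

lemma coeffs_in_of_nat [simp]: "coeffs_in S (of_nat k)"
  by (induction k) auto

lemma adjoin_subring: "field_subring (adjoin S t)"
proof
  show "1 \<in> adjoin S t" by (auto simp: adjoin_def intro!: exI[of _ 1])
  fix a b assume "a \<in> adjoin S t" "b \<in> adjoin S t"
  then obtain p q where pq: "a = Polynomial.poly p t" "b = Polynomial.poly q t" "coeffs_in S p" "coeffs_in S q"
    by (auto simp: adjoin_def)
  show "a - b \<in> adjoin S t" unfolding adjoin_def using pq by (auto intro!: exI[of _ "p - q"])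
  show "a * b \<in> adjoin S t" unfolding adjoin_def using pq by (auto intro!: exI[of _ "p * q"])
qed

lemma subset_adjoin: "S \<subseteq> adjoin S t"
  by (auto simp: adjoin_def intro!: exI[of _ "[:_:]"])

lemma mem_adjoin: "t \<in> adjoin S t"
  unfolding adjoin_def by (rule CollectI, rule exI[of _ "Polynomial.monom 1 1"]) (simp add: poly_monom)

text \<open>The leading coefficient of \<open>D * Q ^ k\<close> is that of D times the k-th power of
  that of Q, so the hypothesis on S applies to the leading coefficient of Q. Removing the leading
  term preserves the hypothesis on Q, by binomial expansion, and lowers the degree.\<close>

lemma coeffs_in_of_leading_coeffs:
  assumes cic: "completely_integrally_closed S"
    and D: "coeffs_in S D" "D \<noteq> 0" and Q: "\<And>k. coeffs_in S (D * Q ^ k)"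
  shows "coeffs_in S Q"
  using Q
proof (induction "Polynomial.degree Q" arbitrary: Q rule: less_induct)
  case less
  define c where "c = Polynomial.lead_coeff Q"
  have "Polynomial.lead_coeff D * c ^ k \<in> S" for k
  proof -
    have "Polynomial.lead_coeff (D * Q ^ k) \<in> S" using less.prems[of k] by (auto simp: coeffs_in_def)
    then show ?thesis by (simp add: Polynomial.lead_coeff_mult Polynomial.lead_coeff_power c_def)
  qed
  then have c: "c \<in> S"
    using cic[unfolded completely_integrally_closed_def, rule_format, of "Polynomial.lead_coeff D" c] D
    by (simp add: coeffs_in_def)
  define m where "m = Polynomial.monom c (Polynomial.degree Q)"
  have m: "coeffs_in S m" using c by (simp add: m_def)
  have "coeffs_in S (Q - m)"
  proof (cases "Polynomial.degree (Q - m) < Polynomial.degree Q")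
    case True
    show ?thesis
    proof (rule less.hyps[OF True])
      fix k
      have "D * (Q - m) ^ k = D * (Q + - m) ^ k" by simp
      also have "\<dots> = (\<Sum>j\<le>k. of_nat (k choose j) * (D * Q ^ j * (- m) ^ (k - j)))"
        unfolding binomial_ring sum_distrib_left by (intro sum.cong) (auto simp: mult_ac)
      also have "coeffs_in S \<dots>" using less.prems m by (intro coeffs_in_sum) auto
      finally show "coeffs_in S (D * (Q - m) ^ k)" .
    qed
  next
    case False
    \<comment> \<open>The degree fails to drop only if nothing is left after removing the leading
      term.\<close>
    have "Polynomial.coeff (Q - m) i = 0" if "i \<ge> Polynomial.degree Q" for i
      using that Polynomial.coeff_eq_0[of Q i] by (cases "i = Polynomial.degree Q") (auto simp: m_def c_def)
    then have "Q - m = 0"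
      using False by (metis leading_coeff_0_iff not_less)
    then show ?thesis by simp
  qed
  then show ?case using coeffs_in_simps(5)[of "Q - m" m] m by (simp only: diff_add_cancel)
qed

text \<open>Transcendence lifts \<open>d (dz)^k = d^k (d z^k)\<close> to an identity of polynomials.
  Divisibility over the whole field then makes z the value of a quotient polynomial Q, and the
  leading coefficient argument brings the coefficients of Q back into S.\<close>

lemma completely_integrally_closed_adjoin:
  assumes cic: "completely_integrally_closed S" and t: "transcendental_over S t"
  shows "completely_integrally_closed (adjoin S t)"
  unfolding completely_integrally_closed_def
proof (intro allI impI)
  fix z d assume d: "d \<in> adjoin S t" "d \<noteq> 0" and dz: "\<forall>k. d * z ^ k \<in> adjoin S t"
  obtain D where D: "d = Polynomial.poly D t" "coeffs_in S D" using d by (auto simp: adjoin_def)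
  have "D \<noteq> 0" using d D by auto
  have "\<forall>k. \<exists>C. d * z ^ k = Polynomial.poly C t \<and> coeffs_in S C" using dz by (auto simp: adjoin_def)
  then obtain C where C: "\<And>k. d * z ^ k = Polynomial.poly (C k) t" "\<And>k. coeffs_in S (C k)" by metis
  have eq: "D * C 1 ^ k = D ^ k * C k" for k
  proof -
    have "Polynomial.poly (D * C 1 ^ k - D ^ k * C k) t = d * (d * z ^ 1) ^ k - d ^ k * (d * z ^ k)"
      unfolding C(1) by (simp add: D(1))
    also have "\<dots> = 0" by (simp add: power_mult_distrib mult_ac)
    finally have "Polynomial.poly (D * C 1 ^ k - D ^ k * C k) t = 0" .
    moreover have "coeffs_in S (D * C 1 ^ k - D ^ k * C k)" using D C by simp
    ultimately show ?thesis using t by (auto simp: transcendental_over_def)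
  qed
  have "D dvd C 1"
    by (rule poly_dvd_of_power_dvd[OF \<open>D \<noteq> 0\<close>]) (simp only: eq dvd_triv_left)
  then obtain Q where Q: "C 1 = D * Q" by auto
  have "D * Q ^ k = C k" for k
  proof -
    have "D ^ k * (D * Q ^ k) = D ^ k * C k"
      using eq[of k] unfolding Q by (simp add: power_mult_distrib mult_ac)
    then show ?thesis using \<open>D \<noteq> 0\<close> by simp
  qed
  then have "coeffs_in S Q" using C(2)
    by (rule_tac coeffs_in_of_leading_coeffs[OF cic D(2) \<open>D \<noteq> 0\<close>]) (simp only:)
  moreover have "d * z ^ 1 = d * Polynomial.poly Q t"
    unfolding C(1) Q by (simp add: D(1))
  then have "z = Polynomial.poly Q t" using d by simp
  ultimately show "z \<in> adjoin S t" by (auto simp: adjoin_def)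
qed

text \<open>If z = a/b satisfies a monic equation of degree n, then \<open>b^n\<close> is a common
  denominator of all powers of z: directly below n, and by reducing with the equation from n
  on.\<close>

lemma completely_integrally_closed_imp_normal:
  assumes cic: "completely_integrally_closed S"
  shows "normal_subring S"
  unfolding normal_subring_def
proof (intro ballI impI)
  fix z assume z: "z \<in> fractions S" "integral_over S z"
  obtain a b where ab: "z = a / b" "a \<in> S" "b \<in> S" "b \<noteq> 0" using z by (auto simp: fractions_def)
  obtain n c where c: "\<And>i. i < n \<Longrightarrow> c i \<in> S" "z ^ n = (\<Sum>i<n. c i * z ^ i)"
    using z(2) by (auto simp: integral_over_iff)
  have "b ^ n * z ^ k \<in> S" for k
  proof (induction k rule: less_induct)
    case (less k)
    show ?case
    proof (cases "k < n")
      case True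
      have "b ^ n * z ^ k = b ^ (n - k) * a ^ k"
        using True ab by (simp add: power_divide power_diff)
      then show ?thesis using ab by simp
    next
      case False
      have "z ^ k = z ^ n * z ^ (k - n)" using False by (simp flip: power_add)
      then have "b ^ n * z ^ k = (\<Sum>i<n. c i * (b ^ n * z ^ (i + (k - n))))"
        unfolding c(2) by (simp add: sum_distrib_left sum_distrib_right power_add mult_ac)
      also have "\<dots> \<in> S"
      proof (rule sum_mem)
        fix i assume "i \<in> {..<n}"
        then have "c i \<in> S" "b ^ n * z ^ (i + (k - n)) \<in> S"
          using c(1) less.IH[of "i + (k - n)"] False by auto
        then show "c i * (b ^ n * z ^ (i + (k - n))) \<in> S" by (rule mult_mem)
      qed
      finally show ?thesis .
    qed
  qed
  moreover have "b ^ n \<in> S" "b ^ n \<noteq> 0" using ab by auto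
  ultimately show "z \<in> S" using cic unfolding completely_integrally_closed_def by blast
qed

text \<open>The hypotheses on L say that it is \<open>S[1/M]\<close>. Scaling z by a high power of M
  clears the denominators in its monic equation, and M can be inverted again in L.\<close>

lemma normal_localization:
  assumes normal: "normal_subring S" and M: "M \<in> S" "M \<noteq> 0"
    and SL: "S \<subseteq> L" "inverse M \<in> L" and L: "field_subring L"
    and clear: "\<And>u. u \<in> L \<Longrightarrow> \<exists>k. u * M ^ k \<in> S"
  shows "normal_subring L"
  unfolding normal_subring_def
proof (intro ballI impI)
  interpret L: field_subring L by (rule L)
  fix z assume z: "z \<in> fractions L" "integral_over L z"
  have clear': "\<exists>k. \<forall>j\<ge>k. u * M ^ j \<in> S" if u: "u \<in> L" for u
  proof -
    obtain k where k: "u * M ^ k \<in> S" using clear[OF u] by blast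
    have "u * M ^ j \<in> S" if "j \<ge> k" for j
    proof -
      have "u * M ^ k * M ^ (j - k) \<in> S" using k M by simp
      then show ?thesis using that by (simp add: mult.assoc flip: power_add)
    qed
    then show ?thesis by blast
  qed
  obtain a b where ab: "z = a / b" "a \<in> L" "b \<in> L" "b \<noteq> 0" using z by (auto simp: fractions_def)
  obtain n c where c: "\<And>i. i < n \<Longrightarrow> c i \<in> L" "z ^ n = (\<Sum>i<n. c i * z ^ i)"
    using z(2) by (auto simp: L.integral_over_iff)
  have "\<forall>i. \<exists>k. i < n \<longrightarrow> (\<forall>j\<ge>k. c i * M ^ j \<in> S)" using clear' c(1) by blast
  then obtain k where k: "\<And>i j. i < n \<Longrightarrow> j \<ge> k i \<Longrightarrow> c i * M ^ j \<in> S" by metis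
  \<comment> \<open>The sum serves as a common upper bound of the exponents.\<close>
  define N where "N = (\<Sum>i<n. k i)"
  have N: "k i \<le> N" if "i < n" for i
    unfolding N_def using that by (intro member_le_sum) auto
  define w where "w = z * M ^ N"
  have eqw: "w ^ n = (\<Sum>i<n. (c i * M ^ (N * (n - i))) * w ^ i)"
  proof -
    have "w ^ n = (\<Sum>i<n. c i * z ^ i * M ^ (N * n))"
      by (simp add: w_def power_mult_distrib c(2) sum_distrib_right power_mult)
    also have "\<dots> = (\<Sum>i<n. (c i * M ^ (N * (n - i))) * w ^ i)"
    proof (rule sum.cong[OF HOL.refl])
      fix i assume "i \<in> {..<n}"
      then have "M ^ (N * n) = M ^ (N * (n - i)) * M ^ (N * i)"
        by (simp flip: power_add distrib_left)
      then show "c i * z ^ i * M ^ (N * n) = c i * M ^ (N * (n - i)) * w ^ i"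
        by (simp add: w_def power_mult_distrib power_mult mult_ac)
    qed
    finally show ?thesis .
  qed
  \<comment> \<open>Here i < n matters: the factor n - i is at least 1, so the exponent is at least
    N.\<close>
  have cw: "c i * M ^ (N * (n - i)) \<in> S" if "i < n" for i
    using k[OF that, of "N * (n - i)"] N[OF that] that
    by (metis One_nat_def Suc_leI le_trans mult.right_neutral mult_le_mono2 zero_less_diff)
  have "integral_over S w"
    unfolding integral_over_iff using cw eqw
    by (intro exI[of _ n] exI[of _ "\<lambda>i. c i * M ^ (N * (n - i))"] conjI allI impI)
  moreover have "w \<in> fractions S"
  proof -
    obtain p q where pq: "a * M ^ p \<in> S" "b * M ^ q \<in> S" using clear ab by blast
    have "w = (a * M ^ p * M ^ (q + N)) / (b * M ^ q * M ^ p)"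
      using M ab by (simp add: w_def power_add field_simps)
    moreover have "a * M ^ p * M ^ (q + N) \<in> S" "b * M ^ q * M ^ p \<in> S"
      using pq M by simp_all
    moreover have "b * M ^ q * M ^ p \<noteq> 0" using ab M by simp
    ultimately show ?thesis unfolding fractions_def by blast
  qed
  ultimately have "w \<in> L" using normal SL by (auto simp: normal_subring_def)
  then have "w * inverse M ^ N \<in> L" using SL by simp
  then show "z \<in> L" using M by (simp add: w_def field_simps)
qed

end

section \<open>Independence of cluster variables\<close>

abbreviation generated_subring :: "'a::field set \<Rightarrow> 'a set" where
  "generated_subring A \<equiv> generate_ring ring_of_type_algebra A"

lemma a_inv_ring_of_type_algebra [simp]: "\<ominus>\<^bsub>ring_of_type_algebra\<^esub> (a :: 'a::field) = - a"
proof -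
  interpret cring "ring_of_type_algebra :: 'a ring" by (rule cring_from_type_algebra)
  show ?thesis using minus_equality[of "- a" a] by simp
qed

lemma generated_subring: "field_subring (generated_subring A)"
proof
  show "1 \<in> generated_subring A" using generate_ring.one[of "ring_of_type_algebra :: 'a ring" A] by simp
  fix a b :: 'a assume ab: "a \<in> generated_subring A" "b \<in> generated_subring A"
  show "a * b \<in> generated_subring A" using generate_ring.eng_mult[OF ab] by simp
  show "a - b \<in> generated_subring A"
    using generate_ring.eng_add[OF ab(1) generate_ring.a_inv[OF ab(2)]] by simp
qed

lemma generated_subring_incl: "A \<subseteq> generated_subring A"
  by (auto intro: generate_ring.incl)

lemma generated_subring_minimal:
  assumes "field_subring L" "A \<subseteq> L"
  shows "generated_subring A \<subseteq> (L :: 'a::field set)"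
proof -
  interpret ring "ring_of_type_algebra :: 'a ring" by (rule ring_from_type_algebra)
  show ?thesis using assms by (intro generate_ring_min_subring1) (auto simp: field_subring_iff)
qed

lemma generated_subring_mono: "A \<subseteq> B \<Longrightarrow> generated_subring A \<subseteq> generated_subring (B :: 'a::field set)"
  using generated_subring_incl by (intro generated_subring_minimal generated_subring) blast

lemma adjoin_minimal:
  assumes "field_subring L" "R \<subseteq> L" "t \<in> L"
  shows "adjoin R t \<subseteq> L"
proof -
  interpret L: field_subring L by fact
  have "Polynomial.poly p t \<in> L" if "coeffs_in R p" for p
    unfolding poly_altdef using that assms(2,3)
    by (intro L.sum_mem L.mult_mem L.power_mem) (auto simp: coeffs_in_def)
  then show ?thesis by (auto simp: adjoin_def)
qed

lemma generated_subring_insert: "generated_subring (insert t A) \<subseteq> adjoin (generated_subring A) t"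
proof -
  interpret field_subring "generated_subring A" by (rule generated_subring)
  show ?thesis
    using mem_adjoin subset_adjoin generated_subring_incl[of A]
    by (intro generated_subring_minimal adjoin_subring) blast
qed

lemma transcendental_over_mono: "transcendental_over L t \<Longrightarrow> R \<subseteq> L \<Longrightarrow> transcendental_over R t"
  by (auto simp: transcendental_over_def coeffs_in_def)

text \<open>Multiplying a relation for P/t by \<open>t^n\<close> gives a relation for t with the
  coefficients reversed. This is the effect of a mutation on the exchanged variable.\<close>

lemma (in field_subring) transcendental_over_divide:
  assumes t: "transcendental_over S t" and P: "P \<in> S" "P \<noteq> 0"
  shows "transcendental_over S (P * inverse t)"
  unfolding transcendental_over_def
proof (intro allI impI)
  have t0: "t \<noteq> 0"
  proof
    assume "t = 0"
    then have "Polynomial.poly (Polynomial.monom 1 1) t = 0" by (simp add: poly_monom)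
    then have "(Polynomial.monom 1 1 :: 'a poly) = 0"
      using t coeffs_in_simps(3)[OF one_mem] unfolding transcendental_over_def by blast
    then show False by simp
  qed
  fix p assume p: "coeffs_in S p" "Polynomial.poly p (P * inverse t) = 0"
  define n where "n = Polynomial.degree p"
  define q where "q = (\<Sum>j\<le>n. Polynomial.monom (Polynomial.coeff p j * P ^ j) (n - j))"
  have "Polynomial.poly q t = (\<Sum>j\<le>n. Polynomial.coeff p j * P ^ j * t ^ (n - j))"
    by (simp add: q_def poly_sum poly_monom)
  also have "\<dots> = (\<Sum>j\<le>n. t ^ n * (Polynomial.coeff p j * (P * inverse t) ^ j))"
    using t0 by (intro sum.cong) (auto simp: power_diff power_mult_distrib field_simps)
  also have "\<dots> = t ^ n * Polynomial.poly p (P * inverse t)"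
    by (simp add: poly_altdef n_def sum_distrib_left)
  finally have "Polynomial.poly q t = 0" using p by simp
  moreover have "coeffs_in S q"
    unfolding q_def using p P by (intro coeffs_in_sum coeffs_in_simps) (auto simp: coeffs_in_def)
  ultimately have q: "q = 0" using t by (auto simp: transcendental_over_def)
  have "Polynomial.coeff p n = 0"
  proof -
    \<comment> \<open>After the reversal the constant term is the leading coefficient of p times
      \<open>P^n\<close>, so its vanishing kills p.\<close>
    have "Polynomial.coeff q 0 = (\<Sum>j\<le>n. if j = n then Polynomial.coeff p j * P ^ j else 0)"
      unfolding q_def by (auto simp: coeff_sum intro!: sum.cong)
    then show ?thesis using q P by simp
  qed
  then show "p = 0" by (simp add: n_def)
qed

lemma (in field_subring) transcendental_over_binomial_nonzero:
  assumes t: "transcendental_over S t" and "a \<in> S" "a \<noteq> 0" "c \<in> S" "0 < b"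
  shows "t ^ b * a + c \<noteq> 0"
proof
  assume "t ^ b * a + c = 0"
  define p where "p = Polynomial.monom a b + Polynomial.monom c 0"
  have "Polynomial.poly p t = 0" "coeffs_in S p"
    using \<open>t ^ b * a + c = 0\<close> assms by (auto simp: p_def poly_monom mult.commute)
  then have "p = 0" using t by (auto simp: transcendental_over_def)
  then have "Polynomial.coeff p b = 0" by simp
  then show False using assms by (simp add: p_def)
qed

text \<open>Rearranging a polynomial relation in \<open>a\<close> over \<open>S[b]\<close> into one in \<open>b\<close> over \<open>S[a]\<close>.\<close>

lemma (in field_subring) transcendental_over_swap:
  assumes a: "transcendental_over S a" and b: "transcendental_over (adjoin S a) b"
  shows "transcendental_over (adjoin S b) a"
  unfolding transcendental_over_def
proof (intro allI impI)
  fix p assume p: "coeffs_in (adjoin S b) p" "Polynomial.poly p a = 0"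
  have "Polynomial.coeff p j \<in> adjoin S b" for j using p(1) by (simp add: coeffs_in_def)
  then have "\<forall>j. \<exists>q. Polynomial.coeff p j = Polynomial.poly q b \<and> coeffs_in S q"
    unfolding adjoin_def by blast
  then obtain q where q: "\<And>j. Polynomial.coeff p j = Polynomial.poly (q j) b" "\<And>j. coeffs_in S (q j)"
    by metis
  define n where "n = Polynomial.degree p"
  define l where "l = (\<Sum>j\<le>n. Polynomial.degree (q j))"
  have deg: "Polynomial.degree (q j) \<le> l" if "j \<le> n" for j
    unfolding l_def using that by (intro member_le_sum) auto
  define s where "s i = (\<Sum>j\<le>n. Polynomial.monom (Polynomial.coeff (q j) i) j)" for i
  define r where "r = (\<Sum>i\<le>l. Polynomial.monom (Polynomial.poly (s i) a) i)"
  have s: "coeffs_in S (s i)" for i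
    unfolding s_def using q(2) by (intro coeffs_in_sum coeffs_in_simps) (auto simp: coeffs_in_def)
  interpret A: field_subring "adjoin S a" by (rule adjoin_subring)
  have "coeffs_in (adjoin S a) r"
    unfolding r_def using s by (intro A.coeffs_in_sum A.coeffs_in_simps) (auto simp: adjoin_def)
  moreover have "Polynomial.poly r b = 0"
  proof -
    have "Polynomial.poly r b = (\<Sum>i\<le>l. \<Sum>j\<le>n. Polynomial.coeff (q j) i * a ^ j * b ^ i)"
      by (simp add: r_def s_def poly_sum poly_monom sum_distrib_right)
    also have "\<dots> = (\<Sum>j\<le>n. \<Sum>i\<le>l. Polynomial.coeff (q j) i * a ^ j * b ^ i)"
      by (rule sum.swap)
    also have "\<dots> = (\<Sum>j\<le>n. Polynomial.coeff p j * a ^ j)"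
    proof (rule sum.cong[OF HOL.refl])
      fix j assume "j \<in> {..n}"
      then have "Polynomial.poly (q j) b = (\<Sum>i\<le>l. Polynomial.coeff (q j) i * b ^ i)"
        unfolding poly_altdef using deg[of j]
        by (intro sum.mono_neutral_left) (auto simp: Polynomial.coeff_eq_0)
      then show "(\<Sum>i\<le>l. Polynomial.coeff (q j) i * a ^ j * b ^ i) = Polynomial.coeff p j * a ^ j"
        by (simp add: q(1) sum_distrib_left mult_ac)
    qed
    also have "\<dots> = 0" using p(2) by (simp add: poly_altdef n_def)
    finally show ?thesis .
  qed
  ultimately have "r = 0" using b by (auto simp: transcendental_over_def)
  have s0: "s i = 0" for i
  proof (cases "i \<le> l")
    case True
    then have "Polynomial.coeff r i = Polynomial.poly (s i) a" by (simp add: r_def coeff_sum)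
    then have "Polynomial.poly (s i) a = 0" using \<open>r = 0\<close> by simp
    then show ?thesis using a s by (auto simp: transcendental_over_def)
  next
    case False
    then have "Polynomial.coeff (q j) i = 0" if "j \<le> n" for j
      using deg[OF that] by (intro Polynomial.coeff_eq_0) simp
    then show ?thesis by (simp add: s_def)
  qed
  have "Polynomial.coeff p n = 0"
  proof -
    have "Polynomial.coeff (q n) i = 0" for i
    proof -
      have "Polynomial.coeff (s i) n = Polynomial.coeff (q n) i" by (simp add: s_def coeff_sum)
      then show ?thesis using s0 by simp
    qed
    then have "q n = 0" by (simp add: poly_eq_iff)
    then show ?thesis using q(1)[of n] by simp
  qed
  then show "p = 0" by (simp add: n_def)
qed

text \<open>Unlike the definition by polynomials in \<open>n\<close> variables, this form of algebraic
  independence is easily traced through a mutation.\<close>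

definition indep_variables :: "nat \<Rightarrow> (nat \<Rightarrow> 'a::field) \<Rightarrow> bool" where
  "indep_variables n y \<longleftrightarrow>
     (\<forall>i<n. transcendental_over (generated_subring (y ` ({..<n} - {i}))) (y i))"

lemma indep_variables_nonzero:
  assumes "indep_variables n y" "i < n"
  shows "y i \<noteq> 0"
proof -
  interpret field_subring "generated_subring (y ` ({..<n} - {i}))" by (rule generated_subring)
  have "y i ^ 1 * 1 + 0 \<noteq> 0"
    using assms by (intro transcendental_over_binomial_nonzero) (auto simp: indep_variables_def)
  then show ?thesis by simp
qed

lemma indep_variables_permute:
  assumes "indep_variables n y" "\<sigma> permutes {..<n}"
  shows "indep_variables n (\<lambda>i. y (\<sigma> i))"
  unfolding indep_variables_def
proof (intro allI impI)
  fix i assume i: "i < n"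
  have "(\<lambda>i. y (\<sigma> i)) ` ({..<n} - {i}) = y ` (\<sigma> ` ({..<n} - {i}))" by auto
  also have "\<sigma> ` ({..<n} - {i}) = {..<n} - {\<sigma> i}"
    using assms(2) i by (simp add: image_set_diff permutes_inj permutes_image)
  finally have "(\<lambda>i. y (\<sigma> i)) ` ({..<n} - {i}) = y ` ({..<n} - {\<sigma> i})" .
  moreover have "\<sigma> i < n" using permutes_in_image[OF assms(2), of i] i by simp
  ultimately show "transcendental_over (generated_subring ((\<lambda>i. y (\<sigma> i)) ` ({..<n} - {i}))) (y (\<sigma> i))"
    using assms(1) by (simp add: indep_variables_def)
qed

text \<open>For the exchanged variable this is the substitution t -> P/t. For another index i, P
  lies in \<open>R0[y i]\<close>, where R0 is generated by the variables other than i and k; so P /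
  y k is transcendental over \<open>R0[y i]\<close>, and a swap makes y i transcendental over R0
  with P / y k adjoined.\<close>

lemma indep_variables_exchange:
  assumes ind: "indep_variables n y" and k: "k < n"
    and P: "P \<in> generated_subring (y ` ({..<n} - {k}))" "P \<noteq> 0"
  shows "indep_variables n (y(k := P * inverse (y k)))"
  unfolding indep_variables_def
proof (intro allI impI)
  fix i assume i: "i < n"
  let ?y = "y(k := P * inverse (y k))"
  show "transcendental_over (generated_subring (?y ` ({..<n} - {i}))) (?y i)"
  proof (cases "i = k")
    case True
    interpret field_subring "generated_subring (y ` ({..<n} - {k}))" by (rule generated_subring)
    have "?y ` ({..<n} - {k}) = y ` ({..<n} - {k})" by auto
    then show ?thesis
      using True transcendental_over_divide[OF _ P] ind k by (simp add: indep_variables_def)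
  next
    case False
    define R0 where "R0 = generated_subring (y ` ({..<n} - {i, k}))"
    interpret R0: field_subring R0 unfolding R0_def by (rule generated_subring)
    have "insert (y i) (y ` ({..<n} - {i, k})) = y ` ({..<n} - {k})" using i False by auto
    then have sub: "generated_subring (y ` ({..<n} - {k})) \<subseteq> adjoin R0 (y i)"
      using generated_subring_insert[of "y i" "y ` ({..<n} - {i, k})"] by (simp add: R0_def)
    have R0i: "R0 \<subseteq> generated_subring (y ` ({..<n} - {i}))"
      unfolding R0_def by (intro generated_subring_mono) auto
    have "R0 \<subseteq> generated_subring (y ` ({..<n} - {k}))"
      unfolding R0_def by (intro generated_subring_mono) auto
    then have "adjoin R0 (y i) \<subseteq> generated_subring (y ` ({..<n} - {k}))"
      using i False by (intro adjoin_minimal generated_subring) (auto intro!: generate_ring.incl)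
    then have yk: "transcendental_over (adjoin R0 (y i)) (y k)"
      using ind k by (auto simp: indep_variables_def intro: transcendental_over_mono)
    interpret A: field_subring "adjoin R0 (y i)" by (rule R0.adjoin_subring)
    have "transcendental_over (adjoin R0 (y i)) (?y k)"
      using A.transcendental_over_divide[OF yk] P sub by auto
    moreover have "transcendental_over R0 (y i)"
      using ind i R0i by (auto simp: indep_variables_def intro: transcendental_over_mono)
    ultimately have "transcendental_over (adjoin R0 (?y k)) (y i)"
      by (rule R0.transcendental_over_swap[rotated])
    moreover have "?y ` ({..<n} - {i}) = insert (?y k) (y ` ({..<n} - {i, k}))"
      using k False by auto
    then have "generated_subring (?y ` ({..<n} - {i})) \<subseteq> adjoin R0 (?y k)"
      using generated_subring_insert[of "?y k" "y ` ({..<n} - {i, k})"] by (simp add: R0_def)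
    ultimately show ?thesis using False by (auto intro: transcendental_over_mono)
  qed
qed

text \<open>Only one of the two monomials contains y i, so the sum is a binomial in y i over the
  ring of the other variables.\<close>

lemma indep_variables_binomial_nonzero:
  fixes y :: "nat \<Rightarrow> 'a::field" and e e' :: "nat \<Rightarrow> nat"
  assumes ind: "indep_variables n y" and A: "A \<subseteq> {..<n}" "A' \<subseteq> {..<n}" "i \<in> A - A'" "0 < e i"
  shows "(\<Prod>j\<in>A. y j ^ e j) + (\<Prod>j\<in>A'. y j ^ e' j) \<noteq> 0"
proof -
  interpret field_subring "generated_subring (y ` ({..<n} - {i}))" by (rule generated_subring)
  have fin: "finite A" using A finite_subset by blast
  have mem: "y j \<in> generated_subring (y ` ({..<n} - {i}))" if "j < n" "j \<noteq> i" for j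
    using that by (auto intro!: generate_ring.incl)
  have "y i ^ e i * (\<Prod>j\<in>A - {i}. y j ^ e j) + (\<Prod>j\<in>A'. y j ^ e' j) \<noteq> 0"
  proof (rule transcendental_over_binomial_nonzero)
    show "transcendental_over (generated_subring (y ` ({..<n} - {i}))) (y i)"
      using ind A by (auto simp: indep_variables_def)
    show "(\<Prod>j\<in>A - {i}. y j ^ e j) \<noteq> 0"
      using indep_variables_nonzero[OF ind] A fin by auto
    show "(\<Prod>j\<in>A - {i}. y j ^ e j) \<in> generated_subring (y ` ({..<n} - {i}))"
      using A(1) by (intro prod_mem power_mem mem) auto
    show "(\<Prod>j\<in>A'. y j ^ e' j) \<in> generated_subring (y ` ({..<n} - {i}))"
      using A(2,3) by (intro prod_mem power_mem mem) auto
  qed (rule A(4))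
  then show ?thesis using A fin by (simp add: prod.remove[of A i])
qed

section \<open>From relations in n variables to relations in one variable\<close>

definition eval_monomial :: "(nat \<Rightarrow> 'a::field_char_0) \<Rightarrow> (nat \<Rightarrow>\<^sub>0 nat) \<Rightarrow> 'a" where
  "eval_monomial x \<alpha> = (\<Prod>i\<in>Poly_Mapping.keys \<alpha>. x i ^ Poly_Mapping.lookup \<alpha> i)"

lemma eval_monomial_superset:
  assumes "finite K" "Poly_Mapping.keys \<alpha> \<subseteq> K"
  shows "eval_monomial x \<alpha> = (\<Prod>i\<in>K. x i ^ Poly_Mapping.lookup \<alpha> i)"
  unfolding eval_monomial_def using assms
  by (intro prod.mono_neutral_left) (auto simp: not_in_keys_iff_lookup_eq_zero)

lemma eval_monomial_add: "eval_monomial x (\<alpha> + \<beta>) = eval_monomial x \<alpha> * eval_monomial x \<beta>"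
proof -
  let ?K = "Poly_Mapping.keys \<alpha> \<union> Poly_Mapping.keys \<beta>"
  have "eval_monomial x (\<alpha> + \<beta>) = (\<Prod>i\<in>?K. x i ^ Poly_Mapping.lookup (\<alpha> + \<beta>) i)"
    using Poly_Mapping.keys_add[of \<alpha> \<beta>] by (intro eval_monomial_superset) auto
  also have "\<dots> = (\<Prod>i\<in>?K. x i ^ Poly_Mapping.lookup \<alpha> i) * (\<Prod>i\<in>?K. x i ^ Poly_Mapping.lookup \<beta> i)"
    by (simp add: lookup_add power_add prod.distrib)
  also have "\<dots> = eval_monomial x \<alpha> * eval_monomial x \<beta>"
    by (intro arg_cong2[of _ _ _ _ "(*)"] eval_monomial_superset[symmetric]) auto
  finally show ?thesis .
qed

lemma eval_monomial_single: "eval_monomial x (Poly_Mapping.single i c) = x i ^ c"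
  using eval_monomial_superset[of "{i}" "Poly_Mapping.single i c" x] by simp

lemma eval_poly_superset:
  assumes "finite K" "Poly_Mapping.keys p \<subseteq> K"
  shows "eval_poly x p = (\<Sum>\<alpha>\<in>K. of_rat (Poly_Mapping.lookup p \<alpha>) * eval_monomial x \<alpha>)"
  unfolding eval_poly_def eval_monomial_def[symmetric] using assms
  by (intro sum.mono_neutral_left) (auto simp: not_in_keys_iff_lookup_eq_zero)

lemma eval_poly_add: "eval_poly x (p + q) = eval_poly x p + eval_poly x q"
proof -
  let ?K = "Poly_Mapping.keys p \<union> Poly_Mapping.keys q"
  have "eval_poly x (p + q) = (\<Sum>\<alpha>\<in>?K. of_rat (Poly_Mapping.lookup (p + q) \<alpha>) * eval_monomial x \<alpha>)"
    using Poly_Mapping.keys_add[of p q] by (intro eval_poly_superset) auto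
  also have "\<dots> = (\<Sum>\<alpha>\<in>?K. of_rat (Poly_Mapping.lookup p \<alpha>) * eval_monomial x \<alpha>)
      + (\<Sum>\<alpha>\<in>?K. of_rat (Poly_Mapping.lookup q \<alpha>) * eval_monomial x \<alpha>)"
    by (simp add: lookup_add of_rat_add distrib_right sum.distrib)
  also have "\<dots> = eval_poly x p + eval_poly x q"
    by (intro arg_cong2[of _ _ _ _ "(+)"] eval_poly_superset[symmetric]) auto
  finally show ?thesis .
qed

lemma eval_poly_zero [simp]: "eval_poly x 0 = 0"
  by (simp add: eval_poly_def)

lemma eval_poly_sum: "eval_poly x (sum f A) = (\<Sum>i\<in>A. eval_poly x (f i))"
  by (induction A rule: infinite_finite_induct) (auto simp: eval_poly_add)

lemma eval_poly_single: "eval_poly x (Poly_Mapping.single \<alpha> c) = of_rat c * eval_monomial x \<alpha>"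
  using eval_poly_superset[of "{\<alpha>}" "Poly_Mapping.single \<alpha> c" x] by simp

lemma eval_poly_uminus: "eval_poly x (- p) = - eval_poly x p"
  using eval_poly_add[of x p "- p"] by (simp add: add_eq_0_iff)

definition poly_values :: "(nat \<Rightarrow> 'a::field_char_0) \<Rightarrow> nat set \<Rightarrow> 'a set" where
  "poly_values x J = {eval_poly x p | p. \<forall>\<alpha>\<in>Poly_Mapping.keys p. Poly_Mapping.keys \<alpha> \<subseteq> J}"

lemma poly_values_subring: "field_subring (poly_values x J)"
proof
  have single: "of_rat c * eval_monomial x \<alpha> \<in> poly_values x J" if "Poly_Mapping.keys \<alpha> \<subseteq> J" for c \<alpha>
    unfolding poly_values_def using that
    by (intro CollectI exI[of _ "Poly_Mapping.single \<alpha> c"]) (auto simp: eval_poly_single split: if_splits)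
  have add: "a + b \<in> poly_values x J" if ab: "a \<in> poly_values x J" "b \<in> poly_values x J" for a b
  proof -
    obtain p q where pq: "a = eval_poly x p" "\<forall>\<alpha>\<in>Poly_Mapping.keys p. Poly_Mapping.keys \<alpha> \<subseteq> J"
      "b = eval_poly x q" "\<forall>\<alpha>\<in>Poly_Mapping.keys q. Poly_Mapping.keys \<alpha> \<subseteq> J"
      using ab by (auto simp: poly_values_def)
    then have "\<forall>\<alpha>\<in>Poly_Mapping.keys (p + q). Poly_Mapping.keys \<alpha> \<subseteq> J"
      using Poly_Mapping.keys_add[of p q] by blast
    then show ?thesis unfolding poly_values_def using pq by (auto simp flip: eval_poly_add)
  qed
  have zero: "0 \<in> poly_values x J"
    unfolding poly_values_def by (rule CollectI, rule exI[of _ 0]) simp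
  have sum: "sum f A \<in> poly_values x J" if "\<And>i. i \<in> A \<Longrightarrow> f i \<in> poly_values x J" for A :: "'b set" and f
    using that by (induction A rule: infinite_finite_induct) (auto intro: add zero)
  show "1 \<in> poly_values x J" using single[of 0 1] by (simp add: eval_monomial_def)
  fix a b assume ab: "a \<in> poly_values x J" "b \<in> poly_values x J"
  obtain p q where p: "a = eval_poly x p" "\<forall>\<alpha>\<in>Poly_Mapping.keys p. Poly_Mapping.keys \<alpha> \<subseteq> J"
    and q: "b = eval_poly x q" "\<forall>\<alpha>\<in>Poly_Mapping.keys q. Poly_Mapping.keys \<alpha> \<subseteq> J"
    using ab by (auto simp: poly_values_def)
  have "- b \<in> poly_values x J"
    unfolding poly_values_def using q
    by (intro CollectI exI[of _ "- q"]) (auto simp: eval_poly_uminus)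
  then show "a - b \<in> poly_values x J" using add[OF ab(1)] by force
  have "a * b = (\<Sum>\<alpha>\<in>Poly_Mapping.keys p. \<Sum>\<beta>\<in>Poly_Mapping.keys q.
      of_rat (Poly_Mapping.lookup p \<alpha> * Poly_Mapping.lookup q \<beta>) * eval_monomial x (\<alpha> + \<beta>))"
    unfolding p(1) q(1) eval_poly_def eval_monomial_def[symmetric] sum_product
    by (simp add: of_rat_mult eval_monomial_add mult_ac)
  also have "\<dots> \<in> poly_values x J"
  proof (intro sum single)
    fix \<alpha> \<beta> assume "\<alpha> \<in> Poly_Mapping.keys p" "\<beta> \<in> Poly_Mapping.keys q"
    then show "Poly_Mapping.keys (\<alpha> + \<beta>) \<subseteq> J"
      using p(2) q(2) Poly_Mapping.keys_add[of \<alpha> \<beta>] by blast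
  qed
  finally show "a * b \<in> poly_values x J" .
qed

lemma generated_subring_poly_values: "generated_subring (x ` J) \<subseteq> poly_values x J"
proof (rule generated_subring_minimal[OF poly_values_subring])
  show "x ` J \<subseteq> poly_values x J"
  proof
    fix a assume "a \<in> x ` J"
    then obtain i where i: "i \<in> J" "a = x i" by auto
    show "a \<in> poly_values x J"
      unfolding poly_values_def using i
      by (intro CollectI exI[of _ "Poly_Mapping.single (Poly_Mapping.single i 1) 1"])
        (auto simp: eval_poly_single eval_monomial_single split: if_splits)
  qed
qed

text \<open>A relation for x i with coefficients in the other variables is assembled into one
  polynomial P in n variables: coefficient number c contributes its monomials times the c-th power
  of variable i. As these monomials are pairwise distinct, P = 0 kills every coefficient.\<close>

lemma algebraically_independent_imp_indep_variables:
  assumes ind: "algebraically_independent n x"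
  shows "indep_variables n x"
  unfolding indep_variables_def transcendental_over_def
proof (intro allI impI)
  fix i q assume i: "i < n" and q: "coeffs_in (generated_subring (x ` ({..<n} - {i}))) q" "Polynomial.poly q (x i) = 0"
  have "\<forall>c. \<exists>p. Polynomial.coeff q c = eval_poly x p \<and>
      (\<forall>\<alpha>\<in>Poly_Mapping.keys p. Poly_Mapping.keys \<alpha> \<subseteq> {..<n} - {i})"
    using q(1) generated_subring_poly_values by (fastforce simp: coeffs_in_def poly_values_def)
  then obtain p where p: "\<And>c. Polynomial.coeff q c = eval_poly x (p c)"
    "\<And>c \<alpha>. \<alpha> \<in> Poly_Mapping.keys (p c) \<Longrightarrow> Poly_Mapping.keys \<alpha> \<subseteq> {..<n} - {i}"
    by metis
  define d where "d = Polynomial.degree q"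
  define K where "K = (SIGMA c:{..d}. Poly_Mapping.keys (p c))"
  define h where "h = (\<lambda>(c :: nat, \<alpha>). \<alpha> + Poly_Mapping.single i c)"
  define P where "P = (\<Sum>(c, \<alpha>)\<in>K. Poly_Mapping.single (h (c, \<alpha>)) (Poly_Mapping.lookup (p c) \<alpha>))"
  have finK: "finite K" by (simp add: K_def)
  have "eval_poly x P = (\<Sum>(c, \<alpha>)\<in>K. of_rat (Poly_Mapping.lookup (p c) \<alpha>) * eval_monomial x \<alpha> * x i ^ c)"
    unfolding P_def eval_poly_sum
    by (intro sum.cong) (auto simp: eval_poly_single h_def eval_monomial_add eval_monomial_single)
  also have "\<dots> = (\<Sum>c\<le>d. \<Sum>\<alpha>\<in>Poly_Mapping.keys (p c). of_rat (Poly_Mapping.lookup (p c) \<alpha>) * eval_monomial x \<alpha> * x i ^ c)"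
    unfolding K_def by (intro sum.Sigma[symmetric]) auto
  also have "\<dots> = (\<Sum>c\<le>d. Polynomial.coeff q c * x i ^ c)"
    by (simp add: p(1) eval_poly_def eval_monomial_def sum_distrib_right)
  also have "\<dots> = 0" using q(2) by (simp add: poly_altdef d_def)
  finally have evP: "eval_poly x P = 0" .
  have hn: "Poly_Mapping.keys (h s) \<subseteq> {..<n}" if sK: "s \<in> K" for s
  proof -
    obtain c \<alpha> where s: "s = (c, \<alpha>)" "\<alpha> \<in> Poly_Mapping.keys (p c)" using sK by (auto simp: K_def)
    have "Poly_Mapping.keys (Poly_Mapping.single i c) \<subseteq> {i}" by simp
    then show ?thesis
      using Poly_Mapping.keys_add[of \<alpha> "Poly_Mapping.single i c"] p(2)[OF s(2)] i by (auto simp: s h_def)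
  qed
  have "\<forall>\<beta>\<in>Poly_Mapping.keys P. Poly_Mapping.keys \<beta> \<subseteq> {..<n}"
  proof
    fix \<beta> assume "\<beta> \<in> Poly_Mapping.keys P"
    then obtain c \<alpha> where "(c, \<alpha>) \<in> K" "\<beta> = h (c, \<alpha>)"
      unfolding P_def by (auto dest!: set_mp[OF keys_sum] split: if_splits prod.splits)
    then show "Poly_Mapping.keys \<beta> \<subseteq> {..<n}" using hn by blast
  qed
  then have P0: "P = 0" using ind evP by (auto simp: algebraically_independent_def)
  have inj: "inj_on h K"
  proof (rule inj_onI, clarify)
    fix c \<alpha> c' \<alpha>' assume K: "(c, \<alpha>) \<in> K" "(c', \<alpha>') \<in> K" and eq: "h (c, \<alpha>) = h (c', \<alpha>')"
    \<comment> \<open>Variable i is absent from \<alpha>, so its exponent in the product recovers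
      c.\<close>
    have "Poly_Mapping.lookup \<alpha> i = 0" "Poly_Mapping.lookup \<alpha>' i = 0"
      using K p(2) by (auto simp: K_def not_in_keys_iff_lookup_eq_zero[symmetric])
    moreover have "Poly_Mapping.lookup (\<alpha> + Poly_Mapping.single i c) i = Poly_Mapping.lookup (\<alpha>' + Poly_Mapping.single i c') i"
      using eq by (simp add: h_def)
    ultimately have "c = c'" by (simp add: lookup_add)
    then show "c = c' \<and> \<alpha> = \<alpha>'" using eq by (simp add: h_def)
  qed
  have "Polynomial.coeff q d = 0"
  proof -
    have "Poly_Mapping.lookup (p d) \<alpha> = 0" for \<alpha>
    proof (rule ccontr)
      assume nz: "Poly_Mapping.lookup (p d) \<alpha> \<noteq> 0"
      then have mem: "(d, \<alpha>) \<in> K" by (simp add: K_def in_keys_iff)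
      have "Poly_Mapping.lookup P (h (d, \<alpha>)) =
          (\<Sum>s\<in>K. if s = (d, \<alpha>) then Poly_Mapping.lookup (p (fst s)) (snd s) else 0)"
        unfolding P_def lookup_sum
      proof (rule sum.cong[OF HOL.refl])
        fix s assume s: "s \<in> K"
        obtain c \<beta> where c: "s = (c, \<beta>)" by (cases s)
        have "h (c, \<beta>) = h (d, \<alpha>) \<longleftrightarrow> s = (d, \<alpha>)"
          using inj_on_eq_iff[OF inj s mem] by (simp add: c)
        then show "Poly_Mapping.lookup (case s of (c, \<alpha>) \<Rightarrow>
              Poly_Mapping.single (h (c, \<alpha>)) (Poly_Mapping.lookup (p c) \<alpha>)) (h (d, \<alpha>)) =
            (if s = (d, \<alpha>) then Poly_Mapping.lookup (p (fst s)) (snd s) else 0)"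
          by (auto simp: c lookup_single when_def)
      qed
      also have "\<dots> = Poly_Mapping.lookup (p d) \<alpha>" using mem finK by simp
      finally show False using P0 nz by simp
    qed
    then have "p d = 0" by (intro poly_mapping_eqI) simp
    then show ?thesis using p(1) by simp
  qed
  then show "q = 0" by (simp add: d_def)
qed

section \<open>Laurent rings of clusters\<close>

lemma generated_subring_empty: "generated_subring {} = (range of_int :: 'a::field set)"
proof
  interpret field_subring "generated_subring ({} :: 'a set)" by (rule generated_subring)
  show "range of_int \<subseteq> generated_subring ({} :: 'a set)" by auto
qed (intro generated_subring_minimal range_of_int_subring, simp)

lemma generated_subring_insert_eq: "generated_subring (insert t A) = adjoin (generated_subring A) t"
  using generated_subring_insert generated_subring_mono[of A "insert t A"] generated_subring_incl[of "insert t A"]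
  by (intro antisym adjoin_minimal generated_subring) auto

text \<open>The induction starts from the integers; the next variable is transcendental because the
  ring built so far lies inside the one generated by all the other variables.\<close>

lemma completely_integrally_closed_generated_subring:
  fixes y :: "nat \<Rightarrow> 'a::field_char_0"
  assumes ind: "indep_variables n y" and "i \<le> n"
  shows "completely_integrally_closed (generated_subring (y ` {..<i}))"
  using \<open>i \<le> n\<close>
proof (induction i)
  case 0
  then show ?case
    by (simp add: generated_subring_empty completely_integrally_closed_range_of_int)
next
  case (Suc i)
  interpret field_subring "generated_subring (y ` {..<i})" by (rule generated_subring)
  have "transcendental_over (generated_subring (y ` {..<i})) (y i)"
  proof (rule transcendental_over_mono)
    show "transcendental_over (generated_subring (y ` ({..<n} - {i}))) (y i)"
      using ind Suc.prems by (simp add: indep_variables_def)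
    show "generated_subring (y ` {..<i}) \<subseteq> generated_subring (y ` ({..<n} - {i}))"
      using Suc.prems by (intro generated_subring_mono image_mono) auto
  qed
  then have "completely_integrally_closed (adjoin (generated_subring (y ` {..<i})) (y i))"
    using Suc by (intro completely_integrally_closed_adjoin) auto
  then show ?case by (simp add: lessThan_Suc generated_subring_insert_eq)
qed

lemma (in field_subring) denominator_subring:
  assumes M: "M \<in> S"
  shows "field_subring {u. \<exists>k. u * M ^ k \<in> S}"
proof
  show "1 \<in> {u. \<exists>k. u * M ^ k \<in> S}" using M by (auto intro!: exI[of _ 0])
  fix u v assume "u \<in> {u. \<exists>k. u * M ^ k \<in> S}" "v \<in> {u. \<exists>k. u * M ^ k \<in> S}"
  then obtain k l where kl: "u * M ^ k \<in> S" "v * M ^ l \<in> S" by auto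
  have "(u - v) * M ^ (k + l) = u * M ^ k * M ^ l - v * M ^ l * M ^ k"
    "u * v * M ^ (k + l) = u * M ^ k * (v * M ^ l)"
    by (simp_all add: algebra_simps power_add)
  then have "(u - v) * M ^ (k + l) \<in> S" "u * v * M ^ (k + l) \<in> S"
    using kl M by (simp_all only: diff_mem mult_mem power_mem)
  then show "u - v \<in> {u. \<exists>k. u * M ^ k \<in> S}" "u * v \<in> {u. \<exists>k. u * M ^ k \<in> S}" by blast+
qed

lemma laurent_ring_subring: "field_subring (laurent_ring n y)"
  unfolding laurent_ring_def by (rule generated_subring)

text \<open>The elements that some power of the product carries into S form a subring, so the
  generators decide: the inverse of a mutable variable times the product is the product of the
  remaining ones. S and m stay general because polynomial rings (m = n) and cluster algebras both
  use it.\<close>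

lemma laurent_ring_denominators:
  assumes S: "field_subring S" and "m \<le> n"
    and y: "\<And>i. i < n \<Longrightarrow> y i \<in> S" "\<And>i. i < n \<Longrightarrow> y i \<noteq> 0"
    and frozen: "\<And>i. m \<le> i \<Longrightarrow> i < n \<Longrightarrow> inverse (y i) \<in> S"
    and u: "u \<in> laurent_ring n y"
  shows "\<exists>k. u * mutable_product m y ^ k \<in> S"
proof -
  interpret field_subring S by (rule S)
  let ?M = "mutable_product m y"
  have M: "?M \<in> S" unfolding mutable_product_def using y \<open>m \<le> n\<close> by (intro prod_mem) auto
  have "laurent_ring n y \<subseteq> {u. \<exists>k. u * ?M ^ k \<in> S}"
    unfolding laurent_ring_def
  proof (intro generated_subring_minimal denominator_subring M Un_least; clarify)
    fix i assume i: "i < n"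
    show "\<exists>k. y i * ?M ^ k \<in> S" using y(1)[OF i] by (intro exI[of _ 0]) simp
    show "\<exists>k. inverse (y i) * ?M ^ k \<in> S"
    proof (cases "i < m")
      case True
      have "inverse (y i) * ?M = (\<Prod>j\<in>{..<m} - {i}. y j)"
        using True y(2)[OF i] by (simp add: mutable_product_def prod.remove[of "{..<m}" i])
      also have "\<dots> \<in> S" using y(1) \<open>m \<le> n\<close> by (intro prod_mem) auto
      finally show ?thesis by (intro exI[of _ 1]) simp
    next
      case False
      then show ?thesis using frozen i by (intro exI[of _ 0]) simp
    qed
  qed
  then show ?thesis using u by blast
qed

lemma normal_laurent_ring:
  fixes y :: "nat \<Rightarrow> 'a::field_char_0"
  assumes ind: "indep_variables n y"
  shows "normal_subring (laurent_ring n y)"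
proof -
  define R where "R = generated_subring (y ` {..<n})"
  interpret R: field_subring R unfolding R_def by (rule generated_subring)
  interpret L: field_subring "laurent_ring n y" by (rule laurent_ring_subring)
  have yR: "y i \<in> R" if "i < n" for i using that by (auto simp: R_def intro: generate_ring.incl)
  have y0: "y i \<noteq> 0" if "i < n" for i by (rule indep_variables_nonzero[OF ind that])
  have inv: "inverse (y i) \<in> laurent_ring n y" if "i < n" for i
    using that by (auto simp: laurent_ring_def intro: generate_ring.incl)
  show ?thesis
  \<comment> \<open>With n in place of m, \<open>mutable_product\<close> is the product of all
    variables, and inverting it gives the Laurent ring.\<close>
  proof (rule R.normal_localization[where M = "mutable_product n y"])
    show "normal_subring R"
      using completely_integrally_closed_generated_subring[OF ind order_refl]
      by (intro R.completely_integrally_closed_imp_normal) (simp add: R_def)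
    show "mutable_product n y \<in> R" unfolding mutable_product_def using yR by (intro R.prod_mem) auto
    show "mutable_product n y \<noteq> 0" using y0 by (simp add: mutable_product_def)
    show "R \<subseteq> laurent_ring n y"
      unfolding R_def laurent_ring_def by (intro generated_subring_mono) auto
    show "inverse (mutable_product n y) \<in> laurent_ring n y"
      unfolding mutable_product_def prod_inversef[symmetric] using inv by (auto intro!: L.prod_mem)
    show "\<exists>k. u * mutable_product n y ^ k \<in> R" if "u \<in> laurent_ring n y" for u
      using that yR y0 by (intro laurent_ring_denominators[of R n n y u] R.field_subring_axioms) auto
  qed (rule laurent_ring_subring)
qed

section \<open>What mutations and permutations preserve\<close>

lemma skew_symmetrizable_diag:
  assumes "skew_symmetrizable m B" "k < m"
  shows "B k k = 0"
proof -
  obtain d where "d k > 0" "d k * B k k = - (d k * B k k)"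
    using assms unfolding skew_symmetrizable_def by blast
  then show ?thesis by simp
qed

lemma exchange_term_even: "even (\<bar>a\<bar> * b + a * \<bar>b\<bar> :: int)"
  by (cases "a \<ge> 0"; cases "b \<ge> 0") (auto simp: abs_if)

text \<open>The same weights d work. Moving the weight from i through k to j changes the sign of
  exactly one factor in each product, since the factors with absolute values satisfy the symmetric
  relation.\<close>

lemma skew_symmetrizable_mutation:
  assumes skew: "skew_symmetrizable m B" and k: "k < m"
  shows "skew_symmetrizable m (snd (mutation n k (x, B)))"
proof -
  obtain d where d: "\<And>i. i < m \<Longrightarrow> d i > 0" "\<And>i j. i < m \<Longrightarrow> j < m \<Longrightarrow> d i * B i j = - (d j * B j i)"
    using skew unfolding skew_symmetrizable_def by blast
  define E where "E i j = \<bar>B i k\<bar> * B k j + B i k * \<bar>B k j\<bar>" for i j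
  have E: "d i * (E i j div 2) = - (d j * (E j i div 2))" if ij: "i < m" "j < m" for i j
  proof -
    have abs: "d a * \<bar>B a b\<bar> = d b * \<bar>B b a\<bar>" if "a < m" "b < m" for a b
    proof -
      have "\<bar>d a * B a b\<bar> = \<bar>d b * B b a\<bar>" using d(2)[OF that] by simp
      then show ?thesis using d(1)[OF that(1)] d(1)[OF that(2)] by (simp add: abs_mult)
    qed
    have "d i * E i j = (d i * \<bar>B i k\<bar>) * B k j + (d i * B i k) * \<bar>B k j\<bar>"
      by (simp add: E_def algebra_simps)
    also have "\<dots> = \<bar>B k i\<bar> * (d k * B k j) - B k i * (d k * \<bar>B k j\<bar>)"
      unfolding abs[OF ij(1) k] d(2)[OF ij(1) k] by (simp add: algebra_simps)
    also have "\<dots> = - (d j * E j i)"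
      unfolding abs[OF k ij(2)] d(2)[OF k ij(2)] by (simp add: E_def algebra_simps)
    finally have "d i * E i j = - (d j * E j i)" .
    \<comment> \<open>Evenness makes the division exact, so the relation for E passes to its
      half.\<close>
    moreover have "E i j = 2 * (E i j div 2)" "E j i = 2 * (E j i div 2)"
      using exchange_term_even[of "B i k" "B k j"] exchange_term_even[of "B j k" "B k i"]
      by (simp_all add: E_def)
    ultimately have "2 * (d i * (E i j div 2)) = 2 * (- (d j * (E j i div 2)))"
      by (metis mult.left_commute mult_minus_right)
    then show ?thesis by simp
  qed
  show ?thesis
    unfolding skew_symmetrizable_def mutation_def
  proof (intro exI[of _ d] conjI allI impI)
    fix i j assume "i < m" "j < m"
    then show "d i * snd (case (x, B) of (x, B) \<Rightarrow>
        (x(k := ((\<Prod>j | j < n \<and> B j k > 0. x j ^ nat (B j k)) +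
              (\<Prod>j | j < n \<and> B j k < 0. x j ^ nat (- B j k))) * inverse (x k)),
         \<lambda>i j. if i = k \<or> j = k then - B i j else B i j + (\<bar>B i k\<bar> * B k j + B i k * \<bar>B k j\<bar>) div 2)) i j =
      - (d j * snd (case (x, B) of (x, B) \<Rightarrow>
        (x(k := ((\<Prod>j | j < n \<and> B j k > 0. x j ^ nat (B j k)) +
              (\<Prod>j | j < n \<and> B j k < 0. x j ^ nat (- B j k))) * inverse (x k)),
         \<lambda>i j. if i = k \<or> j = k then - B i j else B i j + (\<bar>B i k\<bar> * B k j + B i k * \<bar>B k j\<bar>) div 2)) j i)"
      using d(2)[of i j] E[of i j] by (auto simp: E_def distrib_left)
  qed (use d in auto)
qed

text \<open>The zero diagonal entry keeps x k out of the exchange binomial. The two monomials have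
  disjoint supports, since an entry of B has only one sign, so a nonzero entry gives a variable
  occurring in just one of them.\<close>

lemma indep_variables_mutation:
  assumes ind: "indep_variables n x" and k: "k < n" and diag: "B k k = 0"
  shows "indep_variables n (fst (mutation n k (x, B)))"
proof -
  let ?A = "{j. j < n \<and> B j k > 0}" and ?A' = "{j. j < n \<and> B j k < 0}"
  define P where "P = (\<Prod>j\<in>?A. x j ^ nat (B j k)) + (\<Prod>j\<in>?A'. x j ^ nat (- B j k))"
  interpret field_subring "generated_subring (x ` ({..<n} - {k}))" by (rule generated_subring)
  have mem: "x j \<in> generated_subring (x ` ({..<n} - {k}))" if "j < n" "j \<noteq> k" for j
    using that by (auto intro!: generate_ring.incl)
  have "P \<in> generated_subring (x ` ({..<n} - {k}))"
    unfolding P_def using diag by (intro add_mem prod_mem power_mem mem) auto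
  moreover have "P \<noteq> 0"
  proof (cases "\<exists>i<n. B i k \<noteq> 0")
    case False
    then have "?A = {}" "?A' = {}" by force+
    \<comment> \<open>For a zero column both products are empty, and characteristic zero makes the
      sum nonzero.\<close>
    then have "P = 1 + 1" unfolding P_def by (simp only: prod.empty)
    then show ?thesis by simp
  next
    case True
    then obtain i where i: "i < n" "B i k \<noteq> 0" by blast
    then consider "B i k > 0" | "B i k < 0" by linarith
    then show ?thesis
    proof cases
      case 1
      then show ?thesis
        unfolding P_def using i by (intro indep_variables_binomial_nonzero[OF ind, of _ _ i]) auto
    next
      case 2
      have "(\<Prod>j\<in>?A'. x j ^ nat (- B j k)) + (\<Prod>j\<in>?A. x j ^ nat (B j k)) \<noteq> 0"
        using i 2 by (intro indep_variables_binomial_nonzero[OF ind, of _ _ i]) auto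
      then show ?thesis unfolding P_def by (simp only: add.commute not_False_eq_True)
    qed
  qed
  ultimately have "indep_variables n (x(k := P * inverse (x k)))"
    by (rule indep_variables_exchange[OF ind k])
  then show ?thesis by (simp add: mutation_def P_def)
qed

text \<open>Skew-symmetrizability is carried along because it yields the zero diagonal required by
  the exchange. Frozen variables are tracked as a set, since permutations may reorder them.\<close>

lemma mutation_equivalent_invariants:
  assumes "mutation_equivalent n m (x, B) t" and "m \<le> n"
    and "indep_variables n x" "skew_symmetrizable m B"
  shows "indep_variables n (fst t) \<and> skew_symmetrizable m (snd t) \<and>
    fst t ` {m..<n} = x ` {m..<n}"
  using assms(1)
proof (induction rule: mutation_equivalent.induct)
  case refl
  then show ?case using assms by simp
next
  case (mutate t k)
  obtain y C where t: "t = (y, C)" by (cases t)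
  have "fst (mutation n k t) ` {m..<n} = y ` {m..<n}"
    using mutate.hyps by (auto simp: t mutation_def)
  then show ?case
    using mutate indep_variables_mutation[of n y k C] skew_symmetrizable_mutation[of m C k n y]
      skew_symmetrizable_diag[of m C k] assms(2)
    by (auto simp: t)
next
  case (permute t \<sigma>)
  obtain y C where t: "t = (y, C)" by (cases t)
  have im: "\<sigma> ` {m..<n} = {m..<n}"
  proof -
    have eq: "{m..<n} = {..<n} - {..<m}" by auto
    show ?thesis
      unfolding eq image_set_diff[OF permutes_inj[OF permute.hyps(2)]]
        permutes_image[OF permute.hyps(2)] permute.hyps(3) ..
  qed
  have "fst (permute_seed \<sigma> t) ` {m..<n} = y ` \<sigma> ` {m..<n}"
    by (auto simp: t permute_seed_def)
  moreover have "skew_symmetrizable m (\<lambda>i j. C (\<sigma> i) (\<sigma> j))"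
  proof -
    obtain d where d: "\<And>i. i < m \<Longrightarrow> d i > 0" "\<And>i j. i < m \<Longrightarrow> j < m \<Longrightarrow> d i * C i j = - (d j * C j i)"
      using permute.IH unfolding skew_symmetrizable_def t snd_conv by blast
    have "\<sigma> i < m" if "i < m" for i using permute.hyps(3) that by blast
    then show ?thesis
      unfolding skew_symmetrizable_def using d by (intro exI[of _ "\<lambda>i. d (\<sigma> i)"]) blast
  qed
  ultimately show ?case
    using permute indep_variables_permute[of n y \<sigma>] im by (simp add: t permute_seed_def)
qed

section \<open>Cluster algebras\<close>

lemma cluster_algebra_mem:
  assumes "y \<in> clusters n m s" "i < n"
  shows "y i \<in> cluster_algebra n m s"
  unfolding cluster_algebra_def using assms by (intro generate_ring.incl) blast

locale cluster_structure =
  fixes n m :: nat and x :: "nat \<Rightarrow> 'a::field_char_0" and B :: "nat \<Rightarrow> nat \<Rightarrow> int"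
  assumes seed: "ordered_seed n m (x, B)"
begin

lemma mutable_le: "m \<le> n"
  using seed by (simp add: ordered_seed_def)

lemma cluster_indep:
  assumes "y \<in> clusters n m (x, B)"
  shows "indep_variables n y" and "y ` {m..<n} = x ` {m..<n}"
proof -
  obtain C where "mutation_equivalent n m (x, B) (y, C)" using assms by (auto simp: clusters_def)
  moreover have "indep_variables n x" "skew_symmetrizable m B"
    using seed algebraically_independent_imp_indep_variables
    by (auto simp: ordered_seed_def freely_generates_def)
  ultimately show "indep_variables n y" "y ` {m..<n} = x ` {m..<n}"
    using mutation_equivalent_invariants[of n m x B "(y, C)"] mutable_le by auto
qed

lemma mutable_product_nonzero: "y \<in> clusters n m (x, B) \<Longrightarrow> mutable_product m y \<noteq> 0"
  using indep_variables_nonzero[OF cluster_indep(1)] mutable_le by (auto simp: mutable_product_def)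

lemma inverse_mutable_product:
  assumes "y \<in> clusters n m (x, B)"
  shows "inverse (mutable_product m y) \<in> laurent_ring n y"
proof -
  interpret L: field_subring "laurent_ring n y" by (rule laurent_ring_subring)
  have "inverse (y i) \<in> laurent_ring n y" if "i < m" for i
    using that mutable_le by (auto simp: laurent_ring_def intro!: generate_ring.incl)
  then show ?thesis
    unfolding mutable_product_def prod_inversef[symmetric] by (auto intro!: L.prod_mem)
qed

lemma cluster_algebra_subring: "field_subring (cluster_algebra n m (x, B))"
  unfolding cluster_algebra_def by (rule generated_subring)

lemma mutable_product_mem:
  assumes "y \<in> clusters n m (x, B)"
  shows "mutable_product m y \<in> cluster_algebra n m (x, B)"
proof -
  interpret A: field_subring "cluster_algebra n m (x, B)" by (rule cluster_algebra_subring)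
  show ?thesis
    unfolding mutable_product_def using cluster_algebra_mem[OF assms] mutable_le
    by (intro A.prod_mem) auto
qed

lemma laurent_ring_cluster_denominators:
  assumes y: "y \<in> clusters n m (x, B)" and u: "u \<in> laurent_ring n y"
  shows "\<exists>k. u * mutable_product m y ^ k \<in> cluster_algebra n m (x, B)"
proof (rule laurent_ring_denominators[OF cluster_algebra_subring mutable_le _ _ _ u])
  fix i assume i: "i < n"
  show "y i \<in> cluster_algebra n m (x, B)" by (rule cluster_algebra_mem[OF y i])
  show "y i \<noteq> 0" by (rule indep_variables_nonzero[OF cluster_indep(1)[OF y] i])
  assume "m \<le> i"
  \<comment> \<open>Only the inverses of the initial frozen variables are generators; those of the
    cluster are the same up to order.\<close>
  then have "y i \<in> x ` {m..<n}" using cluster_indep(2)[OF y] i by auto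
  then obtain j where "j \<in> {m..<n}" "y i = x j" by auto
  then show "inverse (y i) \<in> cluster_algebra n m (x, B)"
    unfolding cluster_algebra_def by (intro generate_ring.incl) auto
qed

text \<open>The inclusion from left to right uses that S contains the cluster algebra, where powers
  of the product clear Laurent denominators. The converse uses that S lies in every Laurent ring,
  where the product is invertible.\<close>

lemma upper_cluster_algebra_eq_overring:
  assumes S: "field_subring S" "cluster_algebra n m (x, B) \<subseteq> S" "S \<subseteq> upper_cluster_algebra n m (x, B)"
  shows "upper_cluster_algebra n m (x, B) = field_subring.overring S (mutable_product m ` clusters n m (x, B))"
proof -
  interpret field_subring S by (rule S)
  show ?thesis
  proof (intro equalityI subsetI)
    fix u assume "u \<in> upper_cluster_algebra n m (x, B)"
    then show "u \<in> overring (mutable_product m ` clusters n m (x, B))"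
      using laurent_ring_cluster_denominators S(2)
      by (fastforce simp: overring_def upper_cluster_algebra_def)
  next
    fix u assume u: "u \<in> overring (mutable_product m ` clusters n m (x, B))"
    show "u \<in> upper_cluster_algebra n m (x, B)"
      unfolding upper_cluster_algebra_def
    proof
      fix y assume y: "y \<in> clusters n m (x, B)"
      interpret L: field_subring "laurent_ring n y" by (rule laurent_ring_subring)
      obtain k where k: "u * mutable_product m y ^ k \<in> S" using u y by (auto simp: overring_def)
      have "u * mutable_product m y ^ k \<in> laurent_ring n y"
        using k S(3) y by (auto simp: upper_cluster_algebra_def)
      then have "u * mutable_product m y ^ k * inverse (mutable_product m y) ^ k \<in> laurent_ring n y"
        using inverse_mutable_product[OF y] by simp
      then show "u \<in> laurent_ring n y"
        using mutable_product_nonzero[OF y] by (simp add: mult.assoc flip: power_mult_distrib)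
    qed
  qed
qed

text \<open>The ideal of S generated by the products meets the cluster algebra in an ideal, which
  therefore contains the deep ideal; extending to S adds nothing new.\<close>

lemma genideal_deep_ideal:
  assumes S: "field_subring S" "cluster_algebra n m (x, B) \<subseteq> S"
  shows "genideal (ring_on S) (deep_ideal n m (x, B))
    = genideal (ring_on S) (mutable_product m ` clusters n m (x, B))"
proof -
  interpret S: field_subring S by (rule S)
  interpret A: field_subring "cluster_algebra n m (x, B)" by (rule cluster_algebra_subring)
  let ?G = "mutable_product m ` clusters n m (x, B)"
  have GA: "?G \<subseteq> cluster_algebra n m (x, B)" using mutable_product_mem by auto
  then have GS: "?G \<subseteq> S" using S by auto
  have id: "ideal (genideal (ring_on S) ?G) (ring_on S)" using GS by (intro S.R.genideal_ideal) auto
  have "ideal (genideal (ring_on S) ?G \<inter> cluster_algebra n m (x, B)) (ring_on (cluster_algebra n m (x, B)))"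
    unfolding A.ideal_iff using S.idealD(2-4)[OF id] S(2) by auto
  moreover have GI: "?G \<subseteq> genideal (ring_on S) ?G" using GS by (intro S.R.genideal_self) auto
  ultimately have "deep_ideal n m (x, B) \<subseteq> genideal (ring_on S) ?G"
    unfolding deep_ideal_def using A.R.genideal_minimal GA by (metis le_inf_iff)
  moreover have "?G \<subseteq> deep_ideal n m (x, B)"
    unfolding deep_ideal_def using GA by (intro A.R.genideal_self) auto
  moreover have "deep_ideal n m (x, B) \<subseteq> S"
    using \<open>deep_ideal n m (x, B) \<subseteq> genideal (ring_on S) ?G\<close> S.idealD(1)[OF id] by blast
  ultimately show ?thesis
    using S.R.genideal_ideal[of "deep_ideal n m (x, B)"] S.R.genideal_self[of "deep_ideal n m (x, B)"]
    by (intro equalityI S.genideal_minimal' id) auto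
qed

text \<open>Being a fraction and being integral both persist in a larger ring, so normality passes
  from the Laurent rings to their intersection.\<close>

lemma normal_upper_cluster_algebra: "normal_subring (upper_cluster_algebra n m (x, B))"
  unfolding normal_subring_def
proof (intro ballI impI)
  fix z assume z: "z \<in> fractions (upper_cluster_algebra n m (x, B))"
    "integral_over (upper_cluster_algebra n m (x, B)) z"
  have "z \<in> laurent_ring n y" if y: "y \<in> clusters n m (x, B)" for y
  proof -
    have "upper_cluster_algebra n m (x, B) \<subseteq> laurent_ring n y"
      using y by (auto simp: upper_cluster_algebra_def)
    then have "z \<in> fractions (laurent_ring n y)" "integral_over (laurent_ring n y) z"
      using z unfolding fractions_def integral_over_def by blast+
    then show ?thesis
      using normal_laurent_ring[OF cluster_indep(1)[OF y]] by (auto simp: normal_subring_def)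
  qed
  then show "z \<in> upper_cluster_algebra n m (x, B)" by (simp add: upper_cluster_algebra_def)
qed

end

theorem lemma1p2p1:
  fixes n m :: nat
    and x y :: "nat \<Rightarrow> 'a::field_char_0"
    and B :: "nat \<Rightarrow> nat \<Rightarrow> int"
    and S :: "'a set"
  assumes "ordered_seed n m (x, B)"
    and "subring S ring_of_type_algebra"
    and "noetherian_ring (ring_on S)"
    and "cluster_algebra n m (x, B) \<subseteq> S"
    and "S \<subseteq> upper_cluster_algebra n m (x, B)"
    and "y \<in> clusters n m (x, B)"
  shows "let U = upper_cluster_algebra n m (x, B);
             SD = genideal (ring_on S) (deep_ideal n m (x, B));
             f = mutable_product m y;
             Sf = cgenideal (ring_on S) f;
             sat = saturation (ring_on S) Sf SD
         in (S = U \<longleftrightarrow> normal_subring S \<and> codim (ring_on S) SD \<ge> 2) \<and>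
            (S = U \<longleftrightarrow> serre_S 2 S \<and> codim (ring_on S) SD \<ge> 2) \<and>
            (S = U \<longleftrightarrow>
               trivial_group (Ext1 (ring_on S) (quotient_module (ring_on S) SD) (self_module (ring_on S)))) \<and>
            (S = U \<longleftrightarrow> Sf = sat) \<and>
            (Sf \<noteq> sat \<longrightarrow> (\<exists>r \<in> sat. r * inverse f \<in> U \<and> r * inverse f \<notin> S))"
proof -
  interpret cluster_structure n m x B by unfold_locales (rule assms(1))
  interpret S: field_subring S using assms(2) by (simp add: field_subring_iff)
  note noeth = assms(3)
  define U where "U = upper_cluster_algebra n m (x, B)"
  define G where "G = mutable_product m ` clusters n m (x, B)"
  define I where "I = genideal (ring_on S) G"
  define f where "f = mutable_product m y"
  have U: "U = S.overring G"
    unfolding U_def G_def using assms(4,5)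
    by (intro upper_cluster_algebra_eq_overring S.field_subring_axioms)
  have I: "genideal (ring_on S) (deep_ideal n m (x, B)) = I"
    unfolding I_def G_def using assms(4) by (intro genideal_deep_ideal S.field_subring_axioms)
  have G: "G \<subseteq> S" "f \<in> G" "0 \<notin> G"
    unfolding G_def f_def using assms(4,6) mutable_product_mem mutable_product_nonzero by force+
  then have "f \<noteq> 0" by auto
  have "f \<in> I" and Iid: "ideal I (ring_on S)"
    unfolding I_def using G S.R.genideal_self[of G] S.R.genideal_ideal[of G] by auto
  have codim: "2 \<le> codim (ring_on S) I" if "S = U"
    unfolding I_def using that U by (intro S.codim_ge_2_of_eq_overring[OF noeth G(1,2) \<open>f \<noteq> 0\<close>]) metis
  have normal: "normal_subring S" if "S = U"
    unfolding that unfolding U_def by (rule normal_upper_cluster_algebra)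
  have S2: "S = U" if "serre_S 2 S" "2 \<le> codim (ring_on S) I"
    unfolding U using that by (intro S.serre_S2_imp_eq_overring[OF noeth G(1)]) (simp_all add: I_def)
  have "trivial_group (Ext1 (ring_on S) (quotient_module (ring_on S) I) (self_module (ring_on S))) \<longleftrightarrow> S = U"
    using S.Ext1_quotient_trivial_iff[OF Iid \<open>f \<in> I\<close> \<open>f \<noteq> 0\<close>]
      S.eq_overring_iff_no_denominators[OF noeth G(1), folded U I_def] by (rule trans[OF _ sym])
  moreover note S.saturation_eq_iff[OF G, folded I_def, folded U]
  \<comment> \<open>The first two equivalences close in a cycle: S = U gives normality and the
    codimension bound, normality gives S2, and S2 with the bound gives S = U.\<close>
  moreover note S.normal_imp_serre_S2[OF noeth] codim normal S2
  ultimately show ?thesis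
    unfolding Let_def I U_def[symmetric] f_def[symmetric] by blast
qed

end
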